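(* Let $b$ be a prime, $\alpha>1$, let $(\gamma_{\mathfrak{u}})$ be positive weights indexed by the finite subsets $\mathfrak{u}\subset\mathbb{N}$ with $\gamma_\emptyset=1$, and let $0\le w_1\le w_2\le\cdots$ be integers. For $s,m\in\mathbb{N}$ and $N=b^m$ let $\boldsymbol{z}\in\mathbb{Z}^s$ be constructed by the reduced CBC construction (described in the context). 1. For all $s,m\in\mathbb{N}$, $N=b^m$, and all $\delta\in(0,\frac{\alpha-1}{2}]$ we have $e_{N,s}(\boldsymbol{z})\le c_{s,\alpha,\boldsymbol{\gamma},\delta,\boldsymbol{w}}\,N^{-\alpha/2+\delta}$, where $$c_{s,\alpha,\boldsymbol{\gamma},\delta,\boldsymbol{w}}=\left(2\sum_{\emptyset\ne\mathfrak{u}\subseteq[s]}\gamma_{\mathfrak{u}}^{\frac{1}{\alpha-2\delta}}\left(2\zeta\left(\tfrac{\alpha}{\alpha-2\delta}\right)\right)^{|\mathfrak{u}|}b^{\max_{j\in\mathfrak{u}}w_j}\right)^{\alpha/2-\delta}.$$ 2. For $\delta\in(0,\frac{\alpha-1}{2}]$ and $q\ge0$ define $$C_{\delta,q}:=\sup_{s\in\mathbb{N}}\left[\frac{1}{s^q}\sum_{\emptyset\ne\mathfrak{u}\subseteq[s]}\gamma_{\mathfrak{u}}^{\frac{1}{\alpha-2\delta}}\left(2\zeta\left(\tfrac{\alpha}{\alpha-2\delta}\right)\right)^{|\mathfrak{u}|}b^{\max_{j\in\mathfrak{u}}w_j}\right].$$ (a) If $C_{\delta,q}<\infty$ for some $\delta\in(0,\frac{\alpha-1}{2}]$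 and some $q\ge0$, then $e_{N,s}(\boldsymbol{z})\le(2s^qC_{\delta,q})^{\alpha/2-\delta}N^{-\alpha/2+\delta}$ for all $s,m\in\mathbb{N}$, $N=b^m$. In particular, the integration problem is polynomially QMC-tractable with $\varepsilon$-exponent at most $\frac{2}{\alpha-2\delta}$ and $s$-exponent at most $q$. (b) If $C_{\delta,0}<\infty$ for some $\delta\in(0,\frac{\alpha-1}{2}]$, then $e_{N,s}(\boldsymbol{z})\le(2C_{\delta,0})^{\alpha/2-\delta}N^{-\alpha/2+\delta}$ for all $s,m\in\mathbb{N}$, $N=b^m$. In particular, the integration problem is strongly polynomially QMC-tractable with $\varepsilon$-exponent at most $\frac{2}{\alpha-2\delta}$. (c) If $$\lim_{s\to\infty}\frac{\log\left(\sum_{\emptyset\ne\mathfrak{u}\subseteq[s]}\gamma_{\mathfrak{u}}(2\zeta(\alpha))^{|\mathfrak{u}|}b^{\max_{j\in\mathfrak{u}}w_j}\right)}{s}=0,$$ then the integration problem is weakly QMC-tractable.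
   Context: Notation: $[s]=\{1,\ldots,s\}$, $\mathbb{Z}_*=\mathbb{Z}\setminus\{0\}$, $\zeta(x)=\sum_{n\ge1}n^{-x}$ for $x>1$, $\boldsymbol{x}_{\mathfrak{u}}=(x_j)_{j\in\mathfrak{u}}$. Weighted Korobov space: for $s\in\mathbb{N}$, $\mathcal{H}_s=\mathcal{H}(K_{s,\alpha,\boldsymbol{\gamma}})$ is the reproducing kernel Hilbert space of functions on $[0,1]^s$ with kernel $$K_{s,\alpha,\boldsymbol{\gamma}}(\boldsymbol{x},\boldsymbol{y})=1+\sum_{\emptyset\ne\mathfrak{u}\subseteq[s]}\gamma_{\mathfrak{u}}\sum_{\boldsymbol{h}_{\mathfrak{u}}\in\mathbb{Z}_*^{|\mathfrak{u}|}}\frac{\exp(2\pi\mathrm{i}\,\boldsymbol{h}_{\mathfrak{u}}\cdot(\boldsymbol{x}_{\mathfrak{u}}-\boldsymbol{y}_{\mathfrak{u}}))}{\prod_{j\in\mathfrak{u}}|h_j|^{\alpha}}.$$ Worst-case errors: for an $N$-element point set (multiset) $\mathcal{P}$ in $[0,1]^s$, $e_{N,s}(\mathcal{H}_s,\mathcal{P})=\sup_{\|f\|_{\mathcal{H}_s}\le1}\left|\int_{[0,1]^s}f(\boldsymbol{x})\,\mathrm{d}\boldsymbol{x}-\frac1N\sum_{\boldsymbol{x}\in\mathcal{P}}f(\boldsymbol{x})\right|$. For $\boldsymbol{z}\in\mathbb{Z}^s$, $e_{N,s}(\boldsymbol{z})$ denotes this error for the lattice point set $\{\frac{k}{N}\boldsymbol{z}\}$,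 $k=0,\ldots,N-1$ (componentwise fractional parts). It is known that $$e_{N,s}^2(\boldsymbol{z})=\sum_{\emptyset\ne\mathfrak{u}\subseteq[s]}\gamma_{\mathfrak{u}}\sum_{\boldsymbol{h}_{\mathfrak{u}}\in\mathcal{D}_{\mathfrak{u}}}\prod_{j\in\mathfrak{u}}|h_j|^{-\alpha},\qquad \mathcal{D}_{\mathfrak{u}}=\{\boldsymbol{h}_{\mathfrak{u}}\in\mathbb{Z}_*^{|\mathfrak{u}|}:\boldsymbol{h}_{\mathfrak{u}}\cdot\boldsymbol{z}_{\mathfrak{u}}\equiv0\pmod N\}.$$ Reduced CBC construction ($N=b^m$): put $\mathcal{Z}_{N,w_j}=\{z\in\{1,2,\ldots,b^{m-w_j}-1\}:\gcd(z,N)=1\}$ if $w_j<m$ and $\mathcal{Z}_{N,w_j}=\{1\}$ if $w_j\ge m$; $Y_j=b^{w_j}$. Set $z_1=1$. For $d=1,\ldots,s-1$ successively, given $z_1,\ldots,z_d$, choose $z_{d+1}\in\mathcal{Z}_{N,w_{d+1}}$ minimizing $e_{N,d+1}^2((Y_1z_1,\ldots,Y_dz_d,Y_{d+1}z_{d+1}))$ as a function of $z_{d+1}$. The output is $\boldsymbol{z}=(Y_1z_1,\ldots,Y_sz_s)$. Tractability: let $e(N,s)=\inf_{\mathcal{P}}e_{N,s}(\mathcal{H}_s,\mathcal{P})$ over all $N$-element point sets in $[0,1]^s$, $e(0,s)=\sup_{\|f\|_{\mathcal{H}_s}\le1}|\int_{[0,1]^s}f(\boldsymbol{x})\,\mathrm{d}\boldsymbol{x}|$,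 and $N_{\min}(\varepsilon,s)=\min\{N\in\mathbb{N}:e(N,s)\le\varepsilon\,e(0,s)\}$ for $\varepsilon\in(0,1)$, $s\in\mathbb{N}$. The integration problem (in the spaces $\mathcal{H}_s$, $s\in\mathbb{N}$) is: weakly QMC-tractable if $\lim_{s+\varepsilon^{-1}\to\infty}\frac{\log N_{\min}(\varepsilon,s)}{s+\varepsilon^{-1}}=0$; polynomially QMC-tractable if there are $c,p,q\ge0$ with $N_{\min}(\varepsilon,s)\le c\,s^q\varepsilon^{-p}$ for all $\varepsilon,s$; strongly polynomially QMC-tractable if this holds with $q=0$. Exponents are understood as infima: strong polynomial tractability has $\varepsilon$-exponent equal to the infimum of all $p$ for which the bound holds with $q=0$ (and some $c$); polynomial tractability with $\varepsilon$-exponent at most $p_0$ and $s$-exponent at most $q_0$ means that for all $p>p_0$, $q>q_0$ there is $c$ with $N_{\min}(\varepsilon,s)\le c\,s^q\varepsilon^{-p}$ for all $\varepsilon,s$. *)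

theory Defs
  imports "HOL-Analysis.Analysis" "HOL-Library.Multiset"
begin

section \<open>Reproducing kernel Hilbert spaces\<close>

definition ip_norm :: "(('x \<Rightarrow> complex) \<Rightarrow> ('x \<Rightarrow> complex) \<Rightarrow> complex) \<Rightarrow> ('x \<Rightarrow> complex) \<Rightarrow> real"
  where "ip_norm ip f = sqrt (Re (ip f f))"

text \<open>
  A complex Hilbert space \<open>H\<close> of functions on \<open>X\<close>, with inner product \<open>ip\<close> (linear in the first
  argument), having reproducing kernel \<open>K\<close>. A function on \<open>X\<close> is represented by its extension
  by 0 to the whole type, so that equality of members of \<open>H\<close> is equality on \<open>X\<close>. By the
  Moore--Aronszajn theorem, \<open>K\<close> determines \<open>H\<close> and the values of \<open>ip\<close> on \<open>H\<close>.
\<close>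

locale rkhs =
  fixes X :: "'x set"
    and K :: "'x \<Rightarrow> 'x \<Rightarrow> complex"
    and H :: "('x \<Rightarrow> complex) set"
    and ip :: "('x \<Rightarrow> complex) \<Rightarrow> ('x \<Rightarrow> complex) \<Rightarrow> complex"
  assumes zero_outside: "\<And>f x. f \<in> H \<Longrightarrow> x \<notin> X \<Longrightarrow> f x = 0"
    and zero_mem: "(\<lambda>x. 0) \<in> H"
    and add_mem: "\<And>f g. f \<in> H \<Longrightarrow> g \<in> H \<Longrightarrow> (\<lambda>x. f x + g x) \<in> H"
    and scale_mem: "\<And>c f. f \<in> H \<Longrightarrow> (\<lambda>x. c * f x) \<in> H"
    and ip_add_left: "\<And>f g h. f \<in> H \<Longrightarrow> g \<in> H \<Longrightarrow> h \<in> H \<Longrightarrow>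
      ip (\<lambda>x. f x + g x) h = ip f h + ip g h"
    and ip_scale_left: "\<And>c f h. f \<in> H \<Longrightarrow> h \<in> H \<Longrightarrow> ip (\<lambda>x. c * f x) h = c * ip f h"
    and ip_commute: "\<And>f g. f \<in> H \<Longrightarrow> g \<in> H \<Longrightarrow> ip f g = cnj (ip g f)"
    and ip_self_nonneg: "\<And>f. f \<in> H \<Longrightarrow> 0 \<le> Re (ip f f)"
    and ip_self_eq_0: "\<And>f. f \<in> H \<Longrightarrow> ip f f = 0 \<Longrightarrow> f = (\<lambda>x. 0)"
    and complete: "\<And>F :: nat \<Rightarrow> 'x \<Rightarrow> complex.
      (\<And>n. F n \<in> H) \<Longrightarrow>
      (\<And>e. e > 0 \<Longrightarrow> \<exists>M. \<forall>m\<ge>M. \<forall>n\<ge>M. ip_norm ip (\<lambda>x. F m x - F n x) < e) \<Longrightarrow>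
      \<exists>f\<in>H. (\<lambda>n. ip_norm ip (\<lambda>x. F n x - f x)) \<longlonglongrightarrow> 0"
    and kernel_mem: "\<And>y. y \<in> X \<Longrightarrow> (\<lambda>x. if x \<in> X then K x y else 0) \<in> H"
    and reproducing: "\<And>f y. f \<in> H \<Longrightarrow> y \<in> X \<Longrightarrow>
      f y = ip f (\<lambda>x. if x \<in> X then K x y else 0)"

section \<open>Weighted Korobov spaces\<close>

text \<open>The cube \<open>[0,1]\<^sup>s\<close>, with coordinates indexed by \<open>1,\<dots>,s\<close>, and Lebesgue measure on it.\<close>

definition unit_cube :: "nat \<Rightarrow> (nat \<Rightarrow> real) set"
  where "unit_cube s = PiE {1..s} (\<lambda>_. {0..1})"

definition cube_measure :: "nat \<Rightarrow> (nat \<Rightarrow> real) measure"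
  where "cube_measure s = PiM {1..s} (\<lambda>_. restrict_space lborel {0..1})"

definition korobov_kernel ::
    "real \<Rightarrow> (nat set \<Rightarrow> real) \<Rightarrow> nat \<Rightarrow> (nat \<Rightarrow> real) \<Rightarrow> (nat \<Rightarrow> real) \<Rightarrow> complex"
  where "korobov_kernel \<alpha> \<gamma> s x y =
    1 + (\<Sum>u\<in>Pow {1..s} - {{}}. of_real (\<gamma> u) *
          (\<Sum>\<^sub>\<infinity>h\<in>PiE u (\<lambda>_. - {0::int}).
             exp (2 * of_real pi * \<i> * of_real (\<Sum>j\<in>u. of_int (h j) * (x j - y j))) /
             of_real (\<Prod>j\<in>u. \<bar>real_of_int (h j)\<bar> powr \<alpha>)))"

definition zeta :: "real \<Rightarrow> real"
  where "zeta x = (\<Sum>n. real (Suc n) powr (- x))"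

section \<open>Worst-case errors\<close>

text \<open>
  In the following, \<open>H\<close> and \<open>ip\<close> are sequences of function spaces and inner products; the
  functions in \<open>H s\<close> live on \<open>unit_cube s\<close>. Point sets are multisets, counted with multiplicity.
\<close>

type_synonym spaces = "nat \<Rightarrow> ((nat \<Rightarrow> real) \<Rightarrow> complex) set"
type_synonym inner_products =
  "nat \<Rightarrow> ((nat \<Rightarrow> real) \<Rightarrow> complex) \<Rightarrow> ((nat \<Rightarrow> real) \<Rightarrow> complex) \<Rightarrow> complex"

definition unit_ball :: "spaces \<Rightarrow> inner_products \<Rightarrow> nat \<Rightarrow> ((nat \<Rightarrow> real) \<Rightarrow> complex) set"
  where "unit_ball H ip s = {f \<in> H s. ip_norm (ip s) f \<le> 1}"

definition wce :: "spaces \<Rightarrow> inner_products \<Rightarrow> nat \<Rightarrow> (nat \<Rightarrow> real) multiset \<Rightarrow> real"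
  where "wce H ip s P =
    (SUP f\<in>unit_ball H ip s.
       cmod ((LINT x|cube_measure s. f x) - (1 / of_nat (size P)) * (\<Sum>x\<in>#P. f x)))"

definition lattice_points :: "nat \<Rightarrow> nat \<Rightarrow> (nat \<Rightarrow> int) \<Rightarrow> (nat \<Rightarrow> real) multiset"
  where "lattice_points s N z =
    image_mset (\<lambda>k. \<lambda>j\<in>{1..s}. frac (real k / real N * of_int (z j))) (mset_set {0..<N})"

definition lattice_wce ::
    "spaces \<Rightarrow> inner_products \<Rightarrow> nat \<Rightarrow> nat \<Rightarrow> (nat \<Rightarrow> int) \<Rightarrow> real"
  where "lattice_wce H ip N s z = wce H ip s (lattice_points s N z)"

section \<open>The reduced component-by-component construction\<close>

definition reduced_candidates :: "nat \<Rightarrow> nat \<Rightarrow> nat \<Rightarrow> int set"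
  where "reduced_candidates b m wj =
    (if wj < m then {z. 1 \<le> z \<and> z \<le> int b ^ (m - wj) - 1 \<and> gcd z (int b ^ m) = 1} else {1})"

definition scaled_vector :: "nat \<Rightarrow> (nat \<Rightarrow> nat) \<Rightarrow> (nat \<Rightarrow> int) \<Rightarrow> nat \<Rightarrow> int"
  where "scaled_vector b w v j = int b ^ w j * v j"

text \<open>
  \<open>z\<close> is a possible output of the construction (minimizers need not be unique). Only the
  components \<open>z 1, \<dots>, z s\<close> of \<open>z\<close> matter, as \<open>lattice_wce H ip N d\<close> only uses components
  \<open>1, \<dots>, d\<close> of its argument.
\<close>

definition reduced_cbc ::
    "spaces \<Rightarrow> inner_products \<Rightarrow> nat \<Rightarrow> (nat \<Rightarrow> nat) \<Rightarrow> nat \<Rightarrow> nat \<Rightarrow> (nat \<Rightarrow> int) \<Rightarrow> bool"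
  where "reduced_cbc H ip b w m s z \<longleftrightarrow>
    (\<exists>v. v 1 = 1 \<and>
         (\<forall>d\<in>{1..<s}.
            is_arg_min
              (\<lambda>t. (lattice_wce H ip (b ^ m) (d + 1) (scaled_vector b w (v(d + 1 := t))))\<^sup>2)
              (\<lambda>t. t \<in> reduced_candidates b m (w (d + 1)))
              (v (d + 1))) \<and>
         (\<forall>j\<in>{1..s}. z j = scaled_vector b w v j))"

section \<open>Tractability\<close>

definition min_error :: "spaces \<Rightarrow> inner_products \<Rightarrow> nat \<Rightarrow> nat \<Rightarrow> real"
  where "min_error H ip N s = (INF P\<in>{P. size P = N \<and> set_mset P \<subseteq> unit_cube s}. wce H ip s P)"

definition initial_error :: "spaces \<Rightarrow> inner_products \<Rightarrow> nat \<Rightarrow> real"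
  where "initial_error H ip s = (SUP f\<in>unit_ball H ip s. cmod (LINT x|cube_measure s. f x))"

definition N_min :: "spaces \<Rightarrow> inner_products \<Rightarrow> real \<Rightarrow> nat \<Rightarrow> nat"
  where "N_min H ip \<epsilon> s = (LEAST N. N \<ge> 1 \<and> min_error H ip N s \<le> \<epsilon> * initial_error H ip s)"

definition weakly_QMC_tractable :: "spaces \<Rightarrow> inner_products \<Rightarrow> bool"
  where "weakly_QMC_tractable H ip \<longleftrightarrow>
    ((\<lambda>(s, \<epsilon>). ln (real (N_min H ip \<epsilon> s)) / (real s + 1 / \<epsilon>)) \<longlongrightarrow> 0)
      (inf (filtercomap (\<lambda>(s, \<epsilon>). real s + 1 / \<epsilon>) at_top)
           (principal ({1::nat..} \<times> {0<..<1::real})))"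

definition QMC_bound :: "spaces \<Rightarrow> inner_products \<Rightarrow> real \<Rightarrow> real \<Rightarrow> real \<Rightarrow> bool"
  where "QMC_bound H ip c p q \<longleftrightarrow>
    (\<forall>s\<ge>1. \<forall>\<epsilon>\<in>{0<..<1}. real (N_min H ip \<epsilon> s) \<le> c * real s powr q * \<epsilon> powr (- p))"

definition polynomially_QMC_tractable :: "spaces \<Rightarrow> inner_products \<Rightarrow> bool"
  where "polynomially_QMC_tractable H ip \<longleftrightarrow> (\<exists>c\<ge>0. \<exists>p\<ge>0. \<exists>q\<ge>0. QMC_bound H ip c p q)"

definition QMC_exponents_at_most :: "spaces \<Rightarrow> inner_products \<Rightarrow> real \<Rightarrow> real \<Rightarrow> bool"
  where "QMC_exponents_at_most H ip p0 q0 \<longleftrightarrow> (\<forall>p>p0. \<forall>q>q0. \<exists>c\<ge>0. QMC_bound H ip c p q)"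

definition strongly_QMC_tractable :: "spaces \<Rightarrow> inner_products \<Rightarrow> bool"
  where "strongly_QMC_tractable H ip \<longleftrightarrow> (\<exists>c\<ge>0. \<exists>p\<ge>0. QMC_bound H ip c p 0)"

definition strong_QMC_exponent :: "spaces \<Rightarrow> inner_products \<Rightarrow> real"
  where "strong_QMC_exponent H ip = Inf {p. p \<ge> 0 \<and> (\<exists>c\<ge>0. QMC_bound H ip c p 0)}"

section \<open>The weight conditions\<close>

definition weight_sum ::
    "nat \<Rightarrow> (nat set \<Rightarrow> real) \<Rightarrow> (nat \<Rightarrow> nat) \<Rightarrow> real \<Rightarrow> real \<Rightarrow> nat \<Rightarrow> real"
  where "weight_sum b \<gamma> w \<rho> t s =
    (\<Sum>u\<in>Pow {1..s} - {{}}. \<gamma> u powr \<rho> * (2 * zeta t) ^ card u * real b ^ Max (w ` u))"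

definition C_const ::
    "nat \<Rightarrow> real \<Rightarrow> (nat set \<Rightarrow> real) \<Rightarrow> (nat \<Rightarrow> nat) \<Rightarrow> real \<Rightarrow> real \<Rightarrow> ereal"
  where "C_const b \<alpha> \<gamma> w \<delta> q =
    (SUP s\<in>{1..}. ereal (1 / real s powr q *
       weight_sum b \<gamma> w (1 / (\<alpha> - 2 * \<delta>)) (\<alpha> / (\<alpha> - 2 * \<delta>)) s))"

end

theory Submission
  imports Defs "HOL-Number_Theory.Totient"
begin

text \<open>
  Averages of kernel sections over finer and finer grids converge in the space to the constant
  function 1, which therefore represents the integral. Hence the worst-case error of a point set
  is the norm of an explicit function, its square is a double mean of the kernel, and for a lattice
  point set the character sums turn it into a sum over the dual lattice.

  For \<open>\<lambda> = 1 / (\<alpha> - 2 \<delta>)\<close>, the inequality \<open>(\<Sum> a)\<^sup>\<lambda> \<le> \<Sum> a\<^sup>\<lambda>\<close> bounds the \<open>\<lambda>\<close>-th power of the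
  increment of the squared error in step \<open>d + 1\<close>, averaged over all candidates, by a multiple of
  \<open>b ^ w (d + 1) / N\<close>. The minimizer is at most as large as the average, and summing up over the
  components gives the error bound. The tractability statements follow by choosing the least \<open>m\<close>
  for which the bound is at most \<open>\<epsilon>\<close>, as the initial error is 1.
\<close>

section \<open>Reproducing kernel Hilbert spaces\<close>

text \<open>The spaces are known only through their kernel: that they contain the constants, that
  their members are measurable and that integration is bounded has to be extracted from completeness
  and from continuity of the kernel. Hence grid means are studied twice, in the norm of the space
  and as Riemann sums. The range of \<open>\<delta>\<close> is what the exponent needs:
  \<open>\<alpha> * \<lambda> > 1\<close>, that is \<open>\<delta> > 0\<close>, makes the sums of
  \<open>\<bar>h\<bar> powr (- \<alpha> * \<lambda>)\<close> converge, and
  \<open>\<lambda> \<le> 1\<close>, that is \<open>\<delta> \<le> (\<alpha> - 1) / 2\<close>, gives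
  subadditivity. For w < m there are b^(m - w - 1) * (b - 1) \<ge> b^(m - w) / 2 candidates;
  dividing by their number yields both b^w / N and the factor 2 of the constant. No divisor sum
  enters: a frequency may solve the congruence for up to g candidates, but only if g divides it, and
  g * g^(-y) \<le> 1.\<close>

context rkhs
begin

abbreviation section_at :: "'x \<Rightarrow> 'x \<Rightarrow> complex"
  where "section_at y \<equiv> (\<lambda>x. if x \<in> X then K x y else 0)"

lemma diff_mem: "f \<in> H \<Longrightarrow> g \<in> H \<Longrightarrow> (\<lambda>x. f x - g x) \<in> H"
  using add_mem[OF _ scale_mem[of g "-1"], of f] by simp

lemma ip_diff_left:
  assumes "f \<in> H" "g \<in> H" "h \<in> H"
  shows "ip (\<lambda>x. f x - g x) h = ip f h - ip g h"
  using ip_add_left[OF assms(1) scale_mem[OF assms(2), of "-1"] assms(3)]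
    ip_scale_left[OF assms(2,3), of "-1"] by simp

lemma ip_diff_right:
  assumes "f \<in> H" "g \<in> H" "h \<in> H"
  shows "ip h (\<lambda>x. f x - g x) = ip h f - ip h g"
  using ip_diff_left[OF assms] ip_commute[of h] assms diff_mem by simp

lemma ip_scale_right:
  assumes "f \<in> H" "h \<in> H"
  shows "ip h (\<lambda>x. c * f x) = cnj c * ip h f"
  using ip_scale_left[OF assms, of c] ip_commute[of h] assms scale_mem by simp

lemma ip_self_real: "f \<in> H \<Longrightarrow> ip f f = of_real (Re (ip f f))"
  using ip_commute[of f f] by (simp add: complex_eq_iff)

lemma ip_norm_nonneg: "f \<in> H \<Longrightarrow> 0 \<le> ip_norm ip f"
  by (simp add: ip_norm_def ip_self_nonneg)

lemma ip_norm_square: "f \<in> H \<Longrightarrow> (ip_norm ip f)\<^sup>2 = Re (ip f f)"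
  by (simp add: ip_norm_def ip_self_nonneg)

lemma ip_norm_eq_0: "f \<in> H \<Longrightarrow> ip_norm ip f = 0 \<Longrightarrow> f = (\<lambda>x. 0)"
  using ip_self_eq_0[of f] ip_self_real[of f] by (simp add: ip_norm_def)

lemma ip_norm_scale: "f \<in> H \<Longrightarrow> ip_norm ip (\<lambda>x. c * f x) = cmod c * ip_norm ip f"
proof -
  assume f: "f \<in> H"
  have "ip (\<lambda>x. c * f x) (\<lambda>x. c * f x) = (c * cnj c) * ip f f"
    using f scale_mem[OF f, of c] by (simp add: ip_scale_left ip_scale_right)
  also have "c * cnj c = of_real ((cmod c)\<^sup>2)"
    by (rule complex_norm_square [symmetric])
  finally show ?thesis
    by (simp add: ip_norm_def real_sqrt_mult)
qed

lemma Cauchy_Schwarz: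
  assumes f: "f \<in> H" and g: "g \<in> H"
  shows "cmod (ip f g) \<le> ip_norm ip f * ip_norm ip g"
proof (cases "ip_norm ip g = 0")
  case True
  then have "g = (\<lambda>x. 0)"
    using ip_norm_eq_0 g by blast
  then have "ip f g = 0"
    using ip_scale_right[OF g f, of 0] by simp
  then show ?thesis
    using f g by (simp add: ip_norm_nonneg)
next
  case False
  define n where "n = Re (ip g g)"
  have n: "n > 0"
    using False ip_norm_nonneg[OF g] by (auto simp: n_def ip_norm_def)
  have gg: "ip g g = of_real n"
    unfolding n_def by (rule ip_self_real[OF g])
  define c where "c = ip f g / of_real n"
  let ?p = "\<lambda>x. f x - c * g x"
  have cg: "(\<lambda>x. c * g x) \<in> H" by (rule scale_mem[OF g])
  have p: "?p \<in> H" by (rule diff_mem[OF f cg])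
  have "ip ?p g = ip f g - c * ip g g"
    using f g cg by (simp add: ip_diff_left ip_scale_left)
  also have "\<dots> = 0"
    using n by (simp add: c_def gg)
  finally have pg: "ip ?p g = 0" .
  have "ip ?p ?p = ip ?p f - cnj c * ip ?p g"
    using p f g cg by (simp add: ip_diff_right ip_scale_right)
  also have "\<dots> = ip f f - c * ip g f"
    using pg f g cg by (simp add: ip_diff_left ip_scale_left)
  also have "ip g f = cnj (ip f g)"
    by (rule ip_commute[OF g f])
  also have "c * cnj (ip f g) = of_real ((cmod (ip f g))\<^sup>2 / n)"
    by (simp add: c_def complex_norm_square del: of_real_power)
  finally have "Re (ip ?p ?p) = Re (ip f f) - (cmod (ip f g))\<^sup>2 / n"
    by simp
  then have "(cmod (ip f g))\<^sup>2 / n \<le> Re (ip f f)"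
    using ip_self_nonneg[OF p] by simp
  then have "(cmod (ip f g))\<^sup>2 \<le> Re (ip f f) * n"
    using n by (simp add: field_simps)
  then have "(cmod (ip f g))\<^sup>2 \<le> (ip_norm ip f * ip_norm ip g)\<^sup>2"
    using f g by (simp add: power_mult_distrib ip_norm_square n_def)
  then show ?thesis
    using power2_le_imp_le f g by (simp add: ip_norm_nonneg)
qed

lemma ip_tendsto:
  assumes F: "\<And>n. F n \<in> H" and f: "f \<in> H" and h: "h \<in> H"
    and lim: "(\<lambda>n. ip_norm ip (\<lambda>x. F n x - f x)) \<longlonglongrightarrow> 0"
  shows "(\<lambda>n. ip h (F n)) \<longlonglongrightarrow> ip h f" "(\<lambda>n. ip (F n) h) \<longlonglongrightarrow> ip f h"
proof -
  have "(\<lambda>n. ip h (F n) - ip h f) \<longlonglongrightarrow> 0"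
  proof (rule Lim_null_comparison)
    show "\<forall>\<^sub>F n in sequentially. cmod (ip h (F n) - ip h f)
        \<le> ip_norm ip h * ip_norm ip (\<lambda>x. F n x - f x)"
      using Cauchy_Schwarz[OF h diff_mem[OF F f]] ip_diff_right[OF F f h] by simp
    show "(\<lambda>n. ip_norm ip h * ip_norm ip (\<lambda>x. F n x - f x)) \<longlonglongrightarrow> 0"
      using tendsto_mult_right_zero[OF lim] by simp
  qed
  then show 1: "(\<lambda>n. ip h (F n)) \<longlonglongrightarrow> ip h f"
    by (rule LIM_zero_cancel)
  show "(\<lambda>n. ip (F n) h) \<longlonglongrightarrow> ip f h"
    using tendsto_cnj[OF 1] ip_commute[OF F h] ip_commute[OF f h] by simp
qed

section \<open>Representers of quadrature rules and the norm of a functional\<close>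

definition kernel_mean :: "'x multiset \<Rightarrow> 'x \<Rightarrow> complex"
  where "kernel_mean P = (\<lambda>x. (1 / of_nat (size P)) * (\<Sum>y\<in>#P. section_at y x))"

definition point_mean :: "'x multiset \<Rightarrow> ('x \<Rightarrow> complex) \<Rightarrow> complex"
  where "point_mean P f = (1 / of_nat (size P)) * (\<Sum>y\<in>#P. f y)"

text \<open>Membership and inner product share one induction, because additivity of
  \<open>ip\<close> is available only for members. Conjugate symmetry turns linearity in the first
  argument into additivity in the second.\<close>

lemma kernel_sum_mset:
  assumes "set_mset P \<subseteq> X" "f \<in> H"
  shows "(\<lambda>x. \<Sum>y\<in>#P. section_at y x) \<in> H
    \<and> ip f (\<lambda>x. \<Sum>y\<in>#P. section_at y x) = (\<Sum>y\<in>#P. f y)"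
  using assms(1)
proof (induction P)
  case empty
  then show ?case
    using zero_mem ip_scale_right[OF zero_mem assms(2), of 0] by simp
next
  case (add y P)
  let ?S = "\<lambda>x. \<Sum>y\<in>#P. section_at y x"
  have y: "y \<in> X" and S: "?S \<in> H" and ipS: "ip f ?S = (\<Sum>y\<in>#P. f y)"
    using add by auto
  have k: "section_at y \<in> H" by (rule kernel_mem[OF y])
  have "ip f (\<lambda>x. section_at y x + ?S x) = cnj (ip (\<lambda>x. section_at y x + ?S x) f)"
    by (rule ip_commute[OF assms(2) add_mem[OF k S]])
  also have "\<dots> = cnj (ip (section_at y) f) + cnj (ip ?S f)"
    using k S assms(2) by (simp add: ip_add_left)
  also have "\<dots> = f y + (\<Sum>y\<in>#P. f y)"
    using ip_commute[OF assms(2) k] ip_commute[OF assms(2) S] reproducing[OF assms(2) y] ipS by simp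
  finally show ?case
    using add_mem[OF k S] by simp
qed

lemma kernel_mean_mem: "set_mset P \<subseteq> X \<Longrightarrow> kernel_mean P \<in> H"
  unfolding kernel_mean_def using kernel_sum_mset[OF _ zero_mem] by (intro scale_mem) auto

lemma ip_kernel_mean:
  assumes "set_mset P \<subseteq> X" "f \<in> H"
  shows "ip f (kernel_mean P) = point_mean P f"
proof -
  have "ip f (kernel_mean P) = cnj (1 / of_nat (size P)) * ip f (\<lambda>x. \<Sum>y\<in>#P. section_at y x)"
    unfolding kernel_mean_def using kernel_sum_mset[OF assms] assms(2)
    by (intro ip_scale_right) auto
  then show ?thesis
    using kernel_sum_mset[OF assms] by (simp add: point_mean_def)
qed

text \<open>The upper bound is Cauchy-Schwarz, and the normalized representer attains it.\<close>

lemma SUP_cmod_ip: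
  assumes r: "r \<in> H"
  shows "bdd_above ((\<lambda>f. cmod (ip f r)) ` {f \<in> H. ip_norm ip f \<le> 1})"
    and "(SUP f\<in>{f \<in> H. ip_norm ip f \<le> 1}. cmod (ip f r)) = ip_norm ip r"
proof -
  let ?B = "{f \<in> H. ip_norm ip f \<le> 1}"
  have le: "cmod (ip f r) \<le> ip_norm ip r" if "f \<in> ?B" for f
  proof -
    have "cmod (ip f r) \<le> ip_norm ip f * ip_norm ip r"
      using that Cauchy_Schwarz r by blast
    also have "\<dots> \<le> 1 * ip_norm ip r"
      using that ip_norm_nonneg[OF r] by (intro mult_right_mono) auto
    finally show ?thesis by simp
  qed
  show bdd: "bdd_above ((\<lambda>f. cmod (ip f r)) ` ?B)"
    using le by (rule bdd_aboveI2)
  have "ip_norm ip (\<lambda>x. 0) = 0"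
    using ip_norm_scale[OF zero_mem, of 0] by simp
  then have ne: "?B \<noteq> {}"
    using zero_mem by auto
  show "(SUP f\<in>?B. cmod (ip f r)) = ip_norm ip r"
  proof (rule antisym)
    show "(SUP f\<in>?B. cmod (ip f r)) \<le> ip_norm ip r"
      using ne le by (rule cSUP_least)
    \<comment> \<open>For a representer of norm 0 the convention \<open>inverse 0 = 0\<close> makes
      the witness the zero function, so one formula covers both cases.\<close>
    define c :: complex where "c = of_real (inverse (ip_norm ip r))"
    have n0: "0 \<le> ip_norm ip r" by (rule ip_norm_nonneg[OF r])
    have "cmod c * ip_norm ip r \<le> 1"
      using n0 by (cases "ip_norm ip r = 0") (simp_all add: c_def norm_inverse)
    then have "ip_norm ip (\<lambda>x. c * r x) \<le> 1"
      by (simp add: ip_norm_scale[OF r])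
    then have cB: "(\<lambda>x. c * r x) \<in> ?B"
      using scale_mem[OF r] by simp
    have "ip (\<lambda>x. c * r x) r = c * of_real (Re (ip r r))"
      using ip_scale_left[OF r r, of c] ip_self_real[OF r] by simp
    also have "\<dots> = of_real (inverse (ip_norm ip r) * (ip_norm ip r)\<^sup>2)"
      by (simp add: c_def ip_norm_square[OF r])
    also have "\<dots> = of_real (ip_norm ip r)"
      by (cases "ip_norm ip r = 0") (simp_all add: power2_eq_square)
    finally have "cmod (ip (\<lambda>x. c * r x) r) = ip_norm ip r"
      using n0 by simp
    then show "ip_norm ip r \<le> (SUP f\<in>?B. cmod (ip f r))"
      using cSUP_upper[OF cB bdd] by simp
  qed
qed

end

section \<open>Sums over integers subject to a congruence\<close>

lemma summable_zeta:
  assumes "y > 1"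
  shows "summable (\<lambda>n. real (Suc n) powr (- y))"
  using assms summable_real_powr_iff[of "- y"] summable_Suc_iff[of "\<lambda>n. real n powr (- y)"] by simp

lemma zeta_pos:
  assumes "y > 1"
  shows "zeta y > 0"
  unfolding zeta_def by (rule suminf_pos[OF summable_zeta[OF assms]]) simp

lemma has_sum_int_powr:
  assumes "y > 1"
  shows "((\<lambda>h::int. \<bar>of_int h\<bar> powr (- y)) has_sum 2 * zeta y) (- {0})"
proof -
  let ?f = "\<lambda>h::int. \<bar>real_of_int h\<bar> powr (- y)"
  have nat: "((\<lambda>n. real (Suc n) powr (- y)) has_sum zeta y) UNIV"
    using summable_sums[OF summable_zeta[OF assms]]
    by (intro sums_nonneg_imp_has_sum) (simp_all add: zeta_def)
  have range: "range (\<lambda>n. int (Suc n)) = {0<..}"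
  proof safe
    fix h :: int assume "0 < h"
    then have "h = int (Suc (nat (h - 1)))" by simp
    then show "h \<in> range (\<lambda>n. int (Suc n))" by (rule range_eqI)
  qed simp
  have "(?f has_sum zeta y) (range (\<lambda>n. int (Suc n)))"
    using nat by (subst has_sum_reindex) (auto simp: inj_on_def o_def add.commute)
  then have pos: "(?f has_sum zeta y) {0<..}"
    unfolding range .
  have "((?f \<circ> uminus) has_sum zeta y) {0<..}"
    using pos by (simp add: o_def)
  then have "(?f has_sum zeta y) (uminus ` {0<..})"
    by (rule has_sum_reindex[THEN iffD2, rotated]) (rule inj_uminus)
  then have neg: "(?f has_sum zeta y) {..<0}"
    by (simp add: image_uminus_greaterThan)
  have "(?f has_sum zeta y + zeta y) ({0<..} \<union> {..<0})"
    by (rule has_sum_Un_disjoint[OF pos neg]) auto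
  moreover have "{0<..} \<union> {..<0} = - {0::int}" by auto
  ultimately show ?thesis by simp
qed

lemma sum_int_powr_le:
  assumes "y > 1" "finite F" "0 \<notin> F"
  shows "(\<Sum>h\<in>F. \<bar>real_of_int h\<bar> powr (- y)) \<le> 2 * zeta y"
  using assms by (intro finite_sum_le_has_sum[OF has_sum_int_powr]) auto

text \<open>Writing \<open>h = g * h'\<close> turns the sum into \<open>g powr (1 - y)\<close> times
  a sum over nonzero \<open>h'\<close>, and \<open>g powr (1 - y) \<le> 1\<close>. The factor g on
  the left will bound the number of solutions of a congruence, which is thus absorbed.\<close>

lemma sum_int_powr_dvd_le:
  assumes y: "y > 1" and F: "finite F" "0 \<notin> F" and g: "g > 0" "\<And>h. h \<in> F \<Longrightarrow> g dvd h"
  shows "(\<Sum>h\<in>F. real_of_int g * \<bar>real_of_int h\<bar> powr (- y)) \<le> 2 * zeta y"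
proof -
  have le1: "real_of_int g * real_of_int g powr (- y) \<le> 1"
  proof -
    have "real_of_int g * real_of_int g powr (- y) = real_of_int g powr (1 - y)"
      using g(1) powr_add[of "real_of_int g" 1 "- y"] by simp
    also have "\<dots> \<le> real_of_int g powr 0"
      using y g(1) by (intro powr_mono) auto
    finally show ?thesis using g(1) by simp
  qed
  have "(\<Sum>h\<in>F. real_of_int g * \<bar>real_of_int h\<bar> powr (- y))
      = (\<Sum>h\<in>F. (real_of_int g * real_of_int g powr (- y)) * \<bar>real_of_int (h div g)\<bar> powr (- y))"
  proof (rule sum.cong)
    fix h assume "h \<in> F"
    then have h: "real_of_int h = real_of_int g * real_of_int (h div g)"
      using g(2)[of h] by (metis dvd_mult_div_cancel of_int_mult)
    show "real_of_int g * \<bar>real_of_int h\<bar> powr (- y)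
      = (real_of_int g * real_of_int g powr (- y)) * \<bar>real_of_int (h div g)\<bar> powr (- y)"
      using g(1) by (subst h) (simp add: abs_mult powr_mult)
  qed simp
  also have "\<dots> \<le> (\<Sum>h\<in>F. \<bar>real_of_int (h div g)\<bar> powr (- y))"
  proof (rule sum_mono)
    fix h
    show "real_of_int g * real_of_int g powr (- y) * \<bar>real_of_int (h div g)\<bar> powr (- y)
      \<le> \<bar>real_of_int (h div g)\<bar> powr (- y)"
      using mult_right_mono[OF le1, of "\<bar>real_of_int (h div g)\<bar> powr (- y)"] by simp
  qed
  also have "\<dots> = (\<Sum>h\<in>(\<lambda>h. h div g) ` F. \<bar>real_of_int h\<bar> powr (- y))"
    using g by (intro sum.reindex_cong[symmetric, where l = "\<lambda>h. h div g"])
      (auto simp: inj_on_def dvd_div_eq_iff)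
  also have "\<dots> \<le> 2 * zeta y"
    using F g by (intro sum_int_powr_le[OF y]) (auto simp: dvd_div_eq_0_iff)
  finally show ?thesis .
qed

text \<open>If t is coprime to M and solves the congruence, then c and h have the same gcd g with M.
  After division by g the coefficient of t is invertible modulo M / g, so any two solutions agree
  modulo M / g, and \<open>{1..M}\<close> holds exactly g periods of that length.\<close>

lemma card_congruence_solutions:
  fixes M g c h :: int
  assumes M: "M > 0" and T: "T \<subseteq> {1..M}" and cop: "\<And>t. t \<in> T \<Longrightarrow> coprime t M"
  shows "card {t \<in> T. M dvd h * t + c} \<le> nat (gcd c M)"
    and "{t \<in> T. M dvd h * t + c} \<noteq> {} \<Longrightarrow> gcd h M = gcd c M"
proof -
  let ?S = "{t \<in> T. M dvd h * t + c}"
  have gh: "gcd h M = gcd c M" if "t \<in> ?S" for t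
  proof -
    from that obtain k where "h * t + c = M * k" by auto
    then have c: "c = k * M + - (h * t)" by (simp add: mult.commute)
    have "gcd M c = gcd M (h * t)"
      unfolding c gcd_add_mult by simp
    also have "\<dots> = gcd M h"
      using cop[of t] that by (intro gcd_mult_right_right_cancel) (simp add: coprime_commute)
    finally show ?thesis by (simp add: gcd.commute)
  qed
  show "?S \<noteq> {} \<Longrightarrow> gcd h M = gcd c M" using gh by blast
  show "card ?S \<le> nat (gcd c M)"
  proof (cases "?S = {}")
    case True
    show ?thesis unfolding True by simp
  next
    case False
    define g where "g = gcd c M"
    have g: "g > 0" "g dvd M" "gcd h M = g" using M gh False by (auto simp: g_def)
    define M' where "M' = M div g"
    have M': "M = g * M'"
      using g(2) by (simp add: M'_def)
    then have M'0: "M' > 0"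
      using g(1) M by (simp add: zero_less_mult_iff)
    have cong: "M' dvd t - t'" if "t \<in> ?S" "t' \<in> ?S" for t t'
    proof -
      have "M dvd (h * t + c) - (h * t' + c)"
        using that by (intro dvd_diff) auto
      then have "M dvd h * (t - t')" by (simp add: algebra_simps)
      moreover obtain h' where h': "h = g * h'" using g(3) by (metis gcd_dvd1 dvdE)
      ultimately have "g * M' dvd g * (h' * (t - t'))" by (simp add: M' mult.assoc)
      then have "M' dvd h' * (t - t')" using g by simp
      moreover have "coprime M' h'"
      proof -
        have "\<bar>g\<bar> * gcd h' M' = gcd h M"
          unfolding M' h' by (rule gcd_mult_distrib_int)
        then show ?thesis
          using g by (simp add: coprime_iff_gcd_eq_1 gcd.commute)
      qed
      ultimately show ?thesis by (simp add: coprime_dvd_mult_right_iff)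
    qed
    \<comment> \<open>A solution is mapped to the number of its block of length \<open>M'\<close> in
      \<open>{1..M}\<close>: congruent solutions in the same block coincide, and there are g blocks.
      The shift by 1 lets the blocks start at 0.\<close>
    have "inj_on (\<lambda>t. (t - 1) div M') ?S"
    proof (rule inj_onI)
      fix t t' assume tt: "t \<in> ?S" "t' \<in> ?S" and eq: "(t - 1) div M' = (t' - 1) div M'"
      have "M' dvd (t - 1) - (t' - 1)" using cong[OF tt] by simp
      then have "(t - 1) mod M' = (t' - 1) mod M'" by (rule mod_eq_dvd_iff[THEN iffD2])
      then have "(t - 1) div M' * M' + (t - 1) mod M' = (t' - 1) div M' * M' + (t' - 1) mod M'"
        unfolding eq by (rule arg_cong)
      then have "t - 1 = t' - 1" unfolding div_mult_mod_eq .
      then show "t = t'" by simp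
    qed
    moreover have "(\<lambda>t. (t - 1) div M') ` ?S \<subseteq> {0..<g}"
    proof safe
      fix t assume "t \<in> T"
      then have t: "1 \<le> t" "t \<le> g * M'" using T unfolding M'[symmetric] by auto
      have "(t - 1) div M' \<ge> 0" using t M'0 by (simp add: pos_imp_zdiv_nonneg_iff)
      moreover have "(t - 1) div M' < g" 
      proof -
        have "(t - 1) div M' * M' \<le> t - 1"
          using pos_mod_sign[OF M'0, of "t - 1"] minus_mod_eq_div_mult[of "t - 1" M'] by linarith
        then have "(t - 1) div M' * M' < g * M'" using t by linarith
        then show ?thesis using M'0 by simp
      qed
      ultimately show "(t - 1) div M' \<in> {0..<g}" by simp
    qed
    ultimately have "card ?S \<le> card {0..<g}" by (rule card_inj_on_le) simp
    then show ?thesis by (simp add: g_def)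
  qed
qed

text \<open>A solution \<open>t\<close> of \<open>h t + c \<equiv> 0\<close> that is coprime to \<open>M\<close> forces \<open>gcd h M = gcd c M\<close>,
  so \<open>g = gcd c M\<close> divides every contributing \<open>h\<close>, and each of them contributes at most \<open>g\<close> times.\<close>

lemma sum_congruence_powr_le:
  fixes M c :: int
  assumes y: "y > 1" and M: "M > 0" and T: "T \<subseteq> {1..M}" and cop: "\<And>t. t \<in> T \<Longrightarrow> coprime t M"
    and F: "finite F" "0 \<notin> F"
  shows "(\<Sum>t\<in>T. \<Sum>h\<in>F. if M dvd h * t + c then \<bar>real_of_int h\<bar> powr (- y) else 0) \<le> 2 * zeta y"
proof -
  define g where "g = gcd c M"
  have g: "g > 0" using M by (simp add: g_def)
  have finT: "finite T" using T by (rule finite_subset) simp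
  let ?F = "{h \<in> F. g dvd h}"
  have "(\<Sum>t\<in>T. \<Sum>h\<in>F. if M dvd h * t + c then \<bar>real_of_int h\<bar> powr (- y) else 0)
      = (\<Sum>h\<in>F. \<Sum>t\<in>T. if M dvd h * t + c then \<bar>real_of_int h\<bar> powr (- y) else 0)"
    by (rule sum.swap)
  also have "\<dots> = (\<Sum>h\<in>F. real (card {t \<in> T. M dvd h * t + c}) * \<bar>real_of_int h\<bar> powr (- y))"
    using finT by (intro sum.cong refl) (simp add: sum.If_cases Int_def)
  also have "\<dots> \<le> (\<Sum>h\<in>F. if g dvd h then real_of_int g * \<bar>real_of_int h\<bar> powr (- y) else 0)"
  proof (rule sum_mono)
    fix h
    show "real (card {t \<in> T. M dvd h * t + c}) * \<bar>real_of_int h\<bar> powr (- y)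
      \<le> (if g dvd h then real_of_int g * \<bar>real_of_int h\<bar> powr (- y) else 0)"
    proof (cases "{t \<in> T. M dvd h * t + c} = {}")
      case True
      show ?thesis unfolding True using g by simp
    next
      case False
      have "gcd h M = g"
        unfolding g_def using card_congruence_solutions(2)[OF M T cop False] by simp
      then have "g dvd h" by auto
      moreover have "real (card {t \<in> T. M dvd h * t + c}) \<le> real_of_int g"
        using card_congruence_solutions(1)[OF M T cop, of h c] g by (simp add: g_def le_nat_iff)
      ultimately show ?thesis by (simp add: mult_right_mono)
    qed
  qed
  also have "\<dots> = (\<Sum>h\<in>?F. real_of_int g * \<bar>real_of_int h\<bar> powr (- y))"
    using F(1) by (simp add: sum.inter_filter)
  also have "\<dots> \<le> 2 * zeta y"
    using F g by (intro sum_int_powr_dvd_le[OF y]) auto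
  finally show ?thesis .
qed

section \<open>Characters and the Korobov kernel\<close>

definition unit_exp :: "real \<Rightarrow> complex"
  where "unit_exp t = exp (2 * of_real pi * \<i> * of_real t)"

lemma norm_unit_exp [simp]: "cmod (unit_exp t) = 1"
  by (simp add: unit_exp_def)

lemma unit_exp_add: "unit_exp (s + t) = unit_exp s * unit_exp t"
  by (simp add: unit_exp_def ring_distribs exp_add)

lemma unit_exp_0 [simp]: "unit_exp 0 = 1"
  by (simp add: unit_exp_def)

lemma unit_exp_sum: "finite A \<Longrightarrow> unit_exp (\<Sum>j\<in>A. f j) = (\<Prod>j\<in>A. unit_exp (f j))"
  by (induction rule: finite_induct) (auto simp: unit_exp_add)

lemma unit_exp_eq_1_iff: "unit_exp t = 1 \<longleftrightarrow> t \<in> \<int>"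
proof -
  have "unit_exp t = 1 \<longleftrightarrow> (\<exists>n::int. 2 * pi * t = of_int (2 * n) * pi)"
    by (simp add: unit_exp_def exp_eq_1)
  also have "\<dots> \<longleftrightarrow> (\<exists>n::int. t = of_int n)"
    by (auto simp: field_simps)
  finally show ?thesis by (auto simp: Ints_def)
qed

lemma unit_exp_add_int: "unit_exp (t + of_int n) = unit_exp t"
  using unit_exp_eq_1_iff[of "of_int n"] by (simp add: unit_exp_add)

lemma unit_exp_power: "unit_exp t ^ k = unit_exp (real k * t)"
  by (simp add: unit_exp_def exp_of_nat_mult[symmetric] mult_ac)

lemma continuous_unit_exp [continuous_intros]:
  "continuous_on A f \<Longrightarrow> continuous_on A (\<lambda>x. unit_exp (f x))"
  unfolding unit_exp_def by (intro continuous_intros)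

lemma sum_unit_exp:
  assumes "n > 0"
  shows "(\<Sum>k<n. unit_exp (of_int h * (real k / real n))) = (if int n dvd h then of_nat n else 0)"
proof -
  let ?z = "unit_exp (of_int h / real n)"
  have sum: "(\<Sum>k<n. unit_exp (of_int h * (real k / real n))) = (\<Sum>k<n. ?z ^ k)"
    by (simp add: unit_exp_power mult_ac)
  have "?z ^ n = 1"
    using assms unit_exp_eq_1_iff[of "of_int h"] by (simp add: unit_exp_power)
  moreover have "?z = 1 \<longleftrightarrow> int n dvd h"
  proof
    assume "?z = 1"
    then obtain k where "of_int h / real n = of_int k"
      by (auto simp: unit_exp_eq_1_iff Ints_def)
    then have "real_of_int h = real_of_int (int n * k)"
      using assms by (simp add: field_simps)
    then show "int n dvd h"
      by (metis of_int_eq_iff dvd_triv_left)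
  next
    assume "int n dvd h"
    then show "?z = 1"
      using assms by (auto simp: unit_exp_eq_1_iff)
  qed
  ultimately show ?thesis
    unfolding sum by (simp add: sum_gp_strict)
qed

section \<open>The one-dimensional factor of the kernel\<close>

lemma has_sum_finite_sum:
  fixes f :: "'i \<Rightarrow> 'a \<Rightarrow> 'b::topological_comm_monoid_add"
  assumes "finite I" "\<And>i. i \<in> I \<Longrightarrow> (f i has_sum S i) A"
  shows "((\<lambda>x. \<Sum>i\<in>I. f i x) has_sum (\<Sum>i\<in>I. S i)) A"
  using assms by (induction rule: finite_induct) (auto intro: has_sum_add)

text \<open>One factor of the Korobov kernel as a function of the difference of the arguments,
  without the frequency 0; by absolute convergence the multivariate series splits into products of
  such factors.\<close>

definition phi :: "real \<Rightarrow> real \<Rightarrow> complex"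
  where "phi \<alpha> t = (\<Sum>\<^sub>\<infinity>h\<in>- {0::int}. unit_exp (of_int h * t) / of_real (\<bar>of_int h\<bar> powr \<alpha>))"

lemma norm_phi_term:
  "cmod (unit_exp t / of_real (\<bar>x\<bar> powr \<alpha>)) = \<bar>x\<bar> powr (- \<alpha>)"
  by (simp add: norm_mult powr_minus norm_inverse divide_inverse)

lemma abs_summable_phi:
  assumes "\<alpha> > 1"
  shows "(\<lambda>h::int. norm (unit_exp (of_int h * t) / of_real (\<bar>of_int h\<bar> powr \<alpha>))) summable_on - {0}"
  using has_sum_int_powr[OF assms] by (auto simp: norm_phi_term summable_on_def)

lemma has_sum_phi:
  assumes "\<alpha> > 1"
  shows "((\<lambda>h::int. unit_exp (of_int h * t) / of_real (\<bar>of_int h\<bar> powr \<alpha>)) has_sum phi \<alpha> t) (- {0})"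
  unfolding phi_def by (rule has_sum_infsum[OF abs_summable_summable[OF abs_summable_phi[OF assms]]])

lemma norm_phi_le:
  assumes "\<alpha> > 1"
  shows "cmod (phi \<alpha> t) \<le> 2 * zeta \<alpha>"
  using has_sum_int_powr[OF assms] has_sum_phi[OF assms]
  by (intro norm_has_sum_bound[where f = "\<lambda>h::int. unit_exp (of_int h * t) / of_real (\<bar>of_int h\<bar> powr \<alpha>)"])
    (auto simp: norm_phi_term)

text \<open>The series converges uniformly, being dominated by
  \<open>\<bar>h\<bar> powr (- \<alpha>)\<close>. Continuity of the kernel, and through it of every
  member of the space, rests on this.\<close>

lemma continuous_on_phi:
  assumes "\<alpha> > 1"
  shows "continuous_on UNIV (phi \<alpha>)"
proof (rule uniform_limit_theorem)
  let ?f = "\<lambda>(h::int) t. unit_exp (of_int h * t) / of_real (\<bar>of_int h\<bar> powr \<alpha>)"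
  show "uniform_limit UNIV (\<lambda>A t. \<Sum>h\<in>A. ?f h t) (phi \<alpha>) (finite_subsets_at_top (- {0}))"
    unfolding phi_def using has_sum_int_powr[OF assms]
    by (intro Weierstrass_m_test_general[where M = "\<lambda>h. \<bar>of_int h\<bar> powr (- \<alpha>)"])
      (auto simp: norm_phi_term summable_on_def)
  show "\<forall>\<^sub>F A in finite_subsets_at_top (- {0}). continuous_on UNIV (\<lambda>t. \<Sum>h\<in>A. ?f h t)"
    unfolding divide_inverse by (intro always_eventually allI continuous_intros)
qed simp

text \<open>Periodicity is what allows the fractional parts in \<open>lattice_points\<close> to be
  dropped.\<close>

lemma phi_add_int: "phi \<alpha> (t + of_int n) = phi \<alpha> t"
  unfolding phi_def
proof (rule infsum_cong)
  fix h :: int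
  have "unit_exp (of_int h * (t + of_int n)) = unit_exp (of_int h * t + of_int (h * n))"
    by (simp add: ring_distribs)
  then show "unit_exp (of_int h * (t + of_int n)) / of_real (\<bar>of_int h\<bar> powr \<alpha>)
      = unit_exp (of_int h * t) / of_real (\<bar>of_int h\<bar> powr \<alpha>)"
    by (simp only: unit_exp_add_int)
qed

text \<open>Averaging over a uniform grid kills all frequencies that are not multiples of \<open>n\<close>.\<close>

lemma phi_grid_mean:
  assumes \<alpha>: "\<alpha> > 1" and n: "n > 0"
  shows "(1 / of_nat n) * (\<Sum>k<n. phi \<alpha> (t - real k / real n))
    = of_real (real n powr (- \<alpha>)) * phi \<alpha> (real n * t)"
proof -
  let ?g = "\<lambda>h::int. unit_exp (of_int h * t) / of_real (\<bar>of_int h\<bar> powr \<alpha>)"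
  have "((\<lambda>h::int. (1 / of_nat n) * (\<Sum>k<n. unit_exp (of_int h * (t - real k / real n)) / of_real (\<bar>of_int h\<bar> powr \<alpha>)))
     has_sum (1 / of_nat n) * (\<Sum>k<n. phi \<alpha> (t - real k / real n))) (- {0})"
    by (intro has_sum_cmult_right has_sum_finite_sum has_sum_phi[OF \<alpha>]) auto
  also have "(\<lambda>h::int. (1 / of_nat n) * (\<Sum>k<n. unit_exp (of_int h * (t - real k / real n)) / of_real (\<bar>of_int h\<bar> powr \<alpha>)))
      = (\<lambda>h. if int n dvd h then ?g h else 0)"
  proof
    fix h :: int
    have "(\<Sum>k<n. unit_exp (of_int h * (t - real k / real n)) / of_real (\<bar>of_int h\<bar> powr \<alpha>))
      = (\<Sum>k<n. ?g h * unit_exp (of_int (- h) * (real k / real n)))"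
      by (intro sum.cong refl) (simp add: unit_exp_add[symmetric] ring_distribs)
    also have "\<dots> = ?g h * (if int n dvd h then of_nat n else 0)"
      unfolding sum_distrib_left[symmetric] sum_unit_exp[OF n] by simp
    finally show "(1 / of_nat n) * (\<Sum>k<n. unit_exp (of_int h * (t - real k / real n)) / of_real (\<bar>of_int h\<bar> powr \<alpha>))
      = (if int n dvd h then ?g h else 0)"
      using n by simp
  qed
  finally have 1: "((\<lambda>h. if int n dvd h then ?g h else 0) has_sum
      (1 / of_nat n) * (\<Sum>k<n. phi \<alpha> (t - real k / real n))) (- {0})" .
  have "((\<lambda>h. of_real (real n powr (- \<alpha>)) * (unit_exp (of_int h * (real n * t)) / of_real (\<bar>of_int h\<bar> powr \<alpha>)))
     has_sum of_real (real n powr (- \<alpha>)) * phi \<alpha> (real n * t)) (- {0})"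
    by (intro has_sum_cmult_right has_sum_phi[OF \<alpha>])
  also have "(\<lambda>h. of_real (real n powr (- \<alpha>)) * (unit_exp (of_int h * (real n * t)) / of_real (\<bar>of_int h\<bar> powr \<alpha>)))
      = ?g \<circ> (\<lambda>h. int n * h)"
    using n by (auto simp: fun_eq_iff abs_mult powr_mult powr_minus mult_ac divide_inverse)
  finally have "(?g has_sum of_real (real n powr (- \<alpha>)) * phi \<alpha> (real n * t)) ((\<lambda>h. int n * h) ` (- {0}))"
    using n by (subst has_sum_reindex) (auto simp: inj_on_def o_def)
  also have "?this \<longleftrightarrow> ((\<lambda>h. if int n dvd h then ?g h else 0) has_sum
      of_real (real n powr (- \<alpha>)) * phi \<alpha> (real n * t)) (- {0})"
    using n by (intro has_sum_cong_neutral) (auto simp: dvd_def image_iff)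
  finally show ?thesis
    using 1 has_sum_unique by blast
qed

text \<open>The finite set is enlarged to the box of its coordinate projections, where the sum of
  products becomes a product of one-dimensional sums; the projections still avoid 0.\<close>

lemma sum_PiE_powr_le:
  assumes y: "y > 1" and u: "finite u" and F: "finite F" "F \<subseteq> PiE u (\<lambda>_. - {0::int})"
  shows "(\<Sum>h\<in>F. \<Prod>j\<in>u. \<bar>real_of_int (h j)\<bar> powr (- y)) \<le> (2 * zeta y) ^ card u"
proof -
  let ?B = "\<lambda>j. (\<lambda>h. h j) ` F"
  have "(\<Sum>h\<in>F. \<Prod>j\<in>u. \<bar>real_of_int (h j)\<bar> powr (- y))
      \<le> (\<Sum>h\<in>PiE u ?B. \<Prod>j\<in>u. \<bar>real_of_int (h j)\<bar> powr (- y))"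
    using F u by (intro sum_mono2 finite_PiE) (auto simp: PiE_iff intro!: prod_nonneg)
  also have "\<dots> = (\<Prod>j\<in>u. \<Sum>a\<in>?B j. \<bar>real_of_int a\<bar> powr (- y))"
    using u F by (intro prod_sum_PiE[symmetric]) auto
  also have "\<dots> \<le> (\<Prod>j\<in>u. 2 * zeta y)"
  proof (rule prod_mono, safe)
    fix j assume "j \<in> u"
    show "0 \<le> (\<Sum>a\<in>?B j. \<bar>real_of_int a\<bar> powr (- y))" by (intro sum_nonneg) simp
    have "0 \<notin> ?B j" using F \<open>j \<in> u\<close> by (auto simp: PiE_iff)
    then show "(\<Sum>a\<in>?B j. \<bar>real_of_int a\<bar> powr (- y)) \<le> 2 * zeta y"
      using F by (intro sum_int_powr_le[OF y]) auto
  qed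
  finally show ?thesis by simp
qed

lemma summable_on_PiE_powr:
  assumes "y > 1" "finite u"
  shows "(\<lambda>h. \<Prod>j\<in>u. \<bar>real_of_int (h j)\<bar> powr (- y)) summable_on PiE u (\<lambda>_. - {0::int})"
proof (rule nonneg_bounded_partial_sums_imp_summable_on)
  show "\<forall>\<^sub>F F in finite_subsets_at_top (PiE u (\<lambda>_. - {0::int})).
      (\<Sum>h\<in>F. \<Prod>j\<in>u. \<bar>real_of_int (h j)\<bar> powr (- y)) \<le> (2 * zeta y) ^ card u"
    by (rule eventually_finite_subsets_at_top_weakI) (rule sum_PiE_powr_le[OF assms])
qed (simp add: prod_nonneg)

lemma has_sum_prod_phi:
  assumes \<alpha>: "\<alpha> > 1" and u: "finite u"
  shows "((\<lambda>h. unit_exp (\<Sum>j\<in>u. of_int (h j) * x j) * of_real (\<Prod>j\<in>u. \<bar>of_int (h j)\<bar> powr (- \<alpha>)))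
    has_sum (\<Prod>j\<in>u. phi \<alpha> (x j))) (PiE u (\<lambda>_. - {0::int}))"
proof -
  let ?f = "\<lambda>h. unit_exp (\<Sum>j\<in>u. of_int (h j) * x j) * of_real (\<Prod>j\<in>u. \<bar>of_int (h j)\<bar> powr (- \<alpha>))"
  have "?f = (\<lambda>h. \<Prod>j\<in>u. unit_exp (of_int (h j) * x j) / of_real (\<bar>of_int (h j)\<bar> powr \<alpha>))"
    using u by (simp add: unit_exp_sum prod.distrib[symmetric] powr_minus divide_inverse)
  then have eq: "infsum ?f (PiE u (\<lambda>_. - {0::int})) = (\<Prod>j\<in>u. phi \<alpha> (x j))"
    unfolding phi_def using infsum_prod_PiE_abs[OF u abs_summable_phi[OF \<alpha>, of "x _"]] by simp
  have "?f summable_on PiE u (\<lambda>_. - {0::int})"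
    using summable_on_PiE_powr[OF assms]
    by (rule_tac abs_summable_summable) (simp add: norm_mult prod_norm[symmetric])
  then have "(?f has_sum infsum ?f (PiE u (\<lambda>_. - {0::int}))) (PiE u (\<lambda>_. - {0::int}))"
    by (rule has_sum_infsum)
  then show ?thesis
    unfolding eq .
qed

lemma korobov_kernel_eq:
  assumes \<alpha>: "\<alpha> > 1"
  shows "korobov_kernel \<alpha> \<gamma> s x y =
    1 + (\<Sum>u\<in>Pow {1..s} - {{}}. of_real (\<gamma> u) * (\<Prod>j\<in>u. phi \<alpha> (x j - y j)))"
proof -
  have "(\<Sum>\<^sub>\<infinity>h\<in>PiE u (\<lambda>_. - {0::int}).
             exp (2 * of_real pi * \<i> * of_real (\<Sum>j\<in>u. of_int (h j) * (x j - y j))) /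
             of_real (\<Prod>j\<in>u. \<bar>real_of_int (h j)\<bar> powr \<alpha>)) = (\<Prod>j\<in>u. phi \<alpha> (x j - y j))"
    if "finite u" for u
    using infsumI[OF has_sum_prod_phi[OF \<alpha> that, of "\<lambda>j. x j - y j"]]
    by (simp add: unit_exp_def powr_minus divide_inverse prod_inversef[symmetric] del: prod_inversef)
  then show ?thesis
    unfolding korobov_kernel_def by (auto intro!: sum.cong arg_cong2[where f = "(*)"] finite_subset)
qed

text \<open>The sum over \<open>\<D>\<^sub>u\<close> in the error formula.\<close>

definition dual_sum :: "real \<Rightarrow> nat \<Rightarrow> (nat \<Rightarrow> int) \<Rightarrow> nat set \<Rightarrow> real"
  where "dual_sum \<alpha> N z u = (\<Sum>\<^sub>\<infinity>h\<in>PiE u (\<lambda>_. - {0::int}).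
    if int N dvd (\<Sum>j\<in>u. h j * z j) then \<Prod>j\<in>u. \<bar>of_int (h j)\<bar> powr (- \<alpha>) else 0)"

lemma has_sum_dual_sum:
  assumes "\<alpha> > 1" "finite u"
  shows "((\<lambda>h. if int N dvd (\<Sum>j\<in>u. h j * z j) then \<Prod>j\<in>u. \<bar>real_of_int (h j)\<bar> powr (- \<alpha>) else 0)
    has_sum dual_sum \<alpha> N z u) (PiE u (\<lambda>_. - {0::int}))"
  unfolding dual_sum_def using summable_on_PiE_powr[OF assms]
  by (intro has_sum_infsum) (rule summable_on_comparison_test, auto intro!: prod_nonneg)

lemma dual_sum_nonneg: "0 \<le> dual_sum \<alpha> N z u"
  unfolding dual_sum_def by (intro infsum_nonneg) (auto intro!: prod_nonneg)

text \<open>The mean over k is finite, so it can be taken inside the absolutely convergent series;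
  there the mean of the characters is 1 for frequencies orthogonal to z modulo N and 0 for all
  others.\<close>

lemma lattice_mean_prod_phi:
  assumes \<alpha>: "\<alpha> > 1" and u: "finite u" and N: "N > 0"
  shows "(1 / of_nat N) * (\<Sum>k<N. \<Prod>j\<in>u. phi \<alpha> (real k / real N * of_int (z j)))
    = of_real (dual_sum \<alpha> N z u)"
proof -
  let ?p = "\<lambda>h. complex_of_real (\<Prod>j\<in>u. \<bar>of_int (h j)\<bar> powr (- \<alpha>))"
  have "((\<lambda>h. (1 / of_nat N) * (\<Sum>k<N. unit_exp (\<Sum>j\<in>u. of_int (h j) * (real k / real N * of_int (z j))) * ?p h))
    has_sum (1 / of_nat N) * (\<Sum>k<N. \<Prod>j\<in>u. phi \<alpha> (real k / real N * of_int (z j)))) (PiE u (\<lambda>_. - {0::int}))"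
    by (intro has_sum_cmult_right has_sum_finite_sum has_sum_prod_phi[OF \<alpha> u]) auto
  also have "(\<lambda>h. (1 / of_nat N) * (\<Sum>k<N. unit_exp (\<Sum>j\<in>u. of_int (h j) * (real k / real N * of_int (z j))) * ?p h))
      = (\<lambda>h. of_real (if int N dvd (\<Sum>j\<in>u. h j * z j) then \<Prod>j\<in>u. \<bar>of_int (h j)\<bar> powr (- \<alpha>) else 0))"
  proof
    fix h :: "nat \<Rightarrow> int"
    have "(\<Sum>k<N. unit_exp (\<Sum>j\<in>u. of_int (h j) * (real k / real N * of_int (z j))) * ?p h)
      = (\<Sum>k<N. unit_exp (of_int (\<Sum>j\<in>u. h j * z j) * (real k / real N))) * ?p h"
      by (simp add: sum_distrib_right sum_distrib_left sum_divide_distrib mult_ac)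
    then show "(1 / of_nat N) * (\<Sum>k<N. unit_exp (\<Sum>j\<in>u. of_int (h j) * (real k / real N * of_int (z j))) * ?p h)
      = of_real (if int N dvd (\<Sum>j\<in>u. h j * z j) then \<Prod>j\<in>u. \<bar>of_int (h j)\<bar> powr (- \<alpha>) else 0)"
      using N sum_unit_exp[OF N, of "\<Sum>j\<in>u. h j * z j"] by simp
  qed
  finally show ?thesis
    using has_sum_of_real[OF has_sum_dual_sum[OF \<alpha> u, of N z], where 'a = complex] has_sum_unique by blast
qed

section \<open>Riemann sums on the unit cube\<close>

text \<open>For n > 0 these are the lower corners of the n^s subcubes of side 1 / n; rounding down
  reaches the coordinate 1 only from the faces \<open>x j = 1\<close>.\<close>

definition grid :: "nat \<Rightarrow> nat \<Rightarrow> (nat \<Rightarrow> real) multiset"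
  where "grid s n = image_mset (\<lambda>k. \<lambda>j\<in>{1..s}. real (k j) / real n) (mset_set (PiE {1..s} (\<lambda>_. {..<n})))"

lemma size_grid [simp]: "size (grid s n) = n ^ s"
  by (simp add: grid_def card_PiE)

lemma sum_grid: "(\<Sum>y\<in>#grid s n. f y) = (\<Sum>k\<in>PiE {1..s} (\<lambda>_. {..<n}). f (\<lambda>j\<in>{1..s}. real (k j) / real n))"
  by (simp add: grid_def sum_unfold_sum_mset multiset.map_comp o_def)

lemma grid_subset: "set_mset (grid s n) \<subseteq> unit_cube s"
  by (auto simp: grid_def unit_cube_def finite_PiE PiE_iff divide_le_eq_1 less_imp_le)

lemma space_cube_measure [simp]: "space (cube_measure s) = unit_cube s"
  by (simp add: cube_measure_def unit_cube_def space_PiM space_restrict_space)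

lemma product_sigma_finite_unit_interval:
  "product_sigma_finite (\<lambda>_::nat. restrict_space lborel {0..1::real})"
proof -
  have "finite_measure (restrict_space lborel {0..1::real})"
    by (rule finite_measureI) (simp add: space_restrict_space emeasure_restrict_space)
  then show ?thesis
    by (intro product_sigma_finite.intro) (simp add: finite_measure.axioms(1))
qed

lemma emeasure_cube_box:
  assumes "\<And>j. j \<in> {1..s} \<Longrightarrow> A j \<in> sets borel" "\<And>j. j \<in> {1..s} \<Longrightarrow> A j \<subseteq> {0..1}"
  shows "PiE {1..s} A \<in> sets (cube_measure s)"
    and "emeasure (cube_measure s) (PiE {1..s} A) = (\<Prod>j\<in>{1..s}. emeasure lborel (A j))"
proof -
  interpret product_sigma_finite "\<lambda>_::nat. restrict_space lborel {0..1::real}"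
    by (rule product_sigma_finite_unit_interval)
  have A: "A j \<in> sets (restrict_space lborel {0..1})" if "j \<in> {1..s}" for j
    using assms(1,2)[OF that] by (simp add: sets_restrict_space_iff)
  show "PiE {1..s} A \<in> sets (cube_measure s)"
    unfolding cube_measure_def using A by (intro sets_PiM_I_finite) auto
  show "emeasure (cube_measure s) (PiE {1..s} A) = (\<Prod>j\<in>{1..s}. emeasure lborel (A j))"
  proof -
    have "emeasure (cube_measure s) (PiE {1..s} A) = (\<Prod>j\<in>{1..s}. emeasure (restrict_space lborel {0..1}) (A j))"
      unfolding cube_measure_def using A by (intro emeasure_PiM) auto
    also have "\<dots> = (\<Prod>j\<in>{1..s}. emeasure lborel (A j))"
      using assms(2) by (intro prod.cong refl emeasure_restrict_space) auto
    finally show ?thesis .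
  qed
qed

lemma finite_measure_cube: "finite_measure (cube_measure s)"
proof (rule finite_measureI)
  have "emeasure (cube_measure s) (PiE {1..s} (\<lambda>_. {0..1})) = (\<Prod>j\<in>{1..s}. emeasure lborel {0..1::real})"
    by (rule emeasure_cube_box(2)) auto
  then show "emeasure (cube_measure s) (space (cube_measure s)) \<noteq> \<infinity>"
    by (simp add: unit_cube_def)
qed

text \<open>The points that rounding down sends to k / n. For n > 0 the index \<open>k j = n\<close>
  is possible too, but only for \<open>x j = 1\<close>.\<close>

definition cell :: "nat \<Rightarrow> nat \<Rightarrow> (nat \<Rightarrow> nat) \<Rightarrow> (nat \<Rightarrow> real) set"
  where "cell s n k = PiE {1..s} (\<lambda>j. {t \<in> {0..1}. \<lfloor>real n * t\<rfloor> = int (k j)})"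

lemma interval_cell:
  assumes "n > 0" "k \<le> n"
  shows "{t \<in> {0..1::real}. \<lfloor>real n * t\<rfloor> = int k} =
    (if k < n then {real k / real n..<real (k + 1) / real n} else {1})"
proof (cases "k < n")
  case True
  then have "real k + 1 \<le> real n" by linarith
  show ?thesis
  proof (rule set_eqI)
    fix t :: real
    have "\<lfloor>real n * t\<rfloor> = int k \<longleftrightarrow> real k / real n \<le> t \<and> t < real (k + 1) / real n"
      using assms by (simp add: floor_eq_iff field_simps)
    moreover have "0 \<le> t \<and> t \<le> 1" if "real k / real n \<le> t" "t < real (k + 1) / real n"
    proof -
      have "0 \<le> real k / real n" "real (k + 1) / real n \<le> 1"
        using \<open>real k + 1 \<le> real n\<close> assms by (auto simp: divide_le_eq_1)
      then show ?thesis using that by linarith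
    qed
    ultimately show "t \<in> {t \<in> {0..1::real}. \<lfloor>real n * t\<rfloor> = int k} \<longleftrightarrow>
        t \<in> (if k < n then {real k / real n..<real (k + 1) / real n} else {1})"
      using True by auto
  qed
next
  case False
  then have k: "k = n" using assms by simp
  have "t = 1" if "0 \<le> t" "t \<le> 1" "\<lfloor>real n * t\<rfloor> = int n" for t
  proof -
    have "real n \<le> real n * t" using that(3) by (simp add: floor_eq_iff)
    then show ?thesis using that assms by simp
  qed
  then show ?thesis using k by auto
qed

lemma cell_measure:
  assumes n: "n > 0" and k: "\<And>j. j \<in> {1..s} \<Longrightarrow> k j \<le> n"
  shows "cell s n k \<in> sets (cube_measure s)"
    and "measure (cube_measure s) (cell s n k) = (\<Prod>j\<in>{1..s}. if k j < n then 1 / real n else 0)"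
proof -
  have c: "cell s n k = PiE {1..s} (\<lambda>j. if k j < n then {real (k j) / real n..<real (k j + 1) / real n} else {1})"
    unfolding cell_def using interval_cell[OF n k] by (intro PiE_cong) simp
  have sub: "(if k j < n then {real (k j) / real n..<real (k j + 1) / real n} else {1}) \<subseteq> {0..1}"
    if "j \<in> {1..s}" for j
    using interval_cell[OF n k[OF that]] by auto
  show "cell s n k \<in> sets (cube_measure s)"
    unfolding c using sub by (intro emeasure_cube_box) auto
  have "emeasure (cube_measure s) (cell s n k)
      = (\<Prod>j\<in>{1..s}. emeasure lborel (if k j < n then {real (k j) / real n..<real (k j + 1) / real n} else {1}))"
    unfolding c using sub by (intro emeasure_cube_box) auto
  also have "\<dots> = (\<Prod>j\<in>{1..s}. ennreal (if k j < n then 1 / real n else 0))"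
    using n by (intro prod.cong refl) (auto simp: divide_right_mono diff_divide_distrib[symmetric])
  also have "\<dots> = ennreal (\<Prod>j\<in>{1..s}. if k j < n then 1 / real n else 0)"
    by (rule prod_ennreal) simp
  finally show "measure (cube_measure s) (cell s n k) = (\<Prod>j\<in>{1..s}. if k j < n then 1 / real n else 0)"
    by (simp add: measure_def prod_nonneg)
qed

text \<open>An arbitrary f will do: composed with rounding down it takes finitely many values, one
  on each cell, and is therefore a step function. The cells of positive measure have volume 1 / n^s,
  which makes the integral a grid mean.\<close>

lemma grid_step_integral:
  fixes f :: "(nat \<Rightarrow> real) \<Rightarrow> complex"
  assumes n: "n > 0"
  shows "(\<lambda>x. f (\<lambda>j\<in>{1..s}. real_of_int \<lfloor>real n * x j\<rfloor> / real n)) \<in> borel_measurable (cube_measure s)" (is "?F \<in> _")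
    and "(LINT x|cube_measure s. f (\<lambda>j\<in>{1..s}. real_of_int \<lfloor>real n * x j\<rfloor> / real n))
      = (1 / of_nat (n ^ s)) * (\<Sum>y\<in>#grid s n. f y)"
proof -
  define F where "F = ?F"
  interpret finite_measure "cube_measure s" by (rule finite_measure_cube)
  let ?p = "\<lambda>k. \<lambda>j\<in>{1..s}. real (k j) / real n"
  let ?I = "PiE {1..s} (\<lambda>_. {..n})"
  have fin: "finite ?I" by (intro finite_PiE) auto
  have sets: "cell s n k \<in> sets (cube_measure s)" if "k \<in> ?I" for k
    using that by (intro cell_measure n) (auto simp: PiE_iff)
  have F: "F x = (\<Sum>k\<in>?I. indicator (cell s n k) x *\<^sub>R f (?p k))" if x: "x \<in> space (cube_measure s)" for x
  proof -
    have x01: "0 \<le> x j" "x j \<le> 1" "x \<in> extensional {1..s}" if "j \<in> {1..s}" for j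
      using x that by (auto simp: unit_cube_def PiE_iff)
    define k where "k = (\<lambda>j\<in>{1..s}. nat \<lfloor>real n * x j\<rfloor>)"
    have kj: "int (k j) = \<lfloor>real n * x j\<rfloor>" "k j \<le> n" if "j \<in> {1..s}" for j
    proof -
      have "0 \<le> real n * x j" "real n * x j \<le> real n"
        using x01(1,2)[OF that] n by (auto simp: mult_left_le)
      then show "int (k j) = \<lfloor>real n * x j\<rfloor>" "k j \<le> n"
        using that by (auto simp: k_def floor_le_iff nat_le_iff)
    qed
    have kI: "k \<in> ?I" using kj(2) by (auto simp: PiE_iff k_def)
    have "indicator (cell s n k') x = (if k' = k then 1 else 0 :: real)" if k': "k' \<in> ?I" for k'
    proof -
      have "x \<in> cell s n k' \<longleftrightarrow> (\<forall>j\<in>{1..s}. \<lfloor>real n * x j\<rfloor> = int (k' j))"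
        using x by (auto simp: cell_def unit_cube_def PiE_iff)
      also have "\<dots> \<longleftrightarrow> (\<forall>j\<in>{1..s}. k' j = k j)"
        using kj(1) by (metis of_nat_eq_iff)
      also have "\<dots> \<longleftrightarrow> k' = k"
        using PiE_ext[OF k' kI] by blast
      finally show ?thesis by (simp add: indicator_def)
    qed
    then have "(\<Sum>k'\<in>?I. indicator (cell s n k') x *\<^sub>R f (?p k')) = (\<Sum>k'\<in>?I. if k' = k then f (?p k') else 0)"
      by (intro sum.cong refl) auto
    also have "\<dots> = f (?p k)" using kI fin by simp
    also have "?p k = (\<lambda>j\<in>{1..s}. real_of_int \<lfloor>real n * x j\<rfloor> / real n)"
      using kj(1) by (intro restrict_ext) (metis of_int_of_nat_eq)
    finally show ?thesis unfolding F_def by (rule sym)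
  qed
  have meas: "(\<lambda>x. \<Sum>k\<in>?I. indicator (cell s n k) x *\<^sub>R f (?p k)) \<in> borel_measurable (cube_measure s)"
    by (rule borel_measurable_sum, rule borel_measurable_scaleR)
      (simp_all add: borel_measurable_indicator sets)
  have "F \<in> borel_measurable (cube_measure s)"
    using meas by (subst measurable_cong[OF F])
  then show "?F \<in> borel_measurable (cube_measure s)"
    unfolding F_def .
  have "(LINT x|cube_measure s. F x) = (LINT x|cube_measure s. (\<Sum>k\<in>?I. indicator (cell s n k) x *\<^sub>R f (?p k)))"
    using F by (intro Bochner_Integration.integral_cong) auto
  also have "\<dots> = (\<Sum>k\<in>?I. (LINT x|cube_measure s. indicator (cell s n k) x *\<^sub>R f (?p k)))"
    using sets by (intro Bochner_Integration.integral_sum integrable_scaleR_left)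
      (auto intro!: integrable_real_indicator simp: less_top[symmetric])
  also have "\<dots> = (\<Sum>k\<in>?I. measure (cube_measure s) (cell s n k) *\<^sub>R f (?p k))"
  proof (rule sum.cong)
    fix k assume "k \<in> ?I"
    then have "cell s n k \<in> sets (cube_measure s)" by (rule sets)
    moreover from this have "cell s n k \<inter> unit_cube s = cell s n k"
      using sets.sets_into_space by fastforce
    ultimately show "(LINT x|cube_measure s. indicator (cell s n k) x *\<^sub>R f (?p k))
        = measure (cube_measure s) (cell s n k) *\<^sub>R f (?p k)"
      by (subst integral_scaleR_left)
        (auto intro!: integrable_real_indicator simp: less_top[symmetric])
  qed simp
  \<comment> \<open>A cell with some index n lies in a face of the cube and has measure 0, so only
    the indices of the grid remain.\<close>
  also have "\<dots> = (\<Sum>k\<in>PiE {1..s} (\<lambda>_. {..<n}). measure (cube_measure s) (cell s n k) *\<^sub>R f (?p k))"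
  proof (rule sum.mono_neutral_right[OF fin])
    show "PiE {1..s} (\<lambda>_. {..<n}) \<subseteq> ?I" by (intro PiE_mono) auto
    show "\<forall>k\<in>?I - PiE {1..s} (\<lambda>_. {..<n}). measure (cube_measure s) (cell s n k) *\<^sub>R f (?p k) = 0"
    proof
      fix k assume k: "k \<in> ?I - PiE {1..s} (\<lambda>_. {..<n})"
      then obtain j where j: "j \<in> {1..s}" "\<not> k j < n" by (auto simp: PiE_iff)
      have "measure (cube_measure s) (cell s n k) = (\<Prod>j\<in>{1..s}. if k j < n then 1 / real n else 0)"
        using k by (intro cell_measure n) (auto simp: PiE_iff)
      also have "\<dots> = 0" using j by (intro prod_zero) auto
      finally show "measure (cube_measure s) (cell s n k) *\<^sub>R f (?p k) = 0" by simp
    qed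
  qed
  also have "\<dots> = (\<Sum>k\<in>PiE {1..s} (\<lambda>_. {..<n}). (1 / of_nat (n ^ s)) * f (?p k))"
  proof (rule sum.cong)
    fix k assume k: "k \<in> PiE {1..s} (\<lambda>_. {..<n})"
    then have "measure (cube_measure s) (cell s n k) = (\<Prod>j\<in>{1..s}. if k j < n then 1 / real n else 0)"
      by (intro cell_measure n) (auto simp: PiE_iff less_imp_le)
    also have "\<dots> = (\<Prod>j\<in>{1..s}. 1 / real n)"
      using k by (intro prod.cong) (auto simp: PiE_iff)
    finally show "measure (cube_measure s) (cell s n k) *\<^sub>R f (?p k) = (1 / of_nat (n ^ s)) * f (?p k)"
      by (simp add: scaleR_conv_of_real power_one_over)
  qed simp
  finally show "(LINT x|cube_measure s. ?F x) = (1 / of_nat (n ^ s)) * (\<Sum>y\<in>#grid s n. f y)"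
    by (simp add: F_def sum_grid sum_distrib_left)
qed

text \<open>Measurability of f is obtained on the way, as f is the pointwise limit of its step
  functions; dominated convergence with the constant B does the rest. Continuity is phrased by
  sequences converging in the coordinates 1 to s, the form in which the reproducing property yields
  it.\<close>

lemma grid_mean_tendsto_integral:
  fixes f :: "(nat \<Rightarrow> real) \<Rightarrow> complex"
  assumes bound: "\<And>x. x \<in> unit_cube s \<Longrightarrow> cmod (f x) \<le> B"
    and cont: "\<And>X x. x \<in> unit_cube s \<Longrightarrow> (\<And>n. X n \<in> unit_cube s) \<Longrightarrow>
      (\<And>j. j \<in> {1..s} \<Longrightarrow> (\<lambda>n::nat. X n j) \<longlonglongrightarrow> x j) \<Longrightarrow> (\<lambda>n. f (X n)) \<longlonglongrightarrow> f x"
  shows "(\<lambda>n. (1 / of_nat (Suc n ^ s)) * (\<Sum>y\<in>#grid s (Suc n). f y)) \<longlonglongrightarrow> (LINT x|cube_measure s. f x)"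
proof -
  interpret finite_measure "cube_measure s" by (rule finite_measure_cube)
  let ?r = "\<lambda>n x. \<lambda>j\<in>{1..s}. real_of_int \<lfloor>real (Suc n) * x j\<rfloor> / real (Suc n)"
  have r: "?r n x \<in> unit_cube s" if x: "x \<in> unit_cube s" for n x
  proof -
    have "0 \<le> \<lfloor>real (Suc n) * x j\<rfloor>" "\<lfloor>real (Suc n) * x j\<rfloor> \<le> int (Suc n)" if "j \<in> {1..s}" for j
    proof -
      have xj: "0 \<le> x j" "x j \<le> 1" using x that by (auto simp: unit_cube_def PiE_iff)
      then show "0 \<le> \<lfloor>real (Suc n) * x j\<rfloor>" by simp
      have "real (Suc n) * x j \<le> real (Suc n)" using xj by (intro mult_left_le) auto
      then show "\<lfloor>real (Suc n) * x j\<rfloor> \<le> int (Suc n)" by linarith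
    qed
    then have "0 \<le> real_of_int \<lfloor>real (Suc n) * x j\<rfloor>" "real_of_int \<lfloor>real (Suc n) * x j\<rfloor> \<le> real (Suc n)"
      if "j \<in> {1..s}" for j
      using that by (metis of_int_0_le_iff, metis of_int_le_iff of_int_of_nat_eq)
    then show ?thesis
      by (auto simp: unit_cube_def PiE_iff divide_le_eq_1 simp del: of_nat_Suc)
  qed
  have lim: "(\<lambda>n. f (?r n x)) \<longlonglongrightarrow> f x" if x: "x \<in> unit_cube s" for x
  proof (rule cont[OF x])
    show "?r n x \<in> unit_cube s" for n using r[OF x] .
    fix j assume j: "j \<in> {1..s}"
    have "(\<lambda>n. real_of_int \<lfloor>real (Suc n) * x j\<rfloor> / real (Suc n) - x j) \<longlonglongrightarrow> 0"
    proof (rule Lim_null_comparison)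
      show "\<forall>\<^sub>F n in sequentially. norm (real_of_int \<lfloor>real (Suc n) * x j\<rfloor> / real (Suc n) - x j) \<le> 1 / real (Suc n)"
      proof (intro always_eventually allI)
        fix n
        have "norm (real_of_int \<lfloor>real (Suc n) * x j\<rfloor> / real (Suc n) - x j)
            = \<bar>real_of_int \<lfloor>real (Suc n) * x j\<rfloor> - real (Suc n) * x j\<bar> / real (Suc n)"
          by (simp add: field_simps abs_div_pos del: of_nat_Suc)
        also have "\<dots> \<le> 1 / real (Suc n)"
          by (intro divide_right_mono) linarith+
        finally show "norm (real_of_int \<lfloor>real (Suc n) * x j\<rfloor> / real (Suc n) - x j) \<le> 1 / real (Suc n)" .
      qed
      show "(\<lambda>n. 1 / real (Suc n)) \<longlonglongrightarrow> 0"
        using LIMSEQ_inverse_real_of_nat by (simp add: inverse_eq_divide)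
    qed
    then show "(\<lambda>n. ?r n x j) \<longlonglongrightarrow> x j"
      using j LIM_zero_cancel by fastforce
  qed
  have meas: "(\<lambda>x. f (?r n x)) \<in> borel_measurable (cube_measure s)" for n
    by (rule grid_step_integral(1)) simp
  have "f \<in> borel_measurable (cube_measure s)"
    using lim by (rule_tac borel_measurable_LIMSEQ_metric[OF meas]) simp
  then have "(\<lambda>n. LINT x|cube_measure s. f (?r n x)) \<longlonglongrightarrow> (LINT x|cube_measure s. f x)"
    using meas lim bound r by (intro integral_dominated_convergence[where w = "\<lambda>_. B"]) auto
  moreover have "(LINT x|cube_measure s. f (?r n x)) = (1 / of_nat (Suc n ^ s)) * (\<Sum>y\<in>#grid s (Suc n). f y)" for n
    by (rule grid_step_integral(2)) simp
  ultimately show ?thesis by simp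
qed

section \<open>Worst-case errors in Korobov spaces\<close>

lemma phi_grid_mean_prod:
  assumes \<alpha>: "\<alpha> > 1" and n: "n > 0" and u: "u \<subseteq> {1..s}"
  shows "(1 / of_nat (n ^ s)) * (\<Sum>k\<in>PiE {1..s} (\<lambda>_. {..<n}). \<Prod>j\<in>u. phi \<alpha> (x j - real (k j) / real n))
    = (\<Prod>j\<in>u. of_real (real n powr (- \<alpha>)) * phi \<alpha> (real n * x j))"
proof -
  let ?g = "\<lambda>j i. if j \<in> u then phi \<alpha> (x j - real i / real n) else 1"
  have restrict: "(\<Prod>j\<in>u. f j) = (\<Prod>j\<in>{1..s}. if j \<in> u then f j else 1)" for f :: "nat \<Rightarrow> complex"
    using u by (subst prod.inter_restrict[symmetric]) (auto simp: Int_absorb1)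
  have "(\<Sum>k\<in>PiE {1..s} (\<lambda>_. {..<n}). \<Prod>j\<in>u. phi \<alpha> (x j - real (k j) / real n))
      = (\<Sum>k\<in>PiE {1..s} (\<lambda>_. {..<n}). \<Prod>j\<in>{1..s}. ?g j (k j))"
    by (intro sum.cong refl) (rule restrict)
  also have "\<dots> = (\<Prod>j\<in>{1..s}. \<Sum>i<n. ?g j i)"
    by (intro prod_sum_PiE[symmetric]) auto
  finally have "(1 / of_nat (n ^ s)) * (\<Sum>k\<in>PiE {1..s} (\<lambda>_. {..<n}). \<Prod>j\<in>u. phi \<alpha> (x j - real (k j) / real n))
      = (\<Prod>j\<in>{1..s}. (1 / of_nat n) * (\<Sum>i<n. ?g j i))"
    by (simp add: prod_dividef)
  also have "\<dots> = (\<Prod>j\<in>{1..s}. if j \<in> u then of_real (real n powr (- \<alpha>)) * phi \<alpha> (real n * x j) else 1)"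
    using n by (intro prod.cong refl) (simp add: phi_grid_mean[OF \<alpha> n, simplified])
  also have "\<dots> = (\<Prod>j\<in>u. of_real (real n powr (- \<alpha>)) * phi \<alpha> (real n * x j))"
    by (rule restrict[symmetric])
  finally show ?thesis .
qed

text \<open>Differences of lattice points are, modulo 1, again lattice points, with index k - l
  modulo N. This makes the inner one of the two kernel means independent of l, so the double mean
  collapses to a single one.\<close>

lemma sum_periodic_shift:
  fixes \<psi> :: "int \<Rightarrow> complex"
  assumes N: "N > 0" and per: "\<And>i. \<psi> (i mod int N) = \<psi> i"
  shows "(\<Sum>k<N. \<psi> (int k - l)) = (\<Sum>k<N. \<psi> (int k))"
proof (rule sum.reindex_bij_witness[where i = "\<lambda>k. nat ((int k + l) mod int N)"
      and j = "\<lambda>k. nat ((int k - l) mod int N)"])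
  fix k assume k: "k \<in> {..<N}"
  show "nat ((int (nat ((int k - l) mod int N)) + l) mod int N) = k"
    using N k by (simp add: mod_add_left_eq)
  show "nat ((int (nat ((int k + l) mod int N)) - l) mod int N) = k"
    using N k by (simp add: mod_diff_left_eq)
  have "(int k - l) mod int N < int N" using N by simp
  then show "nat ((int k - l) mod int N) \<in> {..<N}" using N by (simp add: nat_less_iff)
  have "(int k + l) mod int N < int N" using N by simp
  then show "nat ((int k + l) mod int N) \<in> {..<N}" using N by (simp add: nat_less_iff)
  show "\<psi> (int (nat ((int k - l) mod int N))) = \<psi> (int k - l)"
    using N per by simp
qed

lemma phi_frac_diff: "phi \<alpha> (frac a - frac b) = phi \<alpha> (a - b)"
proof -
  have "frac a - frac b = (a - b) + of_int (\<lfloor>b\<rfloor> - \<lfloor>a\<rfloor>)"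
    by (simp add: frac_def)
  then show ?thesis by (simp only: phi_add_int)
qed

text \<open>The dimension is fixed, while \<open>H\<close> and \<open>ip\<close> stay sequences,
  because \<open>wce\<close> and \<open>initial_error\<close> expect them in that form.\<close>

locale korobov_space = rkhs "unit_cube s" "korobov_kernel \<alpha> \<gamma> s" "H s" "ip s"
  for s :: nat and \<alpha> :: real and \<gamma> :: "nat set \<Rightarrow> real" and H :: spaces and ip :: inner_products +
  assumes alpha: "\<alpha> > 1"
begin

abbreviation "ker \<equiv> korobov_kernel \<alpha> \<gamma> s"

lemma ker_eq: "ker x y = 1 + (\<Sum>u\<in>Pow {1..s} - {{}}. of_real (\<gamma> u) * (\<Prod>j\<in>u. phi \<alpha> (x j - y j)))"
  by (rule korobov_kernel_eq[OF alpha])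

lemma ker_diag: "ker x x = ker y y"
  by (simp add: ker_eq)

section \<open>Continuity and boundedness of the members of the space\<close>

lemma phi_tendsto: "f \<longlonglongrightarrow> t \<Longrightarrow> (\<lambda>n. phi \<alpha> (f n)) \<longlonglongrightarrow> phi \<alpha> t"
  using continuous_on_tendsto_compose[OF continuous_on_phi[OF alpha]] by simp

lemma ker_tendsto:
  assumes "\<And>j. j \<in> {1..s} \<Longrightarrow> (\<lambda>n. X n j) \<longlonglongrightarrow> x j"
    and "\<And>j. j \<in> {1..s} \<Longrightarrow> (\<lambda>n. Y n j) \<longlonglongrightarrow> y j"
  shows "(\<lambda>n. ker (X n) (Y n)) \<longlonglongrightarrow> ker x y"
  unfolding ker_eq using assms
  by (intro tendsto_intros phi_tendsto tendsto_prod tendsto_sum) auto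

lemma ip_sections:
  assumes "x \<in> unit_cube s" "y \<in> unit_cube s"
  shows "ip s (section_at x) (section_at y) = ker y x"
  using reproducing[OF kernel_mem[OF assms(1)] assms(2)] assms by simp

lemma ip_norm_section_diff:
  assumes x: "x \<in> unit_cube s" and y: "y \<in> unit_cube s"
  shows "ip_norm (ip s) (\<lambda>z. section_at x z - section_at y z)
    = sqrt (Re (ker x x - ker y x - (ker x y - ker y y)))"
  using kernel_mem[OF x] kernel_mem[OF y] diff_mem[OF kernel_mem[OF x] kernel_mem[OF y]]
    ip_sections[OF x x] ip_sections[OF x y] ip_sections[OF y x] ip_sections[OF y y]
  by (simp add: ip_norm_def ip_diff_left ip_diff_right)

text \<open>The squared distance of two kernel sections is a combination of four kernel values that
  vanishes in the limit by continuity of the kernel; members inherit this through the reproducing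
  property.\<close>

lemma tendsto_mem:
  assumes f: "f \<in> H s" and x: "x \<in> unit_cube s" and X: "\<And>n. X n \<in> unit_cube s"
    and lim: "\<And>j. j \<in> {1..s} \<Longrightarrow> (\<lambda>n::nat. X n j) \<longlonglongrightarrow> x j"
  shows "(\<lambda>n. f (X n)) \<longlonglongrightarrow> f x"
proof -
  have "(\<lambda>n. sqrt (Re (ker (X n) (X n) - ker x (X n) - (ker (X n) x - ker x x))))
      \<longlonglongrightarrow> sqrt (Re (ker x x - ker x x - (ker x x - ker x x)))"
    by (intro tendsto_intros ker_tendsto lim)
  then have "(\<lambda>n. ip_norm (ip s) (\<lambda>z. section_at (X n) z - section_at x z)) \<longlonglongrightarrow> 0"
    by (simp add: ip_norm_section_diff[OF X x])
  from ip_tendsto(1)[OF kernel_mem[OF X] kernel_mem[OF x] f this]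
  show ?thesis
    using reproducing[OF f x] reproducing[OF f X] by simp
qed

text \<open>The kernel depends only on differences, so its diagonal is constant and all sections
  have the same norm. The point \<open>\<lambda>_. 0\<close> merely names this diagonal value; it
  need not lie in \<open>unit_cube s\<close>, whose elements are extensional.\<close>

lemma cmod_mem_le:
  assumes f: "f \<in> H s" and x: "x \<in> unit_cube s"
  shows "cmod (f x) \<le> ip_norm (ip s) f * sqrt (Re (ker (\<lambda>_. 0) (\<lambda>_. 0)))"
proof -
  have "ip_norm (ip s) (section_at x) = sqrt (Re (ker (\<lambda>_. 0) (\<lambda>_. 0)))"
    unfolding ip_norm_def ip_sections[OF x x] ker_diag[of "\<lambda>_. 0" x] ..
  then show ?thesis
    using Cauchy_Schwarz[OF f kernel_mem[OF x]] reproducing[OF f x] by simp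
qed

definition grid_mean :: "nat \<Rightarrow> (nat \<Rightarrow> real) \<Rightarrow> complex"
  where "grid_mean n = kernel_mean (grid s (Suc n))"

text \<open>Dominates the kernel minus 1 at all arguments. Absolute values appear because the locale
  fixes no sign of \<open>\<gamma>\<close>.\<close>

definition weight_bound :: real
  where "weight_bound = (\<Sum>u\<in>Pow {1..s} - {{}}. \<bar>\<gamma> u\<bar> * (2 * zeta \<alpha>) ^ card u)"

lemma grid_mean_mem: "grid_mean n \<in> H s"
  unfolding grid_mean_def by (rule kernel_mean_mem[OF grid_subset])

lemma grid_mean_eq:
  assumes x: "x \<in> unit_cube s"
  shows "grid_mean n x = 1 + (\<Sum>u\<in>Pow {1..s} - {{}}. of_real (\<gamma> u) *
    (\<Prod>j\<in>u. of_real (real (Suc n) powr (- \<alpha>)) * phi \<alpha> (real (Suc n) * x j)))"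
proof -
  let ?I = "PiE {1..s} (\<lambda>_. {..<Suc n})" and ?p = "\<lambda>k. \<lambda>j\<in>{1..s}. real (k j) / real (Suc n)"
  have c: "of_nat (card ?I) = (of_nat (Suc n ^ s) :: complex)" by (simp add: card_PiE)
  have "grid_mean n x = (1 / of_nat (Suc n ^ s)) * (\<Sum>k\<in>?I. ker x (?p k))"
    using x by (simp add: grid_mean_def kernel_mean_def sum_grid)
  also have "(\<Sum>k\<in>?I. ker x (?p k)) = of_nat (Suc n ^ s) +
      (\<Sum>u\<in>Pow {1..s} - {{}}. of_real (\<gamma> u) * (\<Sum>k\<in>?I. \<Prod>j\<in>u. phi \<alpha> (x j - ?p k j)))"
    unfolding ker_eq sum.distrib sum_constant c mult_1_right
    by (subst sum.swap) (simp add: sum_distrib_left)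
  also have "(1 / of_nat (Suc n ^ s)) * \<dots> = 1 + (\<Sum>u\<in>Pow {1..s} - {{}}. of_real (\<gamma> u) *
      ((1 / of_nat (Suc n ^ s)) * (\<Sum>k\<in>?I. \<Prod>j\<in>u. phi \<alpha> (x j - ?p k j))))"
    by (simp add: ring_distribs sum_distrib_left mult_ac del: of_nat_Suc)
  also have "\<dots> = 1 + (\<Sum>u\<in>Pow {1..s} - {{}}. of_real (\<gamma> u) *
      (\<Prod>j\<in>u. of_real (real (Suc n) powr (- \<alpha>)) * phi \<alpha> (real (Suc n) * x j)))"
  proof (intro arg_cong2[where f = "(+)"] sum.cong arg_cong2[where f = "(*)"] refl)
    fix u assume u: "u \<in> Pow {1..s} - {{}}"
    have "(\<Sum>k\<in>?I. \<Prod>j\<in>u. phi \<alpha> (x j - ?p k j))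
        = (\<Sum>k\<in>?I. \<Prod>j\<in>u. phi \<alpha> (x j - real (k j) / real (Suc n)))"
      using u by (intro sum.cong prod.cong refl) auto
    then show "(1 / of_nat (Suc n ^ s)) * (\<Sum>k\<in>?I. \<Prod>j\<in>u. phi \<alpha> (x j - ?p k j))
        = (\<Prod>j\<in>u. of_real (real (Suc n) powr (- \<alpha>)) * phi \<alpha> (real (Suc n) * x j))"
      using u phi_grid_mean_prod[OF alpha, of "Suc n" u s x] by simp
  qed
  finally show ?thesis .
qed

text \<open>Every u in the sum is nonempty and hence contributes at least one factor
  \<open>real (Suc n) powr (- \<alpha>)\<close>, the further ones being at most 1. That the rate is
  uniform in x is what gives control over inner products of grid means.\<close>

lemma grid_mean_bound:
  assumes x: "x \<in> unit_cube s"
  shows "cmod (grid_mean n x - 1) \<le> real (Suc n) powr (- \<alpha>) * weight_bound"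
proof -
  let ?c = "real (Suc n) powr (- \<alpha>)"
  have c: "0 \<le> ?c" "?c \<le> 1"
    using alpha by (auto simp: powr_minus inverse_le_1_iff ge_one_powr_ge_zero)
  have z: "0 \<le> zeta \<alpha>" using zeta_pos[OF alpha] by simp
  have "cmod (grid_mean n x - 1) \<le> (\<Sum>u\<in>Pow {1..s} - {{}}. cmod (of_real (\<gamma> u) *
    (\<Prod>j\<in>u. of_real ?c * phi \<alpha> (real (Suc n) * x j))))"
    unfolding grid_mean_eq[OF x] by (simp only: add_diff_cancel_left' norm_sum)
  also have "\<dots> \<le> (\<Sum>u\<in>Pow {1..s} - {{}}. ?c * (\<bar>\<gamma> u\<bar> * (2 * zeta \<alpha>) ^ card u))"
  proof (rule sum_mono)
    fix u assume "u \<in> Pow {1..s} - {{}}"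
    then have u: "finite u" "u \<noteq> {}" by (auto intro: finite_subset)
    have "cmod (\<Prod>j\<in>u. of_real ?c * phi \<alpha> (real (Suc n) * x j))
        = (\<Prod>j\<in>u. ?c * cmod (phi \<alpha> (real (Suc n) * x j)))"
      by (simp add: prod_norm[symmetric] norm_mult)
    also have "\<dots> \<le> (\<Prod>j\<in>u. ?c * (2 * zeta \<alpha>))"
      by (intro prod_mono) (auto intro!: mult_left_mono norm_phi_le[OF alpha])
    also have "\<dots> = ?c ^ card u * (2 * zeta \<alpha>) ^ card u"
      by (simp only: prod_constant power_mult_distrib)
    also have "\<dots> \<le> ?c * (2 * zeta \<alpha>) ^ card u"
    proof (rule mult_right_mono)
      show "?c ^ card u \<le> ?c"
        using power_decreasing[of 1 "card u" ?c] c u by (simp add: card_gt_0_iff Suc_le_eq)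
    qed (use z in simp)
    finally show "cmod (of_real (\<gamma> u) * (\<Prod>j\<in>u. of_real ?c * phi \<alpha> (real (Suc n) * x j)))
      \<le> ?c * (\<bar>\<gamma> u\<bar> * (2 * zeta \<alpha>) ^ card u)"
      unfolding norm_mult norm_of_real
      by (metis (no_types, lifting) abs_ge_zero mult.left_commute mult_left_mono)
  qed
  finally show ?thesis by (simp add: weight_bound_def sum_distrib_left)
qed

text \<open>Serves twice with c = 1: with the rate of the grid means as B for their inner products,
  and with B = 0 for the exact mean of \<open>one\<close>.\<close>

lemma point_mean_bound:
  assumes P: "P \<noteq> {#}" "set_mset P \<subseteq> unit_cube s"
    and f: "\<And>x. x \<in> unit_cube s \<Longrightarrow> cmod (f x - c) \<le> B"
  shows "cmod (point_mean P f - c) \<le> B"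
proof -
  have bound: "cmod (\<Sum>x\<in>#P. f x - c) \<le> real (size P) * B" if "set_mset P \<subseteq> unit_cube s" for P
    using that
  proof (induction P)
    case (add x P)
    then have "cmod (f x - c) + cmod (\<Sum>x\<in>#P. f x - c) \<le> B + real (size P) * B"
      using f by (intro add_mono) auto
    then show ?case
      using norm_triangle_ineq[of "f x - c" "\<Sum>x\<in>#P. f x - c"] by (simp add: ring_distribs)
  qed simp
  have "(\<Sum>x\<in>#P. f x - c) = (\<Sum>x\<in>#P. f x) - of_nat (size P) * c"
    by (induction P) (auto simp: algebra_simps)
  with bound[OF P(2)] have le: "cmod ((\<Sum>x\<in>#P. f x) - of_nat (size P) * c) \<le> real (size P) * B"
    by (simp only:)
  have N: "real (size P) > 0" using P by (simp add: nonempty_has_size[symmetric])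
  have "complex_of_nat (size P) \<noteq> 0" using P by simp
  then have "point_mean P f - c = ((\<Sum>x\<in>#P. f x) - of_nat (size P) * c) / of_nat (size P)"
    by (simp only: point_mean_def diff_divide_distrib nonzero_mult_div_cancel_left) simp
  then have "cmod (point_mean P f - c) = cmod ((\<Sum>x\<in>#P. f x) - of_nat (size P) * c) / real (size P)"
    by (simp add: norm_divide)
  also have "\<dots> \<le> B"
    using le N by (simp add: divide_le_eq mult.commute)
  finally show ?thesis .
qed

lemma grid_nonempty: "grid s (Suc n) \<noteq> {#}"
  by (simp add: size_eq_0_iff_empty[symmetric])

text \<open>Since \<open>grid_mean n\<close> represents a point mean, the inner product is a mean of
  values of \<open>grid_mean m\<close>, all of which are uniformly close to 1.\<close>

lemma ip_grid_mean:
  "cmod (ip s (grid_mean m) (grid_mean n) - 1) \<le> real (Suc m) powr (- \<alpha>) * weight_bound"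
  unfolding grid_mean_def[of n] ip_kernel_mean[OF grid_subset grid_mean_mem]
  by (rule point_mean_bound[OF grid_nonempty grid_subset grid_mean_bound])

text \<open>Extended by 0, as members of \<open>H s\<close> have to vanish outside the cube.\<close>

definition one :: "(nat \<Rightarrow> real) \<Rightarrow> complex"
  where "one = (\<lambda>x. if x \<in> unit_cube s then 1 else 0)"

text \<open>The constant function is obtained by completeness: the grid means of kernel sections form a
  Cauchy sequence that converges pointwise to 1.\<close>

lemma one_mem: "one \<in> H s"
  and grid_mean_tendsto: "(\<lambda>n. ip_norm (ip s) (\<lambda>x. grid_mean n x - one x)) \<longlonglongrightarrow> 0"
proof -
  define \<delta> where "\<delta> n = real (Suc n) powr (- \<alpha>) * weight_bound" for n
  have wb: "weight_bound \<ge> 0"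
    unfolding weight_bound_def using zeta_pos[OF alpha] by (intro sum_nonneg) auto
  have "(\<lambda>n. real (Suc n) powr (- \<alpha>)) \<longlonglongrightarrow> 0"
    using alpha by (intro LIMSEQ_Suc tendsto_neg_powr filterlim_real_sequentially) auto
  then have \<delta>: "\<delta> \<longlonglongrightarrow> 0"
    unfolding \<delta>_def by (rule tendsto_mult_left_zero)
  \<comment> \<open>The expanded square has four inner products, two with each sign, so the ones
    cancel; each product is within \<open>\<delta> m\<close> or \<open>\<delta> n\<close> of
    1.\<close>
  have diff: "(ip_norm (ip s) (\<lambda>x. grid_mean m x - grid_mean n x))\<^sup>2 \<le> 2 * \<delta> m + 2 * \<delta> n" for m n
  proof -
    note G = grid_mean_mem[of m] grid_mean_mem[of n]
    have "(ip_norm (ip s) (\<lambda>x. grid_mean m x - grid_mean n x))\<^sup>2 =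
        Re ((ip s (grid_mean m) (grid_mean m) - 1) - (ip s (grid_mean n) (grid_mean m) - 1)
          - ((ip s (grid_mean m) (grid_mean n) - 1) - (ip s (grid_mean n) (grid_mean n) - 1)))"
      using G diff_mem[OF G] by (simp add: ip_norm_square ip_diff_left ip_diff_right)
    also have "\<dots> \<le> \<delta> m + \<delta> n + (\<delta> m + \<delta> n)"
      using ip_grid_mean[of m m] ip_grid_mean[of m n] ip_grid_mean[of n m] ip_grid_mean[of n n]
        abs_Re_le_cmod[of "ip s (grid_mean m) (grid_mean m) - 1"]
        abs_Re_le_cmod[of "ip s (grid_mean m) (grid_mean n) - 1"]
        abs_Re_le_cmod[of "ip s (grid_mean n) (grid_mean m) - 1"]
        abs_Re_le_cmod[of "ip s (grid_mean n) (grid_mean n) - 1"]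
      unfolding \<delta>_def minus_complex.sel by linarith
    finally show ?thesis by simp
  qed
  have "\<exists>f\<in>H s. (\<lambda>n. ip_norm (ip s) (\<lambda>x. grid_mean n x - f x)) \<longlonglongrightarrow> 0"
  proof (rule complete[OF grid_mean_mem])
    fix e :: real assume e: "e > 0"
    then have "\<forall>\<^sub>F n in sequentially. \<delta> n < e\<^sup>2 / 4"
      using \<delta> by (intro order_tendstoD(2)) auto
    then obtain M where M: "\<And>n. n \<ge> M \<Longrightarrow> \<delta> n < e\<^sup>2 / 4"
      by (auto simp: eventually_sequentially)
    show "\<exists>M. \<forall>m\<ge>M. \<forall>n\<ge>M. ip_norm (ip s) (\<lambda>x. grid_mean m x - grid_mean n x) < e"
    proof (intro exI allI impI)
      fix m n assume m: "m \<ge> M" and n: "n \<ge> M"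
      have "(ip_norm (ip s) (\<lambda>x. grid_mean m x - grid_mean n x))\<^sup>2 \<le> 2 * \<delta> m + 2 * \<delta> n"
        by (rule diff)
      also have "\<dots> < e\<^sup>2"
        using M[OF m] M[OF n] by linarith
      finally have "(ip_norm (ip s) (\<lambda>x. grid_mean m x - grid_mean n x))\<^sup>2 < e\<^sup>2" .
      then show "ip_norm (ip s) (\<lambda>x. grid_mean m x - grid_mean n x) < e"
        by (rule power2_less_imp_less) (use e in simp)
    qed
  qed
  then obtain g where g: "g \<in> H s" and lim: "(\<lambda>n. ip_norm (ip s) (\<lambda>x. grid_mean n x - g x)) \<longlonglongrightarrow> 0"
    by blast
  have "g x = 1" if x: "x \<in> unit_cube s" for x
  proof -
    have "(\<lambda>n. ip s (grid_mean n) (section_at x)) \<longlonglongrightarrow> ip s g (section_at x)"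
      by (rule ip_tendsto(2)[OF grid_mean_mem g kernel_mem[OF x] lim])
    then have 1: "(\<lambda>n. grid_mean n x) \<longlonglongrightarrow> g x"
      using reproducing[OF g x] reproducing[OF grid_mean_mem x] by simp
    have "(\<lambda>n. grid_mean n x - 1) \<longlonglongrightarrow> 0"
      by (rule Lim_null_comparison[OF _ \<delta>])
        (simp add: \<delta>_def grid_mean_bound[OF x] del: of_nat_Suc)
    then have "(\<lambda>n. grid_mean n x) \<longlonglongrightarrow> 1"
      by (rule LIM_zero_cancel)
    with 1 show ?thesis by (rule LIMSEQ_unique)
  qed
  then have "g = one"
    using zero_outside[OF g] by (auto simp: one_def)
  with g lim show "one \<in> H s" "(\<lambda>n. ip_norm (ip s) (\<lambda>x. grid_mean n x - one x)) \<longlonglongrightarrow> 0"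
    by simp_all
qed

section \<open>Integration as an inner product, and the error as a norm\<close>

lemma point_mean_grid_tendsto:
  assumes f: "f \<in> H s"
  shows "(\<lambda>n. point_mean (grid s (Suc n)) f) \<longlonglongrightarrow> ip s f one"
proof -
  have "(\<lambda>n. ip s f (grid_mean n)) \<longlonglongrightarrow> ip s f one"
    by (rule ip_tendsto(1)[OF grid_mean_mem one_mem f grid_mean_tendsto])
  then show ?thesis
    by (simp add: grid_mean_def ip_kernel_mean[OF grid_subset f])
qed

text \<open>The grid means of f have two limits: as Riemann sums they tend to the integral, and by
  norm convergence of their representers to the inner product.\<close>

lemma integral_eq_ip:
  assumes f: "f \<in> H s"
  shows "(LINT x|cube_measure s. f x) = ip s f one"
proof (rule LIMSEQ_unique[OF _ point_mean_grid_tendsto[OF f]])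
  have "(\<lambda>n. (1 / of_nat (Suc n ^ s)) * (\<Sum>y\<in>#grid s (Suc n). f y)) \<longlonglongrightarrow> (LINT x|cube_measure s. f x)"
    by (rule grid_mean_tendsto_integral[OF cmod_mem_le[OF f] tendsto_mem[OF f]])
  then show "(\<lambda>n. point_mean (grid s (Suc n)) f) \<longlonglongrightarrow> (LINT x|cube_measure s. f x)"
    by (simp only: point_mean_def size_grid)
qed

lemma point_mean_one:
  assumes "P \<noteq> {#}" "set_mset P \<subseteq> unit_cube s"
  shows "point_mean P one = 1"
  using point_mean_bound[OF assms, of one 1 0] by (simp add: one_def)

lemma ip_one_one: "ip s one one = 1"
  using point_mean_grid_tendsto[OF one_mem]
  by (simp add: point_mean_one[OF grid_nonempty grid_subset] LIMSEQ_const_iff)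

lemma initial_error_eq_1: "initial_error H ip s = 1"
proof -
  have "initial_error H ip s = (SUP f\<in>{f \<in> H s. ip_norm (ip s) f \<le> 1}. cmod (ip s f one))"
    unfolding initial_error_def unit_ball_def by (intro SUP_cong refl) (simp add: integral_eq_ip)
  also have "\<dots> = 1"
    unfolding SUP_cmod_ip(2)[OF one_mem] by (simp add: ip_norm_def ip_one_one)
  finally show ?thesis .
qed

lemma wce_eq:
  assumes P: "P \<noteq> {#}" "set_mset P \<subseteq> unit_cube s"
  shows "wce H ip s P = ip_norm (ip s) (\<lambda>x. one x - kernel_mean P x)"
proof -
  note mem = one_mem kernel_mean_mem[OF P(2)]
  have "wce H ip s P = (SUP f\<in>{f \<in> H s. ip_norm (ip s) f \<le> 1}. cmod (ip s f (\<lambda>x. one x - kernel_mean P x)))"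
    unfolding wce_def unit_ball_def
  proof (intro SUP_cong refl)
    fix f assume "f \<in> {f \<in> H s. ip_norm (ip s) f \<le> 1}"
    then have f: "f \<in> H s" by simp
    show "cmod ((LINT x|cube_measure s. f x) - (1 / of_nat (size P)) * (\<Sum>x\<in>#P. f x))
        = cmod (ip s f (\<lambda>x. one x - kernel_mean P x))"
      using ip_diff_right[OF mem f] ip_kernel_mean[OF P(2) f]
      by (simp add: integral_eq_ip[OF f] point_mean_def)
  qed
  also have "\<dots> = ip_norm (ip s) (\<lambda>x. one x - kernel_mean P x)"
    by (rule SUP_cmod_ip(2)[OF diff_mem[OF mem]])
  finally show ?thesis .
qed

lemma wce_nonneg:
  assumes "P \<noteq> {#}" "set_mset P \<subseteq> unit_cube s"
  shows "0 \<le> wce H ip s P"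
  unfolding wce_eq[OF assms] by (rule ip_norm_nonneg[OF diff_mem[OF one_mem kernel_mean_mem[OF assms(2)]]])

text \<open>Both mixed products of \<open>one\<close> and \<open>kernel_mean P\<close> equal 1,
  being means of a constant, so the expanded square is 1 - 1 - 1 plus the double kernel
  mean.\<close>

lemma wce_square:
  assumes P: "P \<noteq> {#}" "set_mset P \<subseteq> unit_cube s"
  shows "(wce H ip s P)\<^sup>2 = Re (point_mean P (\<lambda>x. point_mean P (ker x))) - 1"
proof -
  note mem = one_mem kernel_mean_mem[OF P(2)]
  have one_km: "ip s one (kernel_mean P) = 1"
    using ip_kernel_mean[OF P(2) one_mem] point_mean_one[OF P] by simp
  have km_one: "ip s (kernel_mean P) one = 1"
    using ip_commute[OF mem(2,1)] one_km by simp
  have "ip s (kernel_mean P) (kernel_mean P) = point_mean P (kernel_mean P)"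
    by (rule ip_kernel_mean[OF P(2) mem(2)])
  also have "\<dots> = point_mean P (\<lambda>x. point_mean P (ker x))"
    unfolding point_mean_def[of _ "kernel_mean P"] point_mean_def[of _ "\<lambda>x. point_mean P (ker x)"]
    using P(2) by (intro arg_cong2[where f = "(*)"] arg_cong[where f = sum_mset] image_mset_cong refl)
      (auto simp: kernel_mean_def point_mean_def)
  finally show ?thesis
    unfolding wce_eq[OF P] ip_norm_square[OF diff_mem[OF mem]]
    using mem diff_mem[OF mem] one_km km_one ip_one_one by (simp add: ip_diff_left ip_diff_right)
qed

section \<open>Lattice point sets\<close>

lemma lattice_points_subset: "set_mset (lattice_points s N z) \<subseteq> unit_cube s"
  by (auto simp: lattice_points_def unit_cube_def less_imp_le frac_lt_1)

lemma lattice_points_nonempty: "N > 0 \<Longrightarrow> lattice_points s N z \<noteq> {#}"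
  by (simp add: lattice_points_def mset_set_empty_iff)

lemma point_mean_lattice:
  "point_mean (lattice_points s N z) f
    = (1 / of_nat N) * (\<Sum>k<N. f (\<lambda>j\<in>{1..s}. frac (real k / real N * of_int (z j))))"
  by (simp add: point_mean_def lattice_points_def sum_unfold_sum_mset multiset.map_comp o_def lessThan_atLeast0)

lemma lattice_wce_square:
  assumes N: "N > 0"
  shows "(lattice_wce H ip N s z)\<^sup>2 = (\<Sum>u\<in>Pow {1..s} - {{}}. \<gamma> u * dual_sum \<alpha> N z u)"
proof -
  let ?p = "\<lambda>k. \<lambda>j\<in>{1..s}. frac (real k / real N * of_int (z j))"
  let ?\<psi> = "\<lambda>u i. \<Prod>j\<in>u. phi \<alpha> (of_int i / real N * of_int (z j))"
  have per: "?\<psi> u (i mod int N) = ?\<psi> u i" for u i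
  proof (rule prod.cong)
    fix j
    have "i = i mod int N + int N * (i div int N)" by simp
    then have "real_of_int i = of_int (i mod int N) + real N * of_int (i div int N)"
      by (metis of_int_add of_int_mult of_int_of_nat_eq)
    then have "of_int i / real N * of_int (z j)
        = of_int (i mod int N) / real N * of_int (z j) + of_int (i div int N * z j)"
      using N by (simp add: field_simps)
    then show "phi \<alpha> (of_int (i mod int N) / real N * of_int (z j)) = phi \<alpha> (of_int i / real N * of_int (z j))"
      by (simp only: phi_add_int)
  qed simp
  have shift: "(\<Sum>k<N. ?\<psi> u (int k - l)) = (\<Sum>k<N. ?\<psi> u (int k))" for u l
    by (rule sum_periodic_shift[OF N, where \<psi> = "?\<psi> u"]) (rule per)
  \<comment> \<open>The right-hand side is free of l; this is where the group structure of the
    lattice enters.\<close>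
  have mean: "(1 / of_nat N) * (\<Sum>k<N. ker (?p k) (?p l))
      = 1 + (\<Sum>u\<in>Pow {1..s} - {{}}. of_real (\<gamma> u * dual_sum \<alpha> N z u))" for l
  proof -
    have "ker (?p k) (?p l) = 1 + (\<Sum>u\<in>Pow {1..s} - {{}}. of_real (\<gamma> u) * ?\<psi> u (int k - int l))" for k
    proof -
      have "(\<Prod>j\<in>u. phi \<alpha> (?p k j - ?p l j)) = ?\<psi> u (int k - int l)" if "u \<in> Pow {1..s} - {{}}" for u
      proof (rule prod.cong)
        fix j assume "j \<in> u"
        then have "j \<in> {1..s}" using that by auto
        then show "phi \<alpha> (?p k j - ?p l j) = phi \<alpha> (of_int (int k - int l) / real N * of_int (z j))"
          by (simp add: phi_frac_diff diff_divide_distrib left_diff_distrib)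
      qed simp
      then show ?thesis unfolding ker_eq by simp
    qed
    then have "(\<Sum>k<N. ker (?p k) (?p l))
        = of_nat N + (\<Sum>u\<in>Pow {1..s} - {{}}. of_real (\<gamma> u) * (\<Sum>k<N. ?\<psi> u (int k - int l)))"
      by (simp only: sum.distrib) (subst sum.swap, simp add: sum_distrib_left)
    also have "\<dots> = of_nat N + (\<Sum>u\<in>Pow {1..s} - {{}}. of_real (\<gamma> u) * (\<Sum>k<N. ?\<psi> u (int k)))"
      by (simp only: shift)
    also have "(1 / of_nat N) * \<dots>
        = 1 + (\<Sum>u\<in>Pow {1..s} - {{}}. of_real (\<gamma> u) * ((1 / of_nat N) * (\<Sum>k<N. ?\<psi> u (int k))))"
      using N by (simp add: distrib_left sum_distrib_left mult.left_commute)
    also have "\<dots> = 1 + (\<Sum>u\<in>Pow {1..s} - {{}}. of_real (\<gamma> u * dual_sum \<alpha> N z u))"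
    proof (intro arg_cong2[where f = "(+)"] sum.cong refl)
      fix u assume "u \<in> Pow {1..s} - {{}}"
      then have "finite u" by (auto intro: finite_subset)
      from lattice_mean_prod_phi[OF alpha this N, of z]
      show "of_real (\<gamma> u) * ((1 / of_nat N) * (\<Sum>k<N. ?\<psi> u (int k))) = of_real (\<gamma> u * dual_sum \<alpha> N z u)"
        by (simp only: of_int_of_nat_eq of_real_mult)
    qed
    finally show ?thesis .
  qed
  have "point_mean (lattice_points s N z) (\<lambda>x. point_mean (lattice_points s N z) (ker x))
      = (1 / of_nat N) * (\<Sum>k<N. (1 / of_nat N) * (\<Sum>l<N. ker (?p k) (?p l)))"
    by (simp only: point_mean_lattice)
  \<comment> \<open>After the exchange the first argument of \<open>ker\<close> is averaged inside,
    as in \<open>mean\<close>, and the outer mean is over a constant.\<close>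
  also have "\<dots> = (1 / of_nat N) * (\<Sum>l<N. (1 / of_nat N) * (\<Sum>k<N. ker (?p k) (?p l)))"
    by (simp only: sum_distrib_left[symmetric]) (subst sum.swap, rule refl)
  also have "\<dots> = 1 + (\<Sum>u\<in>Pow {1..s} - {{}}. of_real (\<gamma> u * dual_sum \<alpha> N z u))"
    unfolding mean using N by simp
  finally show ?thesis
    unfolding lattice_wce_def wce_square[OF lattice_points_nonempty[OF N] lattice_points_subset]
    by (simp flip: of_real_sum)
qed

lemma min_error_le:
  assumes "size P > 0" "set_mset P \<subseteq> unit_cube s"
  shows "min_error H ip (size P) s \<le> wce H ip s P"
  unfolding min_error_def
proof (rule cINF_lower)
  show "bdd_below (wce H ip s ` {Q. size Q = size P \<and> set_mset Q \<subseteq> unit_cube s})"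
    using assms(1) by (intro bdd_belowI2[where m = 0] wce_nonneg) auto
qed (use assms in simp)

end

section \<open>Averaging over the candidates\<close>

text \<open>Divided by their sum, both parts lie in [0,1], where a positive exponent of at most 1
  does not decrease a number.\<close>

lemma powr_add_le:
  fixes x y :: real
  assumes "0 \<le> x" "0 \<le> y" "0 < l" "l \<le> 1"
  shows "(x + y) powr l \<le> x powr l + y powr l"
proof (cases "x + y = 0")
  case True
  then show ?thesis using assms by simp
next
  case False
  then have S: "x + y > 0" using assms by simp
  have le: "p / (x + y) * (x + y) powr l \<le> p powr l" if "0 \<le> p" "p \<le> x + y" for p
  proof -
    have "(p / (x + y)) powr 1 \<le> (p / (x + y)) powr l"
      using that S assms by (intro powr_mono') (auto simp: divide_le_eq_1)
    then have "p / (x + y) * (x + y) powr l \<le> (p / (x + y)) powr l * (x + y) powr l"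
      using that S by (intro mult_right_mono) auto
    also have "\<dots> = (p / (x + y) * (x + y)) powr l"
      using that S by (intro powr_mult[symmetric])
    finally show ?thesis using S by simp
  qed
  have "(x + y) powr l = x / (x + y) * (x + y) powr l + y / (x + y) * (x + y) powr l"
    using S by (simp add: distrib_right[symmetric] add_divide_distrib[symmetric])
  then show ?thesis
    using le[of x] le[of y] assms by simp
qed

lemma powr_sum_le:
  fixes f :: "'a \<Rightarrow> real"
  assumes "finite A" "\<And>x. x \<in> A \<Longrightarrow> 0 \<le> f x" "0 < l" "l \<le> 1"
  shows "(\<Sum>x\<in>A. f x) powr l \<le> (\<Sum>x\<in>A. f x powr l)"
  using assms(1,2)
proof (induction rule: finite_induct)
  case (insert a A)
  have "(f a + sum f A) powr l \<le> f a powr l + sum f A powr l"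
    using insert assms by (intro powr_add_le) (auto intro: sum_nonneg)
  with insert show ?case by force
qed simp

text \<open>The summation variable is split into its entry a at d and the rest g, after enlarging F
  to a product set. For fixed g the condition is a linear congruence in \<open>a * t\<close>;
  \<open>red\<close> removes the factor Y from it, with a new constant term that depends on g alone,
  and the sum over t and a is then at most \<open>2 * zeta y\<close> whatever this term is. What
  remains is a sum of products over g. Finite F suffice, as the infinite sums are reached by a limit
  afterwards.\<close>

lemma sum_lattice_finite_le:
  fixes N :: nat and Y M :: int
  assumes y: "y > 1" and u: "finite u" "d \<notin> u"
    and M: "M > 0" and T: "T \<subseteq> {1..M}" and cop: "\<And>t. t \<in> T \<Longrightarrow> coprime t M"
    and red: "\<And>c. \<exists>c'. \<forall>x. int N dvd Y * x + c \<longrightarrow> M dvd x + c'"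
    and F: "finite F" "F \<subseteq> PiE (insert d u) (\<lambda>_. - {0::int})"
  shows "(\<Sum>t\<in>T. \<Sum>h\<in>F. if int N dvd (\<Sum>j\<in>insert d u. h j * (z(d := Y * t)) j)
      then \<Prod>j\<in>insert d u. \<bar>real_of_int (h j)\<bar> powr (- y) else 0) \<le> (2 * zeta y) ^ card (insert d u)"
proof -
  let ?A = "(\<lambda>h. h d) ` F" and ?G = "(\<lambda>h. restrict h u) ` F"
  let ?e = "\<lambda>h. (h d, restrict h u)"
  let ?c = "\<lambda>g. \<Sum>j\<in>u. g j * z j"
  let ?P = "\<lambda>g. \<Prod>j\<in>u. \<bar>real_of_int (g j)\<bar> powr (- y)"
  let ?v = "\<lambda>t a g. if int N dvd Y * (a * t) + ?c g then \<bar>real_of_int a\<bar> powr (- y) * ?P g else 0"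
  have A: "finite ?A" "0 \<notin> ?A" using F by (auto simp: PiE_iff)
  have G: "finite ?G" "?G \<subseteq> PiE u (\<lambda>_. - {0})" using F by (auto simp: PiE_iff)
  have P0: "0 \<le> ?P g" for g by (intro prod_nonneg) simp
  have inj: "inj_on ?e F"
  proof (rule inj_onI)
    fix h h' assume h: "h \<in> F" "h' \<in> F" and eq: "?e h = ?e h'"
    have "h j = h' j" if "j \<in> insert d u" for j
      using that eq by (auto dest: fun_cong[of _ _ j])
    then show "h = h'"
      using h F(2) by (intro PiE_ext[of h "insert d u" "\<lambda>_. - {0}" h']) auto
  qed
  have "(\<Sum>h\<in>F. if int N dvd (\<Sum>j\<in>insert d u. h j * (z(d := Y * t)) j)
      then \<Prod>j\<in>insert d u. \<bar>real_of_int (h j)\<bar> powr (- y) else 0)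
      \<le> (\<Sum>a\<in>?A. \<Sum>g\<in>?G. ?v t a g)" for t
  proof -
    have "(\<Sum>h\<in>F. if int N dvd (\<Sum>j\<in>insert d u. h j * (z(d := Y * t)) j)
      then \<Prod>j\<in>insert d u. \<bar>real_of_int (h j)\<bar> powr (- y) else 0) = (\<Sum>h\<in>F. case ?e h of (a, g) \<Rightarrow> ?v t a g)"
    proof (rule sum.cong)
      fix h
      have "(\<Sum>j\<in>u. h j * (z(d := Y * t)) j) = ?c (restrict h u)"
        using u(2) by (intro sum.cong) auto
      then have "(\<Sum>j\<in>insert d u. h j * (z(d := Y * t)) j) = Y * (h d * t) + ?c (restrict h u)"
        using u by (simp add: mult_ac)
      moreover have "(\<Prod>j\<in>insert d u. \<bar>real_of_int (h j)\<bar> powr (- y)) = \<bar>real_of_int (h d)\<bar> powr (- y) * ?P (restrict h u)"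
        using u by simp
      ultimately show "(if int N dvd (\<Sum>j\<in>insert d u. h j * (z(d := Y * t)) j)
        then \<Prod>j\<in>insert d u. \<bar>real_of_int (h j)\<bar> powr (- y) else 0) = (case ?e h of (a, g) \<Rightarrow> ?v t a g)"
        by (simp only: prod.case)
    qed simp
    also have "\<dots> = (\<Sum>(a, g)\<in>?e ` F. ?v t a g)"
      using inj by (simp only: sum.reindex o_def)
    also have "\<dots> \<le> (\<Sum>(a, g)\<in>?A \<times> ?G. ?v t a g)"
      using A G P0 by (intro sum_mono2) (auto intro!: mult_nonneg_nonneg)
    also have "\<dots> = (\<Sum>a\<in>?A. \<Sum>g\<in>?G. ?v t a g)"
      by (rule sum.cartesian_product[symmetric])
    finally show ?thesis .
  qed
  then have "(\<Sum>t\<in>T. \<Sum>h\<in>F. if int N dvd (\<Sum>j\<in>insert d u. h j * (z(d := Y * t)) j)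
      then \<Prod>j\<in>insert d u. \<bar>real_of_int (h j)\<bar> powr (- y) else 0)
      \<le> (\<Sum>t\<in>T. \<Sum>a\<in>?A. \<Sum>g\<in>?G. ?v t a g)"
    by (rule sum_mono)
  also have "\<dots> = (\<Sum>t\<in>T. \<Sum>g\<in>?G. \<Sum>a\<in>?A. ?v t a g)"
    by (intro sum.cong refl) (rule sum.swap)
  also have "\<dots> = (\<Sum>g\<in>?G. \<Sum>t\<in>T. \<Sum>a\<in>?A. ?v t a g)"
    by (rule sum.swap)
  also have "\<dots> \<le> (\<Sum>g\<in>?G. ?P g * (2 * zeta y))"
  proof (rule sum_mono)
    fix g
    obtain c' where c': "\<And>x. int N dvd Y * x + ?c g \<Longrightarrow> M dvd x + c'"
      using red[of "?c g"] by blast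
    have "(\<Sum>t\<in>T. \<Sum>a\<in>?A. ?v t a g)
      \<le> (\<Sum>t\<in>T. \<Sum>a\<in>?A. ?P g * (if M dvd a * t + c' then \<bar>real_of_int a\<bar> powr (- y) else 0))"
    proof (intro sum_mono)
      fix t a
      show "?v t a g \<le> ?P g * (if M dvd a * t + c' then \<bar>real_of_int a\<bar> powr (- y) else 0)"
        using c'[of "a * t"] P0[of g] by auto
    qed
    also have "\<dots> = ?P g * (\<Sum>t\<in>T. \<Sum>a\<in>?A. if M dvd a * t + c' then \<bar>real_of_int a\<bar> powr (- y) else 0)"
      by (simp only: sum_distrib_left)
    also have "\<dots> \<le> ?P g * (2 * zeta y)"
      by (rule mult_left_mono[OF sum_congruence_powr_le[OF y M T cop A] P0])
    finally show "(\<Sum>t\<in>T. \<Sum>a\<in>?A. ?v t a g) \<le> ?P g * (2 * zeta y)" .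
  qed
  also have "\<dots> = (\<Sum>g\<in>?G. ?P g) * (2 * zeta y)"
    by (rule sum_distrib_right[symmetric])
  also have "\<dots> \<le> (2 * zeta y) ^ card u * (2 * zeta y)"
    using sum_PiE_powr_le[OF y u(1) G] zeta_pos[OF y] by (intro mult_right_mono) auto
  also have "\<dots> = (2 * zeta y) ^ card (insert d u)"
    unfolding card_insert_disjoint[OF u] by (rule power_Suc2[symmetric])
  finally show ?thesis .
qed

text \<open>Subadditivity moves the l-th power into the sum and turns \<open>\<alpha>\<close> into
  \<open>\<alpha> * l\<close>, for which the bound on finite partial sums is available. Continuity
  of the power, also at 0 because l > 0, passes it to the limit for all t at once.\<close>

lemma sum_dual_sum_powr_le:
  fixes N :: nat and Y M :: int
  assumes \<alpha>: "\<alpha> > 1" and l: "0 < l" "l \<le> 1" "\<alpha> * l > 1" and u: "finite u" "d \<notin> u"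
    and M: "M > 0" and T: "T \<subseteq> {1..M}" and cop: "\<And>t. t \<in> T \<Longrightarrow> coprime t M"
    and red: "\<And>c. \<exists>c'. \<forall>x. int N dvd Y * x + c \<longrightarrow> M dvd x + c'"
  shows "(\<Sum>t\<in>T. dual_sum \<alpha> N (z(d := Y * t)) (insert d u) powr l) \<le> (2 * zeta (\<alpha> * l)) ^ card (insert d u)"
proof -
  let ?S = "PiE (insert d u) (\<lambda>_. - {0::int})"
  let ?D = "\<lambda>t h. int N dvd (\<Sum>j\<in>insert d u. h j * (z(d := Y * t)) j)"
  let ?f = "\<lambda>t h. if ?D t h then \<Prod>j\<in>insert d u. \<bar>real_of_int (h j)\<bar> powr (- \<alpha>) else 0"
  have f0: "0 \<le> ?f t h" for t h by (auto intro!: prod_nonneg)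
  have fin: "finite (insert d u)" using u by simp
  have "((\<lambda>F. \<Sum>h\<in>F. ?f t h) \<longlongrightarrow> dual_sum \<alpha> N (z(d := Y * t)) (insert d u)) (finite_subsets_at_top ?S)" for t
    using has_sum_dual_sum[OF \<alpha> fin, of N "z(d := Y * t)"] unfolding has_sum_def .
  then have lim: "((\<lambda>F. \<Sum>t\<in>T. (\<Sum>h\<in>F. ?f t h) powr l) \<longlongrightarrow>
      (\<Sum>t\<in>T. dual_sum \<alpha> N (z(d := Y * t)) (insert d u) powr l)) (finite_subsets_at_top ?S)"
    using l(1) f0 by (intro tendsto_sum tendsto_powr' tendsto_const) (auto intro!: always_eventually sum_nonneg)
  have le: "(\<Sum>t\<in>T. (\<Sum>h\<in>F. ?f t h) powr l) \<le> (2 * zeta (\<alpha> * l)) ^ card (insert d u)"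
    if F: "finite F" "F \<subseteq> ?S" for F
  proof -
    have "(\<Sum>t\<in>T. (\<Sum>h\<in>F. ?f t h) powr l) \<le> (\<Sum>t\<in>T. \<Sum>h\<in>F. ?f t h powr l)"
      using F l f0 by (intro sum_mono powr_sum_le) auto
    also have "\<dots> = (\<Sum>t\<in>T. \<Sum>h\<in>F. if ?D t h then \<Prod>j\<in>insert d u. \<bar>real_of_int (h j)\<bar> powr (- (\<alpha> * l)) else 0)"
    proof (intro sum.cong refl)
      fix t and h :: "nat \<Rightarrow> int"
      have "(\<Prod>j\<in>insert d u. \<bar>real_of_int (h j)\<bar> powr (- \<alpha>)) powr l
          = (\<Prod>j\<in>insert d u. \<bar>real_of_int (h j)\<bar> powr (- (\<alpha> * l)))"
        by (subst prod_powr_distrib) (simp_all only: powr_powr mult_minus_left powr_ge_zero)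
      then show "?f t h powr l = (if ?D t h then \<Prod>j\<in>insert d u. \<bar>real_of_int (h j)\<bar> powr (- (\<alpha> * l)) else 0)"
        by (cases "?D t h", simp only: if_True, simp only: if_False, simp)
    qed
    also have "\<dots> \<le> (2 * zeta (\<alpha> * l)) ^ card (insert d u)"
      by (rule sum_lattice_finite_le[OF l(3) u M T cop red F])
    finally show ?thesis .
  qed
  show ?thesis
    by (rule tendsto_upperbound[OF lim eventually_finite_subsets_at_top_weakI[OF le]]) simp_all
qed

section \<open>The candidate sets of the reduced construction\<close>

lemma reduced_candidates_coprime: "t \<in> reduced_candidates b m k \<Longrightarrow> coprime t (int b ^ m)"
  by (auto simp: reduced_candidates_def coprime_iff_gcd_eq_1 split: if_splits)

text \<open>For k < m, being coprime to b^m and to b^(m - k) is the same condition. Totatives range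
  up to b^(m - k) inclusively, but this endpoint exceeds 1 and is not coprime to itself.\<close>

lemma reduced_candidates_eq_totatives:
  assumes b: "prime b" and k: "k < m"
  shows "reduced_candidates b m k = int ` totatives (b ^ (m - k))"
proof -
  have b2: "b \<ge> 2" using b by (rule prime_ge_2_nat)
  have cop: "coprime (int n) (int b ^ m) \<longleftrightarrow> coprime n (b ^ (m - k))" for n
    using k by (simp add: coprime_power_right_iff flip: of_nat_power)
  have M: "1 < b ^ (m - k)" using b2 k by (intro one_less_power) auto
  show ?thesis
  proof (intro set_eqI iffI)
    fix t assume t: "t \<in> reduced_candidates b m k"
    then have t1: "1 \<le> t" "t \<le> int b ^ (m - k) - 1" using k by (auto simp: reduced_candidates_def)
    have "coprime (nat t) (b ^ (m - k))"
      using reduced_candidates_coprime[OF t] t1 cop[of "nat t"] by simp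
    moreover have "nat t \<le> b ^ (m - k)" using t1 by (simp add: nat_le_iff)
    ultimately have "nat t \<in> totatives (b ^ (m - k))" using t1 by (simp add: totatives_def)
    then show "t \<in> int ` totatives (b ^ (m - k))" using t1 by (intro image_eqI[of _ _ "nat t"]) auto
  next
    fix t assume "t \<in> int ` totatives (b ^ (m - k))"
    then obtain n where n: "t = int n" "0 < n" "n \<le> b ^ (m - k)" "coprime n (b ^ (m - k))"
      by (auto simp: totatives_def)
    have "n \<noteq> b ^ (m - k)" using n(4) M by auto
    then have "n < b ^ (m - k)" using n(3) by simp
    then have "int n < int b ^ (m - k)" by (simp flip: of_nat_power)
    then show "t \<in> reduced_candidates b m k"
      using n(1,2,4) k cop[of n] by (simp add: reduced_candidates_def coprime_iff_gcd_eq_1)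
  qed
qed

text \<open>The modulus M is b^(m - k) for k < m and 1 otherwise. The fourth statement packs what
  the averaging needs: candidates are residues coprime to M, and a congruence modulo b^m implies one
  modulo M after division by b^k.\<close>

lemma reduced_candidates_props:
  assumes b: "prime b" and m: "m \<ge> 1"
  shows "finite (reduced_candidates b m k)" "1 \<in> reduced_candidates b m k"
    and "b ^ m \<le> 2 * b ^ k * card (reduced_candidates b m k)"
    and "\<exists>M>0. reduced_candidates b m k \<subseteq> {1..M} \<and> (\<forall>t\<in>reduced_candidates b m k. coprime t M)
      \<and> (\<forall>c. \<exists>c'. \<forall>x. int (b ^ m) dvd int b ^ k * x + c \<longrightarrow> M dvd x + c')"
proof -
  have b2: "b \<ge> 2" using b by (rule prime_ge_2_nat)
  let ?T = "reduced_candidates b m k"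
  have "finite ?T \<and> 1 \<in> ?T \<and> b ^ m \<le> 2 * b ^ k * card ?T \<and>
    (\<exists>M>0. ?T \<subseteq> {1..M} \<and> (\<forall>t\<in>?T. coprime t M)
      \<and> (\<forall>c. \<exists>c'. \<forall>x. int (b ^ m) dvd int b ^ k * x + c \<longrightarrow> M dvd x + c'))"
  proof (cases "k < m")
    case True
    define M where "M = int b ^ (m - k)"
    have M2: "int (b ^ m) = int b ^ k * M"
      using True by (simp add: M_def flip: power_add)
    have M0: "M > 0" using b2 by (simp add: M_def)
    have T: "?T = int ` totatives (b ^ (m - k))"
      by (rule reduced_candidates_eq_totatives[OF b True])
    have one: "1 < b ^ (m - k)" using b2 True by (intro one_less_power) auto
    have "card ?T = totient (b ^ (m - k))"
      unfolding T totient_def by (intro card_image) simp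
    also have "\<dots> = b ^ (m - k - 1) * (b - 1)"
      using totient_prime_power[OF b, of "m - k"] True by simp
    finally have card: "card ?T = b ^ (m - k - 1) * (b - 1)" .
    have "m = k + Suc (m - k - 1)" using True by simp
    then have "b ^ m = b ^ k * (b ^ (m - k - 1) * b)"
      by (metis power_add power_Suc2)
    \<comment> \<open>Here b \<ge> 2 enters as \<open>b \<le> 2 * (b - 1)\<close>, an equality for b
      = 2; it is the source of the factor 2.\<close>
    also have "\<dots> \<le> b ^ k * (b ^ (m - k - 1) * (2 * (b - 1)))"
      using b2 by (intro mult_left_mono) auto
    finally have "b ^ m \<le> 2 * b ^ k * card ?T"
      unfolding card by (simp add: mult_ac)
    moreover have "finite ?T" "1 \<in> ?T"
      unfolding T using one by (auto simp: totatives_def intro!: image_eqI[of _ _ 1])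
    moreover have "?T \<subseteq> {1..M}" using True by (auto simp: reduced_candidates_def M_def)
    moreover have "coprime t M" if "t \<in> ?T" for t
      using reduced_candidates_coprime[OF that] True b2
      by (auto simp: M_def coprime_power_right_iff)
    \<comment> \<open>If b^k does not divide c, the congruence modulo b^m has no solution and any c'
      will do.\<close>
    moreover have "\<exists>c'. \<forall>x. int (b ^ m) dvd int b ^ k * x + c \<longrightarrow> M dvd x + c'" for c
    proof (cases "int b ^ k dvd c")
      case True
      then obtain c' where "c = int b ^ k * c'" by auto
      then have "M dvd x + c'" if "int (b ^ m) dvd int b ^ k * x + c" for x
        using that b2 unfolding M2 by (simp flip: distrib_left)
      then show ?thesis by blast
    next
      case False
      have "\<not> int (b ^ m) dvd int b ^ k * x + c" for x
      proof
        assume "int (b ^ m) dvd int b ^ k * x + c"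
        then have "int b ^ k dvd int b ^ k * x + c" unfolding M2 by (rule dvd_mult_left)
        then show False using False by (simp add: dvd_add_right_iff)
      qed
      then show ?thesis by blast
    qed
    ultimately show ?thesis using M0 by blast
  next
    case False
    then have T: "?T = {1}" by (simp add: reduced_candidates_def)
    have "b ^ m \<le> b ^ k" using False b2 by (intro power_increasing) auto
    then have "b ^ m \<le> 2 * b ^ k * card ?T" unfolding T by simp
    \<comment> \<open>Modulo 1 every congruence holds, and a single candidate is enough because b^m
      \<le> b^k.\<close>
    then show ?thesis unfolding T by (auto intro!: exI[of _ 1])
  qed
  then show "finite ?T" "1 \<in> ?T" "b ^ m \<le> 2 * b ^ k * card ?T"
    "\<exists>M>0. ?T \<subseteq> {1..M} \<and> (\<forall>t\<in>?T. coprime t M)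
      \<and> (\<forall>c. \<exists>c'. \<forall>x. int (b ^ m) dvd int b ^ k * x + c \<longrightarrow> M dvd x + c')"
    by blast+
qed

section \<open>Error bound and tractability\<close>

lemma dual_sum_cong:
  assumes "\<And>j. j \<in> u \<Longrightarrow> z j = z' j"
  shows "dual_sum \<alpha> N z u = dual_sum \<alpha> N z' u"
proof -
  have "(\<Sum>j\<in>u. h j * z j) = (\<Sum>j\<in>u. h j * z' j)" for h :: "nat \<Rightarrow> int"
    using assms by (intro sum.cong) auto
  then show ?thesis unfolding dual_sum_def by simp
qed

lemma lattice_wce_cong:
  assumes "\<And>j. j \<in> {1..s} \<Longrightarrow> z j = z' j"
  shows "lattice_wce H ip N s z = lattice_wce H ip N s z'"
proof -
  have "(\<lambda>j\<in>{1..s}. frac (real k / real N * of_int (z j))) = (\<lambda>j\<in>{1..s}. frac (real k / real N * of_int (z' j)))" for k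
    using assms by (intro restrict_ext) simp
  then show ?thesis unfolding lattice_wce_def lattice_points_def by simp
qed

lemma sum_Pow_Suc:
  fixes f :: "nat set \<Rightarrow> real"
  shows "(\<Sum>u\<in>Pow {1..Suc d} - {{}}. f u)
    = (\<Sum>u\<in>Pow {1..d} - {{}}. f u) + (\<Sum>u\<in>Pow {1..d}. f (insert (Suc d) u))"
proof -
  have "{1..Suc d} = insert (Suc d) {1..d}" by auto
  then have "Pow {1..Suc d} - {{}} = (Pow {1..d} - {{}}) \<union> insert (Suc d) ` Pow {1..d}"
    by (auto simp: Pow_insert)
  moreover have "(Pow {1..d} - {{}}) \<inter> insert (Suc d) ` Pow {1..d} = {}"
    by auto
  moreover have "inj_on (insert (Suc d)) (Pow {1..d})"
  proof (rule inj_onI)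
    fix x y assume xy: "x \<in> Pow {1..d}" "y \<in> Pow {1..d}" and eq: "insert (Suc d) x = insert (Suc d) y"
    have "Suc d \<notin> x" "Suc d \<notin> y" using xy by auto
    with eq show "x = y" by (simp add: insert_ident)
  qed
  ultimately show ?thesis
    by (simp add: sum.union_disjoint sum.reindex)
qed

locale korobov_sequence =
  fixes b :: nat and \<alpha> :: real and \<gamma> :: "nat set \<Rightarrow> real" and w :: "nat \<Rightarrow> nat"
    and H :: spaces and ip :: inner_products
  assumes prime_b: "prime b" and alpha: "\<alpha> > 1"
    and gamma_pos: "\<And>u. finite u \<Longrightarrow> u \<subseteq> {1..} \<Longrightarrow> \<gamma> u > 0"
    and w_Suc: "\<And>j. j \<ge> 1 \<Longrightarrow> w j \<le> w (Suc j)"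
    and rkhs: "\<And>s. s \<ge> 1 \<Longrightarrow> rkhs (unit_cube s) (korobov_kernel \<alpha> \<gamma> s) (H s) (ip s)"
begin

lemma korobov_space: "s \<ge> 1 \<Longrightarrow> korobov_space s \<alpha> \<gamma> H ip"
  by (intro korobov_space.intro korobov_space_axioms.intro rkhs alpha)

lemma b_ge_2: "b \<ge> 2"
  using prime_b by (rule prime_ge_2_nat)

lemma w_mono:
  assumes "1 \<le> i" "i \<le> j"
  shows "w i \<le> w j"
  using assms(2)
proof (induction j rule: dec_induct)
  case (step n)
  then show ?case using w_Suc[of n] assms(1) by simp
qed simp

lemma gamma_pos': "u \<subseteq> {1..d} \<Longrightarrow> \<gamma> u > 0"
  by (intro gamma_pos) (auto intro: finite_subset)

text \<open>The squared error in the form given by the dual sums. It also makes sense for d = 0,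
  where the locale provides no space; the value 0 there is the base of the induction over the
  components.\<close>

definition err :: "nat \<Rightarrow> nat \<Rightarrow> (nat \<Rightarrow> int) \<Rightarrow> real"
  where "err m d v = (\<Sum>u\<in>Pow {1..d} - {{}}. \<gamma> u * dual_sum \<alpha> (b ^ m) (scaled_vector b w v) u)"

lemma lattice_wce_square_eq_err:
  assumes "d \<ge> 1"
  shows "(lattice_wce H ip (b ^ m) d (scaled_vector b w v))\<^sup>2 = err m d v"
  unfolding err_def using b_ge_2 by (intro korobov_space.lattice_wce_square[OF korobov_space[OF assms]]) simp

lemma lattice_wce_nonneg:
  assumes "d \<ge> 1"
  shows "0 \<le> lattice_wce H ip (b ^ m) d z"
proof -
  interpret korobov_space d \<alpha> \<gamma> H ip by (rule korobov_space[OF assms])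
  show ?thesis
    unfolding lattice_wce_def using b_ge_2
    by (intro wce_nonneg lattice_points_nonempty lattice_points_subset) simp
qed

lemma err_nonneg: "0 \<le> err m d v"
  unfolding err_def by (intro sum_nonneg mult_nonneg_nonneg dual_sum_nonneg less_imp_le[OF gamma_pos']) auto

lemma err_Suc:
  "err m (Suc d) (v(Suc d := t)) = err m d v + (\<Sum>u\<in>Pow {1..d}. \<gamma> (insert (Suc d) u) *
     dual_sum \<alpha> (b ^ m) ((scaled_vector b w v)(Suc d := int b ^ w (Suc d) * t)) (insert (Suc d) u))"
proof -
  have "scaled_vector b w (v(Suc d := t)) = (scaled_vector b w v)(Suc d := int b ^ w (Suc d) * t)"
    by (auto simp: scaled_vector_def)
  moreover have "dual_sum \<alpha> (b ^ m) ((scaled_vector b w v)(Suc d := x)) u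
      = dual_sum \<alpha> (b ^ m) (scaled_vector b w v) u" if "u \<in> Pow {1..d} - {{}}" for x u
    using that by (intro dual_sum_cong) auto
  ultimately show ?thesis
    unfolding err_def sum_Pow_Suc by simp
qed

text \<open>Monotonicity of w makes \<open>w (Suc d)\<close> the maximum over every subset of
  \<open>{1..Suc d}\<close> that contains \<open>Suc d\<close>; in this way the factor of a single
  step becomes the power of b in \<open>weight_sum\<close>.\<close>

lemma weight_sum_Suc:
  "weight_sum b \<gamma> w \<rho> t (Suc d) = weight_sum b \<gamma> w \<rho> t d +
    (\<Sum>u\<in>Pow {1..d}. \<gamma> (insert (Suc d) u) powr \<rho> * (2 * zeta t) ^ card (insert (Suc d) u)) * real b ^ w (Suc d)"
proof -
  have "Max (w ` insert (Suc d) u) = w (Suc d)" if "u \<subseteq> {1..d}" for u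
    using that by (intro Max_eqI) (auto intro: finite_subset intro!: w_mono)
  then show ?thesis
    unfolding weight_sum_def sum_Pow_Suc by (simp add: sum_distrib_right del: power_mult_distrib)
qed

lemma err_step:
  assumes m: "m \<ge> 1" and l: "0 < l" "l \<le> 1" "\<alpha> * l > 1"
    and v: "v (Suc d) \<in> reduced_candidates b m (w (Suc d))"
    and min: "\<And>t. t \<in> reduced_candidates b m (w (Suc d)) \<Longrightarrow> err m (Suc d) v \<le> err m (Suc d) (v(Suc d := t))"
  shows "err m (Suc d) v powr l \<le> err m d v powr l + 2 / real (b ^ m) *
    ((\<Sum>u\<in>Pow {1..d}. \<gamma> (insert (Suc d) u) powr l * (2 * zeta (\<alpha> * l)) ^ card (insert (Suc d) u)) * real b ^ w (Suc d))"
proof -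
  let ?T = "reduced_candidates b m (w (Suc d))"
  let ?D = "\<lambda>t u. dual_sum \<alpha> (b ^ m) ((scaled_vector b w v)(Suc d := int b ^ w (Suc d) * t)) (insert (Suc d) u)"
  define \<theta> where "\<theta> t = (\<Sum>u\<in>Pow {1..d}. \<gamma> (insert (Suc d) u) * ?D t u)" for t
  define R where "R = (\<Sum>u\<in>Pow {1..d}. \<gamma> (insert (Suc d) u) powr l * (2 * zeta (\<alpha> * l)) ^ card (insert (Suc d) u))"
  have g: "\<gamma> (insert (Suc d) u) > 0" if "u \<in> Pow {1..d}" for u
    using that by (intro gamma_pos'[of _ "Suc d"]) auto
  have \<theta>0: "0 \<le> \<theta> t" for t
    unfolding \<theta>_def using g by (intro sum_nonneg mult_nonneg_nonneg dual_sum_nonneg) (auto intro: less_imp_le)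
  have eq: "err m (Suc d) (v(Suc d := t)) = err m d v + \<theta> t" for t
    unfolding err_Suc \<theta>_def ..
  have eqv: "err m (Suc d) v = err m d v + \<theta> (v (Suc d))"
    using eq[of "v (Suc d)"] by simp
  \<comment> \<open>The term \<open>err m d v\<close> is common to all candidates, so a minimizer of
    the error also minimizes \<open>\<theta>\<close>.\<close>
  have le: "\<theta> (v (Suc d)) \<le> \<theta> t" if "t \<in> ?T" for t
    using min[OF that] unfolding eq eqv by simp
  obtain M where M: "M > 0" "?T \<subseteq> {1..M}" "\<And>t. t \<in> ?T \<Longrightarrow> coprime t M"
    "\<And>c. \<exists>c'. \<forall>x. int (b ^ m) dvd int b ^ w (Suc d) * x + c \<longrightarrow> M dvd x + c'"
    using reduced_candidates_props(4)[OF prime_b m] by blast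
  have "real (card ?T) * \<theta> (v (Suc d)) powr l = (\<Sum>t\<in>?T. \<theta> (v (Suc d)) powr l)"
    by simp
  also have "\<dots> \<le> (\<Sum>t\<in>?T. \<theta> t powr l)"
    using le \<theta>0 l by (intro sum_mono powr_mono2) auto
  also have "\<dots> \<le> (\<Sum>t\<in>?T. \<Sum>u\<in>Pow {1..d}. (\<gamma> (insert (Suc d) u) * ?D t u) powr l)"
    unfolding \<theta>_def using g l
    by (intro sum_mono powr_sum_le mult_nonneg_nonneg dual_sum_nonneg) (auto intro: less_imp_le)
  also have "\<dots> = (\<Sum>t\<in>?T. \<Sum>u\<in>Pow {1..d}. \<gamma> (insert (Suc d) u) powr l * ?D t u powr l)"
    by (simp only: powr_mult)
  also have "\<dots> = (\<Sum>u\<in>Pow {1..d}. \<Sum>t\<in>?T. \<gamma> (insert (Suc d) u) powr l * ?D t u powr l)"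
    by (rule sum.swap)
  also have "\<dots> = (\<Sum>u\<in>Pow {1..d}. \<gamma> (insert (Suc d) u) powr l * (\<Sum>t\<in>?T. ?D t u powr l))"
    by (simp only: sum_distrib_left)
  also have "\<dots> \<le> R"
    unfolding R_def
  proof (intro sum_mono mult_left_mono)
    fix u assume "u \<in> Pow {1..d}"
    then have u: "finite u" "Suc d \<notin> u" by (auto intro: finite_subset)
    show "(\<Sum>t\<in>?T. ?D t u powr l) \<le> (2 * zeta (\<alpha> * l)) ^ card (insert (Suc d) u)"
      by (rule sum_dual_sum_powr_le[OF alpha l u M])
  qed simp
  finally have avg: "real (card ?T) * \<theta> (v (Suc d)) powr l \<le> R" .
  \<comment> \<open>Division by the number of candidates, which is at least b^m / (2 * b^w), gives
    the factor 2 * b^w / b^m of the step.\<close>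
  have "b ^ m \<le> 2 * b ^ w (Suc d) * card ?T"
    by (rule reduced_candidates_props(3)[OF prime_b m])
  then have "real (b ^ m) \<le> real (2 * b ^ w (Suc d) * card ?T)"
    by (rule of_nat_mono)
  then have "real (b ^ m) * \<theta> (v (Suc d)) powr l \<le> real (2 * b ^ w (Suc d) * card ?T) * \<theta> (v (Suc d)) powr l"
    by (rule mult_right_mono) simp
  also have "\<dots> = 2 * real b ^ w (Suc d) * (real (card ?T) * \<theta> (v (Suc d)) powr l)"
    by simp
  also have "\<dots> \<le> 2 * real b ^ w (Suc d) * R"
    by (rule mult_left_mono[OF avg]) simp
  finally have "\<theta> (v (Suc d)) powr l \<le> 2 / real (b ^ m) * (R * real b ^ w (Suc d))"
    using b_ge_2 by (simp add: field_simps)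
  moreover have "err m (Suc d) v powr l \<le> err m d v powr l + \<theta> (v (Suc d)) powr l"
    unfolding eqv by (intro powr_add_le err_nonneg \<theta>0 l)
  ultimately show ?thesis
    unfolding R_def by linarith
qed

text \<open>Minimality is required of every component, the first one included, so that the induction
  can start from the empty sum at d = 0.\<close>

lemma err_le:
  assumes m: "m \<ge> 1" and l: "0 < l" "l \<le> 1" "\<alpha> * l > 1"
    and v: "\<And>e. e < d \<Longrightarrow> v (Suc e) \<in> reduced_candidates b m (w (Suc e))"
    and min: "\<And>e t. e < d \<Longrightarrow> t \<in> reduced_candidates b m (w (Suc e)) \<Longrightarrow>
      err m (Suc e) v \<le> err m (Suc e) (v(Suc e := t))"
  shows "err m d v powr l \<le> 2 / real (b ^ m) * weight_sum b \<gamma> w l (\<alpha> * l) d"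
  using v min
proof (induction d)
  case 0
  then show ?case by (simp add: err_def weight_sum_def)
next
  case (Suc d)
  have "err m (Suc d) v powr l \<le> err m d v powr l + 2 / real (b ^ m) *
    ((\<Sum>u\<in>Pow {1..d}. \<gamma> (insert (Suc d) u) powr l * (2 * zeta (\<alpha> * l)) ^ card (insert (Suc d) u)) * real b ^ w (Suc d))"
    by (rule err_step[OF m l Suc.prems(1) Suc.prems(2)]) simp_all
  moreover have "err m d v powr l \<le> 2 / real (b ^ m) * weight_sum b \<gamma> w l (\<alpha> * l) d"
    by (rule Suc.IH) (use Suc.prems less_SucI in blast)+
  ultimately show ?case
    unfolding weight_sum_Suc distrib_left by linarith
qed

text \<open>All candidates for the first component give the same error, so the choice \<open>z\<^sub>1 = 1\<close> is also
  a minimizer.\<close>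

lemma err_1_eq:
  assumes t: "coprime t (int b ^ m)" and t': "coprime t' (int b ^ m)"
  shows "err m (Suc 0) (v(Suc 0 := t)) = err m (Suc 0) (v(Suc 0 := t'))"
proof -
  have dvd: "int b ^ m dvd a * (c * t) \<longleftrightarrow> int b ^ m dvd a * c" if "coprime t (int b ^ m)" for a c t
    using that coprime_dvd_mult_left_iff[of "int b ^ m" t "a * c"]
    by (simp add: coprime_commute mult.assoc)
  have "dual_sum \<alpha> (b ^ m) (scaled_vector b w (v(Suc 0 := t))) {Suc 0} =
      dual_sum \<alpha> (b ^ m) (scaled_vector b w (v(Suc 0 := t'))) {Suc 0}"
    unfolding dual_sum_def by (simp add: scaled_vector_def dvd[OF t] dvd[OF t'])
  moreover have "Pow {1..Suc 0} - {{}} = {{Suc 0}}" by auto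
  ultimately show ?thesis unfolding err_def by simp
qed

section \<open>The error of a constructed vector\<close>

lemma cbc_err_le:
  assumes m: "m \<ge> 1" and s: "s \<ge> 1" and cbc: "reduced_cbc H ip b w m s z"
    and l: "0 < l" "l \<le> 1" "\<alpha> * l > 1"
  shows "((lattice_wce H ip (b ^ m) s z)\<^sup>2) powr l \<le> 2 / real (b ^ m) * weight_sum b \<gamma> w l (\<alpha> * l) s"
proof -
  obtain v where v1: "v 1 = 1"
    and min: "\<And>d. d \<in> {1..<s} \<Longrightarrow> is_arg_min
        (\<lambda>t. (lattice_wce H ip (b ^ m) (d + 1) (scaled_vector b w (v(d + 1 := t))))\<^sup>2)
        (\<lambda>t. t \<in> reduced_candidates b m (w (d + 1))) (v (d + 1))"
    and z: "\<And>j. j \<in> {1..s} \<Longrightarrow> z j = scaled_vector b w v j"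
    using cbc unfolding reduced_cbc_def by blast
  have mem: "v (Suc e) \<in> reduced_candidates b m (w (Suc e))" if "e < s" for e
  proof (cases "e = 0")
    case True
    then show ?thesis using v1 reduced_candidates_props(2)[OF prime_b m] by simp
  next
    case False
    then show ?thesis using min[of e] that by (simp add: is_arg_min_def)
  qed
  have le: "err m (Suc e) v \<le> err m (Suc e) (v(Suc e := t))"
    if "e < s" "t \<in> reduced_candidates b m (w (Suc e))" for e t
  proof (cases "e = 0")
    case True
    have "err m (Suc 0) (v(Suc 0 := v (Suc 0))) = err m (Suc 0) (v(Suc 0 := t))"
      using reduced_candidates_coprime[OF mem[OF that(1)]] reduced_candidates_coprime[OF that(2)] True
      by (intro err_1_eq) auto
    then show ?thesis using True by simp
  next
    case False
    then have "\<not> (lattice_wce H ip (b ^ m) (Suc e) (scaled_vector b w (v(Suc e := t))))\<^sup>2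
        < (lattice_wce H ip (b ^ m) (Suc e) (scaled_vector b w (v(Suc e := v (Suc e)))))\<^sup>2"
      using min[of e] that by (simp add: is_arg_min_def)
    then show ?thesis
      by (simp add: lattice_wce_square_eq_err)
  qed
  have "lattice_wce H ip (b ^ m) s z = lattice_wce H ip (b ^ m) s (scaled_vector b w v)"
    by (rule lattice_wce_cong) (rule z)
  then have "(lattice_wce H ip (b ^ m) s z)\<^sup>2 = err m s v"
    using lattice_wce_square_eq_err[OF s] by simp
  then show ?thesis
    using err_le[OF m l mem le] by simp
qed

lemma weight_sum_pos:
  assumes "s \<ge> 1" "t > 1"
  shows "weight_sum b \<gamma> w \<rho> t s > 0"
  unfolding weight_sum_def
proof (rule sum_pos)
  show "Pow {1..s} - {{}} \<noteq> {}" using assms(1) by auto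
  fix u assume "u \<in> Pow {1..s} - {{}}"
  then have "\<gamma> u > 0" by (intro gamma_pos'[of _ s]) auto
  then show "0 < \<gamma> u powr \<rho> * (2 * zeta t) ^ card u * real b ^ Max (w ` u)"
    using zeta_pos[OF assms(2)] b_ge_2 by (intro mult_pos_pos zero_less_power) auto
qed simp

text \<open>Here \<open>\<tau>\<close> stands for \<open>\<alpha> - 2 * \<delta>\<close>, and
  \<open>1 \<le> \<tau>\<close>, \<open>\<tau> < \<alpha>\<close> are the conditions
  \<open>\<lambda> \<le> 1\<close> and \<open>\<alpha> * \<lambda> > 1\<close> for
  \<open>\<lambda> = 1 / \<tau>\<close>. The power \<open>\<tau> / 2\<close> undoes both
  \<open>\<lambda>\<close> and the square.\<close>

lemma cbc_error_bound:
  assumes m: "m \<ge> 1" and s: "s \<ge> 1" and cbc: "reduced_cbc H ip b w m s z"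
    and \<tau>: "1 \<le> \<tau>" "\<tau> < \<alpha>"
  shows "lattice_wce H ip (b ^ m) s z
    \<le> (2 * weight_sum b \<gamma> w (1 / \<tau>) (\<alpha> / \<tau>) s) powr (\<tau> / 2) * real (b ^ m) powr (- \<tau> / 2)"
proof -
  let ?e = "lattice_wce H ip (b ^ m) s z" and ?W = "weight_sum b \<gamma> w (1 / \<tau>) (\<alpha> / \<tau>) s"
  have e0: "0 \<le> ?e" by (rule lattice_wce_nonneg[OF s])
  have N: "real (b ^ m) > 0" using b_ge_2 by simp
  have W: "?W > 0" using \<tau> by (intro weight_sum_pos s) simp
  have "(?e\<^sup>2) powr (1 / \<tau>) \<le> 2 / real (b ^ m) * ?W"
    using cbc_err_le[OF m s cbc, of "1 / \<tau>"] \<tau> by simp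
  then have "((?e\<^sup>2) powr (1 / \<tau>)) powr (\<tau> / 2) \<le> (2 * ?W / real (b ^ m)) powr (\<tau> / 2)"
    using \<tau> by (intro powr_mono2) auto
  moreover have "((?e\<^sup>2) powr (1 / \<tau>)) powr (\<tau> / 2) = ?e"
  proof -
    have half: "1 / \<tau> * (\<tau> / 2) = 1 / 2" using \<tau> by simp
    show ?thesis
      unfolding powr_powr half using powr_half_sqrt[of "?e\<^sup>2"] e0 by simp
  qed
  moreover have "(2 * ?W / real (b ^ m)) powr (\<tau> / 2) = (2 * ?W) powr (\<tau> / 2) * real (b ^ m) powr (- \<tau> / 2)"
    using N W powr_minus_divide[of "real (b ^ m)" "\<tau> / 2"] powr_divide[of "2 * ?W" "real (b ^ m)" "\<tau> / 2"] by simp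
  ultimately show ?thesis by simp
qed

text \<open>Supplies the point sets behind the tractability bounds. Extending v by a minimizer in
  component s + 1 leaves the earlier conditions intact, as their errors see only components up to
  s.\<close>

lemma ex_reduced_cbc:
  assumes m: "m \<ge> 1"
  shows "\<exists>z. reduced_cbc H ip b w m s z"
proof -
  let ?f = "\<lambda>v d t. (lattice_wce H ip (b ^ m) (d + 1) (scaled_vector b w (v(d + 1 := t))))\<^sup>2"
  let ?P = "\<lambda>v d. is_arg_min (?f v d) (\<lambda>t. t \<in> reduced_candidates b m (w (d + 1))) (v (d + 1))"
  have "\<exists>v. v 1 = 1 \<and> (\<forall>d\<in>{1..<s}. ?P v d)"
  proof (induction s)
    case 0
    show ?case by (rule exI[of _ "\<lambda>_. 1"]) simp
  next
    case (Suc s)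
    then obtain v where v: "v 1 = 1" "\<And>d. d \<in> {1..<s} \<Longrightarrow> ?P v d" by blast
    show ?case
    proof (cases "s \<ge> 1")
      case True
      obtain t where t: "is_arg_min (?f v s) (\<lambda>t. t \<in> reduced_candidates b m (w (s + 1))) t"
        using ex_is_arg_min_if_finite[of "reduced_candidates b m (w (s + 1))" "?f v s"]
          reduced_candidates_props(1,2)[OF prime_b m, of "w (s + 1)"] by blast
      define v' where "v' = v(s + 1 := t)"
      have "?P v' d" if d: "d \<in> {1..<Suc s}" for d
      proof (cases "d = s")
        case True
        then show ?thesis using t by (simp add: v'_def)
      next
        case False
        then have "lattice_wce H ip (b ^ m) (d + 1) (scaled_vector b w (v'(d + 1 := x)))
            = lattice_wce H ip (b ^ m) (d + 1) (scaled_vector b w (v(d + 1 := x)))" for x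
          using d by (intro lattice_wce_cong) (auto simp: v'_def scaled_vector_def)
        moreover have "v' (d + 1) = v (d + 1)" using False by (simp add: v'_def)
        ultimately show ?thesis using v(2)[of d] d False by simp
      qed
      moreover have "v' 1 = 1" using True v(1) by (simp add: v'_def)
      ultimately show ?thesis by blast
    next
      case False
      then show ?thesis using v(1) by auto
    qed
  qed
  then show ?thesis unfolding reduced_cbc_def by blast
qed

section \<open>Bounds on the number of points needed\<close>

lemma N_min_le:
  assumes "N \<ge> 1" "min_error H ip N s \<le> \<epsilon> * initial_error H ip s"
  shows "1 \<le> N_min H ip \<epsilon> s" "N_min H ip \<epsilon> s \<le> N"
proof -
  let ?Q = "\<lambda>N. N \<ge> 1 \<and> min_error H ip N s \<le> \<epsilon> * initial_error H ip s"
  have Q: "?Q N" using assms by simp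
  show "1 \<le> N_min H ip \<epsilon> s" unfolding N_min_def using LeastI[of ?Q, OF Q] by blast
  show "N_min H ip \<epsilon> s \<le> N" unfolding N_min_def using Least_le[of ?Q, OF Q] .
qed

text \<open>The least power of b above x overshoots by a factor of at most b. The maximum with 1
  covers x \<le> 1, where m = 1 is taken because the error bound is for m \<ge> 1.\<close>

lemma ex_power_between:
  shows "\<exists>m\<ge>1. x \<le> real (b ^ m) \<and> real (b ^ m) \<le> real b * max 1 x"
proof (cases "x \<le> 1")
  case True
  then show ?thesis using b_ge_2 by (intro exI[of _ 1]) auto
next
  case False
  define m where "m = (LEAST m. x \<le> real b ^ m)"
  obtain k where "x < real b ^ k" using real_arch_pow[of "real b" x] b_ge_2 by auto
  then have m: "x \<le> real b ^ m"
    unfolding m_def by (rule LeastI[of "\<lambda>m. x \<le> real b ^ m", OF less_imp_le])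
  then have "m \<noteq> 0" using False by (intro notI) simp
  then obtain n where n: "m = Suc n" using not0_implies_Suc by blast
  have "\<not> x \<le> real b ^ n" using not_less_Least[of n "\<lambda>m. x \<le> real b ^ m"] n unfolding m_def by simp
  then have "real b ^ m \<le> real b * x" unfolding n by (simp add: mult_left_mono)
  then show ?thesis using m n False by (intro exI[of _ m]) auto
qed

text \<open>The threshold \<open>2 * W * \<epsilon> powr (- 2 / \<tau>)\<close> is the N that solves
  \<open>(2 * W) powr (\<tau> / 2) * N powr (- \<tau> / 2) = \<epsilon>\<close>. As the initial
  error is 1, every power b^m with m \<ge> 1 that is at least the threshold meets the
  criterion.\<close>

lemma N_min_bound:
  assumes s: "s \<ge> 1" and \<epsilon>: "0 < \<epsilon>" and \<tau>: "1 \<le> \<tau>" "\<tau> < \<alpha>"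
  defines "W \<equiv> weight_sum b \<gamma> w (1 / \<tau>) (\<alpha> / \<tau>) s"
  shows "1 \<le> N_min H ip \<epsilon> s" "real (N_min H ip \<epsilon> s) \<le> real b * max 1 (2 * W * \<epsilon> powr (- 2 / \<tau>))"
proof -
  interpret korobov_space s \<alpha> \<gamma> H ip by (rule korobov_space[OF s])
  have W: "W > 0" unfolding W_def using \<tau> by (intro weight_sum_pos s) simp
  let ?X = "2 * W * \<epsilon> powr (- 2 / \<tau>)"
  obtain m where m: "m \<ge> 1" "?X \<le> real (b ^ m)" "real (b ^ m) \<le> real b * max 1 ?X"
    using ex_power_between[of ?X] by blast
  obtain z where z: "reduced_cbc H ip b w m s z" using ex_reduced_cbc[OF m(1)] by blast
  have N: "b ^ m \<ge> 1" using b_ge_2 by simp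
  have size: "size (lattice_points s (b ^ m) z) = b ^ m"
    by (simp add: lattice_points_def)
  then have "size (lattice_points s (b ^ m) z) > 0"
    using b_ge_2 by simp
  from min_error_le[OF this lattice_points_subset]
  have "min_error H ip (b ^ m) s \<le> wce H ip s (lattice_points s (b ^ m) z)"
    unfolding size .
  also have "\<dots> \<le> (2 * W) powr (\<tau> / 2) * real (b ^ m) powr (- \<tau> / 2)"
    using cbc_error_bound[OF m(1) s z \<tau>] unfolding lattice_wce_def W_def .
  also have "\<dots> \<le> (2 * W) powr (\<tau> / 2) * ?X powr (- \<tau> / 2)"
    using m(2) W \<epsilon> \<tau> by (intro mult_left_mono powr_mono2') auto
  also have "?X powr (- \<tau> / 2) = (2 * W) powr (- \<tau> / 2) * \<epsilon>"
    using W \<epsilon> \<tau> by (simp add: powr_mult powr_powr)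
  also have "(2 * W) powr (\<tau> / 2) * ((2 * W) powr (- \<tau> / 2) * \<epsilon>) = \<epsilon>"
    using W by (simp add: powr_minus)
  finally have "min_error H ip (b ^ m) s \<le> \<epsilon> * initial_error H ip s"
    by (simp add: initial_error_eq_1)
  from N_min_le[OF N this] m(3)
  show "1 \<le> N_min H ip \<epsilon> s" "real (N_min H ip \<epsilon> s) \<le> real b * max 1 ?X"
    by (simp, meson of_nat_mono order_trans)
qed

lemma C_const_le:
  assumes C: "C_const b \<alpha> \<gamma> w \<delta> q < \<infinity>" and s: "s \<ge> 1"
  shows "weight_sum b \<gamma> w (1 / (\<alpha> - 2 * \<delta>)) (\<alpha> / (\<alpha> - 2 * \<delta>)) s
    \<le> real s powr q * real_of_ereal (C_const b \<alpha> \<gamma> w \<delta> q)"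
proof -
  let ?W = "weight_sum b \<gamma> w (1 / (\<alpha> - 2 * \<delta>)) (\<alpha> / (\<alpha> - 2 * \<delta>)) s"
  have le: "ereal (1 / real s powr q * ?W) \<le> C_const b \<alpha> \<gamma> w \<delta> q"
    unfolding C_const_def using s by (intro SUP_upper) simp
  with C obtain r where r: "C_const b \<alpha> \<gamma> w \<delta> q = ereal r"
    by (cases "C_const b \<alpha> \<gamma> w \<delta> q") auto
  have "1 / real s powr q * ?W \<le> r" using le unfolding r by simp
  then show ?thesis unfolding r using s by (simp add: field_simps)
qed

lemma C_const_error_bound:
  assumes \<delta>: "0 < \<delta>" "\<delta> \<le> (\<alpha> - 1) / 2" and C: "C_const b \<alpha> \<gamma> w \<delta> q < \<infinity>"
    and s: "s \<ge> 1" and m: "m \<ge> 1" and z: "reduced_cbc H ip b w m s z"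
  shows "lattice_wce H ip (b ^ m) s z
    \<le> (2 * real s powr q * real_of_ereal (C_const b \<alpha> \<gamma> w \<delta> q)) powr (\<alpha> / 2 - \<delta>)
      * real (b ^ m) powr (- \<alpha> / 2 + \<delta>)"
proof -
  define \<tau> where "\<tau> = \<alpha> - 2 * \<delta>"
  have \<tau>: "1 \<le> \<tau>" "\<tau> < \<alpha>" using \<delta> by (auto simp: \<tau>_def)
  have exps: "\<alpha> / 2 - \<delta> = \<tau> / 2" "- \<alpha> / 2 + \<delta> = - \<tau> / 2" by (simp_all add: \<tau>_def field_simps)
  have W: "weight_sum b \<gamma> w (1 / \<tau>) (\<alpha> / \<tau>) s > 0"
    using \<tau> by (intro weight_sum_pos s) simp
  have "lattice_wce H ip (b ^ m) s z
    \<le> (2 * weight_sum b \<gamma> w (1 / \<tau>) (\<alpha> / \<tau>) s) powr (\<tau> / 2) * real (b ^ m) powr (- \<tau> / 2)"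
    by (rule cbc_error_bound[OF m s z \<tau>])
  also have "\<dots> \<le> (2 * real s powr q * real_of_ereal (C_const b \<alpha> \<gamma> w \<delta> q)) powr (\<tau> / 2)
      * real (b ^ m) powr (- \<tau> / 2)"
    using C_const_le[OF C s] W \<tau> unfolding \<tau>_def
    by (intro mult_right_mono powr_mono2) auto
  finally show ?thesis unfolding exps .
qed

text \<open>In the constant, the factor b pays for rounding up to a power of b. The maximum with 1
  covers thresholds below 1, since \<open>real s powr q\<close> and the power of
  \<open>\<epsilon>\<close> are at least 1.\<close>

lemma C_const_QMC_bound:
  assumes \<delta>: "0 < \<delta>" "\<delta> \<le> (\<alpha> - 1) / 2" and q: "0 \<le> q" and C: "C_const b \<alpha> \<gamma> w \<delta> q < \<infinity>"
  shows "\<exists>c\<ge>0. QMC_bound H ip c (2 / (\<alpha> - 2 * \<delta>)) q"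
proof -
  define \<tau> where "\<tau> = \<alpha> - 2 * \<delta>"
  have \<tau>: "1 \<le> \<tau>" "\<tau> < \<alpha>" using \<delta> by (auto simp: \<tau>_def)
  define D where "D = real_of_ereal (C_const b \<alpha> \<gamma> w \<delta> q)"
  define c where "c = real b * max 1 (2 * D)"
  have "QMC_bound H ip c (2 / \<tau>) q"
    unfolding QMC_bound_def
  proof (intro allI impI ballI)
    fix s :: nat and \<epsilon> :: real assume s: "s \<ge> 1" and "\<epsilon> \<in> {0<..<1}"
    then have \<epsilon>: "0 < \<epsilon>" "\<epsilon> < 1" by auto
    let ?W = "weight_sum b \<gamma> w (1 / \<tau>) (\<alpha> / \<tau>) s"
    have W: "?W \<le> real s powr q * D"
      using C_const_le[OF C s] unfolding \<tau>_def D_def .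
    have sq: "1 \<le> real s powr q" using s q by (intro ge_one_powr_ge_zero) auto
    have "\<epsilon> powr (2 / \<tau>) \<le> 1" using \<epsilon> \<tau> by (intro powr_le1) auto
    then have ep: "1 \<le> \<epsilon> powr (- (2 / \<tau>))"
      using \<epsilon> by (simp add: powr_minus one_le_inverse_iff)
    have "2 * ?W * \<epsilon> powr (- (2 / \<tau>)) \<le> 2 * (real s powr q * D) * \<epsilon> powr (- (2 / \<tau>))"
      using W by (intro mult_right_mono mult_left_mono) auto
    also have "\<dots> = (2 * D) * (real s powr q * \<epsilon> powr (- (2 / \<tau>)))"
      by simp
    also have "\<dots> \<le> max 1 (2 * D) * (real s powr q * \<epsilon> powr (- (2 / \<tau>)))"
      by (intro mult_right_mono) auto
    finally have 1: "2 * ?W * \<epsilon> powr (- (2 / \<tau>)) \<le> max 1 (2 * D) * (real s powr q * \<epsilon> powr (- (2 / \<tau>)))" .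
    have "1 * (1 * 1) \<le> max 1 (2 * D) * (real s powr q * \<epsilon> powr (- (2 / \<tau>)))"
      using sq ep by (intro mult_mono) auto
    with 1 have "max 1 (2 * ?W * \<epsilon> powr (- (2 / \<tau>))) \<le> max 1 (2 * D) * (real s powr q * \<epsilon> powr (- (2 / \<tau>)))"
      by simp
    then have "real b * max 1 (2 * ?W * \<epsilon> powr (- (2 / \<tau>))) \<le> c * real s powr q * \<epsilon> powr (- (2 / \<tau>))"
      unfolding c_def mult.assoc by (rule mult_left_mono) simp
    moreover have "real (N_min H ip \<epsilon> s) \<le> real b * max 1 (2 * ?W * \<epsilon> powr (- (2 / \<tau>)))"
      using N_min_bound(2)[OF s \<epsilon>(1) \<tau>] by simp
    ultimately show "real (N_min H ip \<epsilon> s) \<le> c * real s powr q * \<epsilon> powr (- (2 / \<tau>))"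
      by linarith
  qed
  moreover have "c \<ge> 0" unfolding c_def by simp
  ultimately show ?thesis unfolding \<tau>_def by blast
qed

lemma QMC_bound_mono:
  assumes "QMC_bound H ip c p q" "p \<le> p'" "q \<le> q'" "c \<ge> 0"
  shows "QMC_bound H ip c p' q'"
  unfolding QMC_bound_def
proof (intro allI impI ballI)
  fix s :: nat and \<epsilon> :: real assume s: "s \<ge> 1" and \<epsilon>: "\<epsilon> \<in> {0<..<1}"
  have "real (N_min H ip \<epsilon> s) \<le> c * real s powr q * \<epsilon> powr (- p)"
    using assms(1) s \<epsilon> unfolding QMC_bound_def by blast
  also have "\<dots> \<le> c * real s powr q' * \<epsilon> powr (- p')"
    using assms(2-) s \<epsilon> by (intro mult_mono powr_mono powr_mono') auto
  finally show "real (N_min H ip \<epsilon> s) \<le> c * real s powr q' * \<epsilon> powr (- p')" .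
qed

text \<open>This is the case \<open>\<tau> = 1\<close>, the endpoint
  \<open>\<delta> = (\<alpha> - 1) / 2\<close>, for which \<open>weight_sum\<close> takes the form
  used in the condition for weak tractability. The absolute value allows for weight sums below
  1.\<close>

lemma ln_N_min_le:
  assumes s: "s \<ge> 1" and \<epsilon>: "0 < \<epsilon>" "\<epsilon> < 1"
  shows "0 \<le> ln (real (N_min H ip \<epsilon> s))"
    and "ln (real (N_min H ip \<epsilon> s))
      \<le> ln (real b) + ln 2 + \<bar>ln (weight_sum b \<gamma> w 1 \<alpha> s)\<bar> + 2 * ln (1 / \<epsilon>)"
proof -
  let ?W = "weight_sum b \<gamma> w 1 \<alpha> s"
  have W: "?W > 0" by (rule weight_sum_pos[OF s alpha])
  have N: "1 \<le> N_min H ip \<epsilon> s" "real (N_min H ip \<epsilon> s) \<le> real b * max 1 (2 * ?W * \<epsilon> powr (- 2))"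
    using N_min_bound[OF s \<epsilon>(1), of 1] alpha by auto
  show "0 \<le> ln (real (N_min H ip \<epsilon> s))" using N(1) by simp
  let ?E = "\<epsilon> powr (- 2)"
  have E: "?E > 0" using \<epsilon> by simp
  have lnE: "ln ?E = 2 * ln (1 / \<epsilon>)" using \<epsilon> by (simp add: ln_powr ln_div)
  have E0: "0 \<le> ln (1 / \<epsilon>)" using \<epsilon> by simp
  have "ln (max 1 (2 * ?W * ?E)) \<le> ln 2 + \<bar>ln ?W\<bar> + 2 * ln (1 / \<epsilon>)"
  proof (cases "2 * ?W * ?E \<le> 1")
    case True
    then have "max 1 (2 * ?W * ?E) = 1" by simp
    moreover have "0 \<le> ln 2 + \<bar>ln ?W\<bar> + 2 * ln (1 / \<epsilon>)"
      using E0 ln_gt_zero[of 2] by linarith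
    ultimately show ?thesis by simp
  next
    case False
    then have "max 1 (2 * ?W * ?E) = 2 * ?W * ?E" by simp
    then have "ln (max 1 (2 * ?W * ?E)) = ln 2 + ln ?W + ln ?E"
      using W E by (simp only: ln_mult_pos mult_pos_pos zero_less_numeral)
    then show ?thesis unfolding lnE by linarith
  qed
  moreover have "ln (real (N_min H ip \<epsilon> s)) \<le> ln (real b * max 1 (2 * ?W * ?E))"
    using N by (intro ln_mono) auto
  moreover have "ln (real b * max 1 (2 * ?W * ?E)) = ln (real b) + ln (max 1 (2 * ?W * ?E))"
    using b_ge_2 by (intro ln_mult_pos) (auto simp: less_max_iff_disj)
  ultimately show "ln (real (N_min H ip \<epsilon> s)) \<le> ln (real b) + ln 2 + \<bar>ln ?W\<bar> + 2 * ln (1 / \<epsilon>)"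
    by linarith
qed

text \<open>The limit is joint: s may stay bounded while \<open>\<epsilon>\<close> tends to 0, or
  the other way round. With x = s + 1 / \<open>\<epsilon>\<close> the weights contribute at most a
  constant plus a small multiple of s \<le> x, and the remaining term
  \<open>2 * ln (1 / \<epsilon>) \<le> 2 * ln x\<close> is o(x).\<close>

lemma weak_tractability:
  assumes lim: "(\<lambda>s. ln (weight_sum b \<gamma> w 1 \<alpha> s) / real s) \<longlonglongrightarrow> 0"
  shows "weakly_QMC_tractable H ip"
proof -
  let ?L = "\<lambda>s. \<bar>ln (weight_sum b \<gamma> w 1 \<alpha> s)\<bar>"
  let ?F = "inf (filtercomap (\<lambda>(s, \<epsilon>). real s + 1 / \<epsilon>) at_top) (principal ({1::nat..} \<times> {0<..<1::real}))"
  have ev: "eventually P ?F" if "\<And>s \<epsilon>. s \<ge> 1 \<Longrightarrow> 0 < \<epsilon> \<Longrightarrow> \<epsilon> < 1 \<Longrightarrow> x0 \<le> real s + 1 / \<epsilon> \<Longrightarrow> P (s, \<epsilon>)" for P x0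
    unfolding eventually_inf_principal eventually_filtercomap
    by (rule exI[of _ "\<lambda>x. x0 \<le> x"]) (use that in \<open>auto simp: eventually_ge_at_top\<close>)
  have "\<forall>\<^sub>F x in ?F. dist (case x of (s, \<epsilon>) \<Rightarrow> ln (real (N_min H ip \<epsilon> s)) / (real s + 1 / \<epsilon>)) 0 < e" if e: "e > 0" for e
  proof -
    obtain S where S: "\<And>s. s \<ge> S \<Longrightarrow> \<bar>ln (weight_sum b \<gamma> w 1 \<alpha> s) / real s\<bar> < e / 4"
      using tendstoD[OF lim, of "e / 4"] e by (auto simp: eventually_sequentially dist_real_def)
    \<comment> \<open>The hypothesis gives no bound for the finitely many s below S; their
      contribution is the constant B.\<close>
    define B where "B = (\<Sum>s<S. ?L s)"
    have L: "?L s \<le> B + e / 4 * real s" if "s \<ge> 1" for s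
    proof (cases "s < S")
      case True
      then have "?L s \<le> B" unfolding B_def by (intro member_le_sum) auto
      moreover have "0 \<le> e / 4 * real s" using e by simp
      ultimately show ?thesis by linarith
    next
      case False
      then have "?L s / real s < e / 4" using S[of s] that by simp
      then have "?L s < e / 4 * real s" using that by (simp add: pos_divide_less_eq)
      moreover have "0 \<le> B" unfolding B_def by (intro sum_nonneg) simp
      ultimately show ?thesis by linarith
    qed
    define A where "A = ln (real b) + ln 2 + B"
    have "((\<lambda>x. A / x + 2 * (ln x / x)) \<longlongrightarrow> 0 + 2 * 0) (at_top :: real filter)"
      by (intro tendsto_add tendsto_mult tendsto_const ln_x_over_x_tendsto_0
          tendsto_divide_0[OF tendsto_const] filterlim_at_top_imp_at_infinity filterlim_ident)
    then have "\<forall>\<^sub>F x in at_top. A / x + 2 * (ln x / x) < e / 4"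
      using e by (intro order_tendstoD(2)[where a = "e / 4"]) auto
    then obtain x0 where x0: "\<And>x. x \<ge> x0 \<Longrightarrow> A / x + 2 * (ln x / x) < e / 4"
      by (auto simp: eventually_at_top_linorder)
    show ?thesis
    proof (rule ev[of x0])
      fix s \<epsilon> assume s: "(s::nat) \<ge> 1" and \<epsilon>: "0 < (\<epsilon>::real)" "\<epsilon> < 1" and x: "x0 \<le> real s + 1 / \<epsilon>"
      define x where "x = real s + 1 / \<epsilon>"
      have x0': "x > 0" "1 / \<epsilon> \<le> x" "real s \<le> x" using s \<epsilon> by (auto simp: x_def add_pos_pos)
      have "ln (1 / \<epsilon>) \<le> ln x" using x0' \<epsilon> by (intro ln_mono) auto
      moreover have "e / 4 * real s \<le> e / 4 * x" using x0'(3) e by (intro mult_left_mono) auto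
      ultimately have "ln (real (N_min H ip \<epsilon> s)) \<le> A + 2 * ln x + e / 4 * x"
        using ln_N_min_le(2)[OF s \<epsilon>] L[OF s] unfolding A_def by linarith
      then have "ln (real (N_min H ip \<epsilon> s)) / x \<le> (A + 2 * ln x + e / 4 * x) / x"
        using x0' by (intro divide_right_mono) auto
      also have "\<dots> = A / x + 2 * (ln x / x) + e / 4"
        using x0' by (simp add: add_divide_distrib)
      also have "\<dots> < e"
        using x0[of x] x e unfolding x_def by linarith
      finally have "ln (real (N_min H ip \<epsilon> s)) / x < e" .
      moreover have "0 \<le> ln (real (N_min H ip \<epsilon> s)) / x"
        using ln_N_min_le(1)[OF s \<epsilon>] x0' by simp
      ultimately show "dist (case (s, \<epsilon>) of (s, \<epsilon>) \<Rightarrow> ln (real (N_min H ip \<epsilon> s)) / (real s + 1 / \<epsilon>)) 0 < e"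
        unfolding x_def by (simp only: prod.case dist_real_def diff_zero abs_of_nonneg)
    qed
  qed
  then show ?thesis
    unfolding weakly_QMC_tractable_def by (rule tendstoI)
qed

end

theorem corollary1:
  fixes b :: nat and \<alpha> :: real and \<gamma> :: "nat set \<Rightarrow> real" and w :: "nat \<Rightarrow> nat"
    and H :: spaces and ip :: inner_products
  assumes "prime b" and "\<alpha> > 1"
    and "\<And>u. finite u \<Longrightarrow> u \<subseteq> {1..} \<Longrightarrow> \<gamma> u > 0" and "\<gamma> {} = 1"
    and "\<And>j. j \<ge> 1 \<Longrightarrow> w j \<le> w (Suc j)"
    and "\<And>s. s \<ge> 1 \<Longrightarrow> rkhs (unit_cube s) (korobov_kernel \<alpha> \<gamma> s) (H s) (ip s)"
  shows
    "(\<forall>s\<ge>1. \<forall>m\<ge>1. \<forall>z. reduced_cbc H ip b w m s z \<longrightarrow>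
        (\<forall>\<delta>\<in>{0<..(\<alpha> - 1) / 2}.
           lattice_wce H ip (b ^ m) s z
             \<le> (2 * weight_sum b \<gamma> w (1 / (\<alpha> - 2 * \<delta>)) (\<alpha> / (\<alpha> - 2 * \<delta>)) s) powr (\<alpha> / 2 - \<delta>)
                * real (b ^ m) powr (- \<alpha> / 2 + \<delta>)))
     \<and> (\<forall>\<delta>\<in>{0<..(\<alpha> - 1) / 2}. \<forall>q\<ge>0. C_const b \<alpha> \<gamma> w \<delta> q < \<infinity> \<longrightarrow>
          (\<forall>s\<ge>1. \<forall>m\<ge>1. \<forall>z. reduced_cbc H ip b w m s z \<longrightarrow>
             lattice_wce H ip (b ^ m) s z
               \<le> (2 * real s powr q * real_of_ereal (C_const b \<alpha> \<gamma> w \<delta> q)) powr (\<alpha> / 2 - \<delta>)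
                  * real (b ^ m) powr (- \<alpha> / 2 + \<delta>))
          \<and> polynomially_QMC_tractable H ip
          \<and> QMC_exponents_at_most H ip (2 / (\<alpha> - 2 * \<delta>)) q)
     \<and> (\<forall>\<delta>\<in>{0<..(\<alpha> - 1) / 2}. C_const b \<alpha> \<gamma> w \<delta> 0 < \<infinity> \<longrightarrow>
          (\<forall>s\<ge>1. \<forall>m\<ge>1. \<forall>z. reduced_cbc H ip b w m s z \<longrightarrow>
             lattice_wce H ip (b ^ m) s z
               \<le> (2 * real_of_ereal (C_const b \<alpha> \<gamma> w \<delta> 0)) powr (\<alpha> / 2 - \<delta>)
                  * real (b ^ m) powr (- \<alpha> / 2 + \<delta>))
          \<and> strongly_QMC_tractable H ip
          \<and> strong_QMC_exponent H ip \<le> 2 / (\<alpha> - 2 * \<delta>))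
     \<and> (((\<lambda>s. ln (weight_sum b \<gamma> w 1 \<alpha> s) / real s) \<longlonglongrightarrow> 0) \<longrightarrow>
          weakly_QMC_tractable H ip)"
proof -
  interpret korobov_sequence b \<alpha> \<gamma> w H ip
    by (rule korobov_sequence.intro) (fact assms)+
  have strong: "strongly_QMC_tractable H ip \<and> strong_QMC_exponent H ip \<le> 2 / (\<alpha> - 2 * \<delta>)"
    if \<delta>: "\<delta> \<in> {0<..(\<alpha> - 1) / 2}" and C: "C_const b \<alpha> \<gamma> w \<delta> 0 < \<infinity>" for \<delta>
  proof -
    have p: "0 \<le> 2 / (\<alpha> - 2 * \<delta>)" using \<delta> by auto
    have ex: "\<exists>c\<ge>0. QMC_bound H ip c (2 / (\<alpha> - 2 * \<delta>)) 0"
      using C_const_QMC_bound[of \<delta> 0] \<delta> C by auto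
    have "strong_QMC_exponent H ip \<le> 2 / (\<alpha> - 2 * \<delta>)"
      unfolding strong_QMC_exponent_def using p ex by (intro cInf_lower bdd_belowI[of _ 0]) auto
    then show ?thesis
      unfolding strongly_QMC_tractable_def using p ex by blast
  qed
  have poly: "polynomially_QMC_tractable H ip \<and> QMC_exponents_at_most H ip (2 / (\<alpha> - 2 * \<delta>)) q"
    if \<delta>: "\<delta> \<in> {0<..(\<alpha> - 1) / 2}" and q: "0 \<le> q" and C: "C_const b \<alpha> \<gamma> w \<delta> q < \<infinity>" for \<delta> q
  proof -
    have p: "0 \<le> 2 / (\<alpha> - 2 * \<delta>)" using \<delta> by auto
    obtain c where c: "c \<ge> 0" "QMC_bound H ip c (2 / (\<alpha> - 2 * \<delta>)) q"
      using C_const_QMC_bound[of \<delta> q] \<delta> q C by auto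
    have "QMC_exponents_at_most H ip (2 / (\<alpha> - 2 * \<delta>)) q"
      unfolding QMC_exponents_at_most_def using QMC_bound_mono[OF c(2) _ _ c(1)] c(1) by (meson less_imp_le)
    then show ?thesis
      unfolding polynomially_QMC_tractable_def using p q c by blast
  qed
  have exps: "\<alpha> / 2 - \<delta> = (\<alpha> - 2 * \<delta>) / 2" "- \<alpha> / 2 + \<delta> = - (\<alpha> - 2 * \<delta>) / 2" for \<delta>
    by (simp_all add: field_simps)
  show ?thesis
  proof (intro conjI allI impI ballI)
    fix s m :: nat and z \<delta>
    assume "s \<ge> 1" "m \<ge> 1" "reduced_cbc H ip b w m s z" "\<delta> \<in> {0<..(\<alpha> - 1) / 2}"
    then show "lattice_wce H ip (b ^ m) s z
        \<le> (2 * weight_sum b \<gamma> w (1 / (\<alpha> - 2 * \<delta>)) (\<alpha> / (\<alpha> - 2 * \<delta>)) s) powr (\<alpha> / 2 - \<delta>)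
          * real (b ^ m) powr (- \<alpha> / 2 + \<delta>)"
      unfolding exps by (intro cbc_error_bound) auto
  next
    fix \<delta> q and s m :: nat and z
    assume "\<delta> \<in> {0<..(\<alpha> - 1) / 2}" "C_const b \<alpha> \<gamma> w \<delta> q < \<infinity>" "s \<ge> 1" "m \<ge> 1" "reduced_cbc H ip b w m s z"
    then show "lattice_wce H ip (b ^ m) s z
        \<le> (2 * real s powr q * real_of_ereal (C_const b \<alpha> \<gamma> w \<delta> q)) powr (\<alpha> / 2 - \<delta>)
          * real (b ^ m) powr (- \<alpha> / 2 + \<delta>)"
      by (intro C_const_error_bound) auto
  next
    fix \<delta> and s m :: nat and z
    assume "\<delta> \<in> {0<..(\<alpha> - 1) / 2}" "C_const b \<alpha> \<gamma> w \<delta> 0 < \<infinity>" "s \<ge> 1" "m \<ge> 1" "reduced_cbc H ip b w m s z"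
    then show "lattice_wce H ip (b ^ m) s z
        \<le> (2 * real_of_ereal (C_const b \<alpha> \<gamma> w \<delta> 0)) powr (\<alpha> / 2 - \<delta>)
          * real (b ^ m) powr (- \<alpha> / 2 + \<delta>)"
      \<comment> \<open>This is the case q = 0: as s \<ge> 1, \<open>real s powr 0\<close> is
        1.\<close>
      using C_const_error_bound[of \<delta> 0 s m z] by simp
  qed (use poly strong weak_tractability in blast)+
qed

end
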